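(* Consider the constrained decentralized problem $\min_{x\in\mathcal X} f(x)=\sum_{i=1}^m f_i(x^{(i)})$ subject to $\mathcal A x=0$, with $f_i=\tilde f_i+\mu\nu_i$, $\mu\ge 0$, $\tilde f_i$ convex and $\tilde L$-smooth, $\nu_i$ $1$-strongly convex, and a stochastic first-order oracle with variance parameter $\sigma^2$, all as described in the context. Let $V(\hat x,x)=\|\hat x-x\|_2^2$. Let $N$ be the pre-determined number of outer iterations of the I-PDS algorithm, let $\tau:=2\sqrt{\tilde L/\mu}$ and $\Delta:=\lceil 2\tau+1\rceil$ if $\mu>0$, and $\Delta:=+\infty$ if $\mu=0$. Set the parameters of the I-PDS algorithm, with constants $R>0$, $c>0$, as follows. For all $k\le\Delta$: $$\tau_k=\tfrac{k-1}{2},\quad \lambda_k=\tfrac{k-1}{k},\quad \beta_k=k,\quad p_k=\tfrac{4\tilde L}{k},\quad T_k=\Big\lceil\tfrac{kR\|\mathcal A\|}{\tilde L}\Big\rceil,\quad c_k=\Big\lceil\tfrac{\min\{N,\Delta\}\beta_k c}{p_k\tilde L}\Big\rceil .$$ For all $k\ge\Delta+1$: $$\tau_k=\tau,\quad \lambda_k=\lambda:=\tfrac{\tau}{1+\tau},\quad \beta_k=\Delta\lambda^{-(k-\Delta)},\quad p_k=\tfrac{2\tilde L}{1+\tau},\quad T_k=\Big\lceil\tfrac{2(1+\tau)R\|\mathcal A\|}{\tilde L\,\lambda^{(k-\Delta)/2}}\Big\rceil,\quad c_k=\Big\lceil\tfrac{(1+\tau)^2\Delta c}{\tilde L^2\,\lambda^{(k+N-2\Delta)/2}}\Big\rceil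 .$$ For all $k$ and $t$: $$\eta_k^t=(p_k+\mu)(t-1)+p_kT_k,\qquad q_k^t=\tfrac{\tilde L T_k}{4\beta_kR^2},\qquad \alpha_k^t=\begin{cases}\tfrac{\beta_{k-1}T_k}{\beta_kT_{k-1}} & k\ge2,\ t=1,\\ 1&\text{otherwise.}\end{cases}$$ Then, for suitable choices of $N$, $R$, $c$ and of the tolerances $\varepsilon_k^t$ of the CGS procedure, the following hold. (i) If the problem is smooth and convex ($\mu=0$), the I-PDS algorithm with the CGS procedure as subproblem solver returns an $\varepsilon$-approximate solution with sampling complexity $O\big(\sqrt{\tilde L/\varepsilon}+\sigma^2/\varepsilon^2\big)$, communication complexity $O\big(\|\mathcal A\|/\varepsilon\big)$ and linear oracle complexity $O\big(1/\varepsilon^2\big)$. (ii) If the problem is smooth and $\mu$-strongly convex ($\mu>0$), the I-PDS algorithm with the CGS procedure as subproblem solver returns an $\varepsilon$-approximate solution with sampling complexity $O\big(\sqrt{\tilde L/\mu}\,\log(\tilde L/\varepsilon)+\sigma^2/\varepsilon\big)$, communication complexity $O\big(\|\mathcal A\|/\sqrt{\varepsilon}\big)$ and linear oracle complexity $O\big(1/\varepsilon^2\big)$.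
   Context: **Problem.** $G$ is a connected undirected graph on workers $\{1,\dots,m\}$ with Laplacian $\mathcal L\in\mathbb R^{m\times m}$; $\mathcal A=\mathcal L\otimes I_d\in\mathbb R^{md\times md}$; $\|\mathcal A\|$ is its spectral norm. $\mathcal X=\mathcal X_1\times\dots\times\mathcal X_m$ with each $\mathcal X_i\subset\mathbb R^d$ nonempty, convex and compact; $x=(x^{(1)},\dots,x^{(m)})\in\mathcal X$. For each $i$, $f_i=\tilde f_i+\mu\nu_i$ with $\mu\ge0$, $\tilde f_i:\mathbb R^d\to\mathbb R$ convex, differentiable and $\tilde L$-smooth (that is, $\tilde f_i(y)-\tilde f_i(x)-\langle\nabla\tilde f_i(x),y-x\rangle\le\frac{\tilde L}{2}\|x-y\|_2^2$ for all $x,y$), and $\nu_i$ $1$-strongly convex. Write $f(x)=\sum_i f_i(x^{(i)})$, $\tilde f(x)=\sum_i\tilde f_i(x^{(i)})$, $\nu(x)=\sum_i\nu_i(x^{(i)})$. $V(\hat x,x)=\nu(x)-\nu(\hat x)-\langle\nabla\nu(\hat x),x-\hat x\rangle$ is the prox function generated by $\nu$; here it is taken to be $V(\hat x,x)=\|\hat x-x\|_2^2$ (so $\nu$ equals $\|x\|_2^2$ up to an affine function). It is assumed that the saddle point problem $\min_{x\in\mathcal X}\max_{z\in\mathbb R^{md}}f(x)+\langle\mathcal Ax,z\rangle$ has a solution $(x^*,z^* )$; $f^*=f(x^* )$. **Stochastic oracle.** At outer iteration $k$ each worker $i$ can draw, with batch size $c_k$ and fresh randomness, an estimate $v_k^{(i)}$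 of $\nabla\tilde f_i$ at a query point which, conditionally on the past, is unbiased and has expected squared error $\le\sigma^2/c_k$ in $\|\cdot\|_2$. If $\sigma=0$ exact gradients are used. **I-PDS algorithm.** Choose $x_0\in\mathcal X$; set $\hat x_0=\underline x_0=x_{-1}=x_0$, $z_0=0$. For $k=1,\dots,N$: - $\tilde x_k=x_{k-1}+\lambda_k(\hat x_{k-1}-x_{k-2})$, $\ \underline x_k=(\tilde x_k+\tau_k\underline x_{k-1})/(1+\tau_k)$; draw $v_k=(v_k^{(1)},\dots,v_k^{(m)})$ with conditional mean $\nabla\tilde f(\underline x_k)$ and batch size $c_k$ at each node. - Set $x_k^0=x_{k-1}$, $z_k^0=z_{k-1}$, $x_k^{-1}=x_{k-1}^{T_{k-1}-1}$ (with $x_1^{-1}=x_0$). For $t=1,\dots,T_k$: $\tilde u_k^t=x_k^{t-1}+\alpha_k^t(x_k^{t-1}-x_k^{t-2})$; $z_k^t=z_k^{t-1}+\mathcal A\tilde u_k^t/q_k^t$; and $x_k^t\in\mathcal X$ is an approximate solution, computed by the CGS procedure with tolerance $\varepsilon_k^t$, of $$\min_{x\in\mathcal X}\ \Phi_k^t(x):=\mu\nu(x)+\langle v_k+\mathcal A^\top z_k^t,x\rangle+\eta_k^tV(x_k^{t-1},x)+p_kV(x_{k-1},x).$$ - Set $x_k=x_k^{T_k}$, $z_k=z_k^{T_k}$, $\hat x_k=\frac1{T_k}\sum_{t=1}^{T_k}x_k^t$, $\hat z_k=\frac1{T_k}\sum_{t=1}^{T_k}z_k^t$. Output $\bar x_N=\big(\sum_{k=1}^N\beta_k\big)^{-1}\sum_{k=1}^N\beta_k\hat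 x_k$. **CGS procedure.** Since $V$ is the squared Euclidean distance, $\Phi_k^t$ equals, up to an additive constant, $\phi(x)=\langle g,x\rangle+\frac\beta2\|x-u\|_2^2$ for suitable $g$, $u\in\mathcal X$, $\beta>0$. Start from $u_0=u$. For $s=1,2,\dots$: compute by one linear optimization over $\mathcal X$ a maximizer $v$ of $x\mapsto\langle\nabla\phi(u_{s-1}),u_{s-1}-x\rangle$ over $\mathcal X$; if the maximum (the Wolfe gap) is at most the tolerance $\varepsilon_k^t$, stop and return $u_{s-1}$; otherwise set $u_s=(1-\alpha)u_{s-1}+\alpha v$ with $\alpha=\min\{1,\langle\beta(u-u_{s-1})-g,v-u_{s-1}\rangle/(\beta\|v-u_{s-1}\|_2^2)\}$. **Accuracy and complexity.** The output $\bar x_N$ is an $\varepsilon$-approximate solution if $f(\bar x_N)-f^*\le\varepsilon$ and $\|\mathcal A\bar x_N\|_2\le\varepsilon$, both in expectation when $\sigma>0$. Sampling complexity: $\sum_{k=1}^Nc_k$ (gradient samples per worker). Communication complexity: number of communication rounds, $2\sum_{k=1}^NT_k$ (each multiplication by $\mathcal A$ or $\mathcal A^\top$ is a round). Linear oracle (LO) complexity: total number of linear optimizations over $\mathcal X$. The $O(\cdot)$ is as $\varepsilon\to0$; the hidden constants do not depend on $\varepsilon$ and may depend on the remaining fixed problem data (such as $m$, the diameter of $\mathcal X$, $\|x_0-x^*\|_2$, $\|z^*\|_2$, and the other parameters not displayed in a given bound). *)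

theory Defs
  imports "HOL-Analysis.Analysis" "HOL-Probability.Probability"
begin

(* A point of R^{md} is an element of real^'d^'m: 'm is the set of workers, x $ i in R^d is the
   block of worker i, and inner product and norm are the Euclidean ones of R^{md}. *)

section \<open>Problem data\<close>

definition laplacian :: "('m \<Rightarrow> 'm \<Rightarrow> bool) \<Rightarrow> real^'m^'m" where
  "laplacian E = (\<chi> i j. if i = j then real (card {l. E i l}) else if E i j then -1 else 0)"

text \<open>The action of the Kronecker product of a matrix \<open>B\<close> with the identity of size d.\<close>

definition kron_id :: "real^'m^'m \<Rightarrow> real^'d^'m \<Rightarrow> real^'d^'m" where
  "kron_id B x = (\<chi> i. \<Sum>j\<in>UNIV. B $ i $ j *\<^sub>R x $ j)"

record ('m, 'd) problem =
  edge :: "'m \<Rightarrow> 'm \<Rightarrow> bool"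
  Xset :: "'m \<Rightarrow> (real^'d) set"
  ft :: "'m \<Rightarrow> real^'d \<Rightarrow> real"
  gft :: "'m \<Rightarrow> real^'d \<Rightarrow> real^'d"    \<comment> \<open>gradients of \<open>ft\<close>\<close>
  nu :: "'m \<Rightarrow> real^'d \<Rightarrow> real"
  gnu :: "'m \<Rightarrow> real^'d \<Rightarrow> real^'d"    \<comment> \<open>gradients of \<open>nu\<close>\<close>
  mu :: real
  Lt :: real
  noise :: real    \<comment> \<open>the standard deviation parameter \<open>\<sigma>\<close> of the stochastic oracle\<close>
  x0 :: "real^'d^'m"
  xstar :: "real^'d^'m"
  zstar :: "real^'d^'m"

definition feas :: "('m::finite, 'd::finite) problem \<Rightarrow> (real^'d^'m) set" where
  "feas P = {x. \<forall>i. x $ i \<in> Xset P i}"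

definition Aop :: "('m::finite, 'd::finite) problem \<Rightarrow> real^'d^'m \<Rightarrow> real^'d^'m" where
  "Aop P = kron_id (laplacian (edge P))"

definition nu_sum :: "('m::finite, 'd::finite) problem \<Rightarrow> real^'d^'m \<Rightarrow> real" where
  "nu_sum P x = (\<Sum>i\<in>UNIV. nu P i (x $ i))"

definition grad_nu :: "('m::finite, 'd::finite) problem \<Rightarrow> real^'d^'m \<Rightarrow> real^'d^'m" where
  "grad_nu P x = (\<chi> i. gnu P i (x $ i))"

definition grad_ft :: "('m::finite, 'd::finite) problem \<Rightarrow> real^'d^'m \<Rightarrow> real^'d^'m" where
  "grad_ft P x = (\<chi> i. gft P i (x $ i))"

definition obj :: "('m::finite, 'd::finite) problem \<Rightarrow> real^'d^'m \<Rightarrow> real" where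
  "obj P x = (\<Sum>i\<in>UNIV. ft P i (x $ i) + mu P * nu P i (x $ i))"

definition prox :: "('m::finite, 'd::finite) problem \<Rightarrow> real^'d^'m \<Rightarrow> real^'d^'m \<Rightarrow> real" where
  "prox P xh x = nu_sum P x - nu_sum P xh - grad_nu P xh \<bullet> (x - xh)"

definition smooth_with :: "real \<Rightarrow> (real^'d \<Rightarrow> real) \<Rightarrow> (real^'d \<Rightarrow> real^'d) \<Rightarrow> bool" where
  "smooth_with L h gh \<longleftrightarrow>
     (\<forall>x y. h y - h x - gh x \<bullet> (y - x) \<le> L / 2 * (norm (x - y))\<^sup>2)"

definition strongly_convex_with :: "real \<Rightarrow> (real^'d \<Rightarrow> real) \<Rightarrow> (real^'d \<Rightarrow> real^'d) \<Rightarrow> bool" where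
  "strongly_convex_with s h gh \<longleftrightarrow>
     (\<forall>x y. h y - h x - gh x \<bullet> (y - x) \<ge> s / 2 * (norm (x - y))\<^sup>2)"

definition saddle_point :: "('m::finite, 'd::finite) problem \<Rightarrow> real^'d^'m \<Rightarrow> real^'d^'m \<Rightarrow> bool" where
  "saddle_point P xs zs \<longleftrightarrow> xs \<in> feas P \<and>
     (\<forall>z. obj P xs + Aop P xs \<bullet> z \<le> obj P xs + Aop P xs \<bullet> zs) \<and>
     (\<forall>x\<in>feas P. obj P xs + Aop P xs \<bullet> zs \<le> obj P x + Aop P x \<bullet> zs)"

text \<open>\<open>Lt > 0\<close> and at least two workers: the parameters divide by \<open>Lt\<close>, and for a single
  worker the Laplacian vanishes, so that all the inner loops would have length 0 (and the averages
  over them would be undefined).\<close>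

definition pds_problem :: "('m::finite, 'd::finite) problem \<Rightarrow> bool" where
  "pds_problem P \<longleftrightarrow>
     CARD('m) \<ge> 2 \<and>
     symp (edge P) \<and> irreflp (edge P) \<and> (\<forall>i j. (edge P)\<^sup>*\<^sup>* i j) \<and>
     (\<forall>i. Xset P i \<noteq> {} \<and> convex (Xset P i) \<and> compact (Xset P i)) \<and>
     mu P \<ge> 0 \<and> Lt P > 0 \<and> noise P \<ge> 0 \<and>
     (\<forall>i. convex_on UNIV (ft P i) \<and> (\<forall>x. GDERIV (ft P i) x :> gft P i x) \<and>
          smooth_with (Lt P) (ft P i) (gft P i)) \<and>
     (\<forall>i. (\<forall>x. GDERIV (nu P i) x :> gnu P i x) \<and> strongly_convex_with 1 (nu P i) (gnu P i)) \<and>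
     (\<forall>xh x. prox P xh x = (norm (xh - x))\<^sup>2) \<and>
     x0 P \<in> feas P \<and> saddle_point P (xstar P) (zstar P)"

section \<open>The conditional gradient sliding (CGS) procedure\<close>

text \<open>A linear optimization oracle. Maximizing \<open>\<langle>g, y - x\<rangle>\<close> over \<open>x\<close> is minimizing \<open>\<langle>g, x\<rangle>\<close>.
  Ties are broken by an arbitrary Borel measurable rule, so that the iterates of a stochastic run
  are random variables.\<close>

definition lin_oracle :: "('a::euclidean_space) set \<Rightarrow> ('a \<Rightarrow> 'a) \<Rightarrow> bool" where
  "lin_oracle X lo \<longleftrightarrow> lo \<in> borel_measurable borel \<and>
     (\<forall>g. lo g \<in> X \<and> (\<forall>x\<in>X. g \<bullet> lo g \<le> g \<bullet> x))"

text \<open>The procedure minimizes \<open>\<langle>g, x\<rangle> + b/2 * \<parallel>x - u\<parallel>\<^sup>2\<close>, with gradient \<open>g + b (x - u)\<close>.\<close>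

primrec cgs_iter :: "('a::euclidean_space \<Rightarrow> 'a) \<Rightarrow> 'a \<Rightarrow> real \<Rightarrow> 'a \<Rightarrow> nat \<Rightarrow> 'a" where
  "cgs_iter lo g b u 0 = u"
| "cgs_iter lo g b u (Suc s) =
     (let y = cgs_iter lo g b u s;
          v = lo (g + b *\<^sub>R (y - u));
          a = min 1 (((b *\<^sub>R (u - y) - g) \<bullet> (v - y)) / (b * (norm (v - y))\<^sup>2))
      in (1 - a) *\<^sub>R y + a *\<^sub>R v)"

definition wolfe_gap :: "('a::euclidean_space \<Rightarrow> 'a) \<Rightarrow> 'a \<Rightarrow> real \<Rightarrow> 'a \<Rightarrow> 'a \<Rightarrow> real" where
  "wolfe_gap lo g b u y = (g + b *\<^sub>R (y - u)) \<bullet> (y - lo (g + b *\<^sub>R (y - u)))"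

definition cgs_output :: "('a::euclidean_space \<Rightarrow> 'a) \<Rightarrow> real \<Rightarrow> 'a \<Rightarrow> real \<Rightarrow> 'a \<Rightarrow> 'a" where
  "cgs_output lo e g b u =
     cgs_iter lo g b u (LEAST s. wolfe_gap lo g b u (cgs_iter lo g b u s) \<le> e)"

text \<open>Number of linear optimizations of one call, including the one that detects termination;
  it is \<open>\<infinity>\<close> if the procedure does not terminate.\<close>

definition cgs_calls :: "('a::euclidean_space \<Rightarrow> 'a) \<Rightarrow> real \<Rightarrow> 'a \<Rightarrow> real \<Rightarrow> 'a \<Rightarrow> enat" where
  "cgs_calls lo e g b u =
     (INF s \<in> {s. wolfe_gap lo g b u (cgs_iter lo g b u s) \<le> e}. enat (Suc s))"

section \<open>The I-PDS algorithm\<close>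

record ipds_params =
  pN :: nat
  ptau :: "nat \<Rightarrow> real"
  plam :: "nat \<Rightarrow> real"
  pbeta :: "nat \<Rightarrow> real"
  pp :: "nat \<Rightarrow> real"
  pT :: "nat \<Rightarrow> nat"
  pc :: "nat \<Rightarrow> nat"
  peta :: "nat \<Rightarrow> nat \<Rightarrow> real"
  pq :: "nat \<Rightarrow> nat \<Rightarrow> real"
  palpha :: "nat \<Rightarrow> nat \<Rightarrow> real"
  ptol :: "nat \<Rightarrow> nat \<Rightarrow> real"

text \<open>The subproblem objective, where \<open>w\<close> stands for \<open>v\<^sub>k + A\<^sup>T z\<^sub>k\<^sup>t\<close>, \<open>xt\<close> for the previous
  inner iterate and \<open>xp\<close> for the previous outer iterate.\<close>

definition subobj :: "('m::finite, 'd::finite) problem \<Rightarrow> real \<Rightarrow> real \<Rightarrow> real^'d^'m \<Rightarrow>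
    real^'d^'m \<Rightarrow> real^'d^'m \<Rightarrow> real^'d^'m \<Rightarrow> real" where
  "subobj P eta p w xt xp x = mu P * nu_sum P x + w \<bullet> x + eta * prox P xt x + p * prox P xp x"

definition sub_b :: "('m::finite, 'd::finite) problem \<Rightarrow> real \<Rightarrow> real \<Rightarrow> real" where
  "sub_b P eta p = 2 * (mu P + eta + p)"

definition sub_g :: "('m::finite, 'd::finite) problem \<Rightarrow> real \<Rightarrow> real \<Rightarrow> real^'d^'m \<Rightarrow>
    real^'d^'m \<Rightarrow> real^'d^'m \<Rightarrow> real^'d^'m \<Rightarrow> real^'d^'m" where
  "sub_g P eta p w xt xp u =
     w + mu P *\<^sub>R grad_nu P u + (2 * eta) *\<^sub>R (u - xt) + (2 * p) *\<^sub>R (u - xp)"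

text \<open>The quadratic form on which the CGS procedure is run is the subproblem objective up to an
  additive constant, whatever \<open>u\<close> is.\<close>

lemma subobj_quadratic:
  fixes P :: "('m::finite, 'd::finite) problem"
  assumes V: "\<And>xh x. prox P xh x = (norm (xh - x))\<^sup>2"
  shows "subobj P eta p w xt xp x =
    sub_g P eta p w xt xp u \<bullet> x + sub_b P eta p / 2 * (norm (x - u))\<^sup>2 +
    (subobj P eta p w xt xp u - sub_g P eta p w xt xp u \<bullet> u)"
proof -
  have nu: "nu_sum P x = nu_sum P u + grad_nu P u \<bullet> (x - u) + (norm (u - x))\<^sup>2"
    using V[of u x] unfolding prox_def by linarith
  show ?thesis
    unfolding subobj_def sub_g_def sub_b_def V nu
    by (simp add: power2_norm_eq_inner inner_diff_left inner_diff_right inner_add_left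
        inner_add_right inner_commute field_simps)
qed

text \<open>After outer iteration \<open>k\<close>: \<open>st_xprev\<close> is the outer iterate with index \<open>k - 1\<close>,
  \<open>st_xlast\<close> the inner iterate with index \<open>T\<^sub>k - 1\<close> (used for \<open>t = 1\<close> in outer iteration
  \<open>k + 1\<close>), \<open>st_xhat\<close> the average of the inner iterates, and \<open>st_xul\<close> the query point.\<close>

record ('m, 'd) ipds_state =
  st_x :: "real^'d^'m"
  st_xprev :: "real^'d^'m"
  st_xlast :: "real^'d^'m"
  st_xhat :: "real^'d^'m"
  st_xul :: "real^'d^'m"
  st_z :: "real^'d^'m"

definition query_point :: "ipds_params \<Rightarrow> nat \<Rightarrow> ('m::finite, 'd::finite) ipds_state \<Rightarrow> real^'d^'m" where
  "query_point a k s =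
     (1 / (1 + ptau a k)) *\<^sub>R
       ((st_x s + plam a k *\<^sub>R (st_xhat s - st_xprev s)) + ptau a k *\<^sub>R st_xul s)"

text \<open>In the following, \<open>lo\<close> is the linear optimization oracle, and \<open>start k t\<close> chooses, from the
  two prox centres \<open>x\<^sub>k\<^sup>t\<^sup>-\<^sup>1\<close> and \<open>x\<^sub>k\<^sub>-\<^sub>1\<close>, the point \<open>u\<close> of the quadratic form; it is left arbitrary.
  The components of \<open>inner_loop \<dots> t\<close> are \<open>x\<^sub>k\<^sup>t\<^sup>-\<^sup>1\<close>, \<open>x\<^sub>k\<^sup>t\<close>, \<open>z\<^sub>k\<^sup>t\<close>.\<close>

definition dual_step :: "('m::finite, 'd::finite) problem \<Rightarrow> ipds_params \<Rightarrow> nat \<Rightarrow> nat \<Rightarrow>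
    (real^'d^'m) \<times> (real^'d^'m) \<times> (real^'d^'m) \<Rightarrow> real^'d^'m" where
  "dual_step P a k t = (\<lambda>(xo, x, z).
     z + (1 / pq a k t) *\<^sub>R Aop P (x + palpha a k t *\<^sub>R (x - xo)))"

definition start_point :: "(nat \<Rightarrow> nat \<Rightarrow> real^'d^'m \<Rightarrow> real^'d^'m \<Rightarrow> real^'d^'m) \<Rightarrow> nat \<Rightarrow> nat \<Rightarrow>
    ('m::finite, 'd::finite) ipds_state \<Rightarrow>
    (real^'d^'m) \<times> (real^'d^'m) \<times> (real^'d^'m) \<Rightarrow> real^'d^'m" where
  "start_point start k t s = (\<lambda>(xo, x, z). start k t x (st_x s))"

definition sub_data :: "('m::finite, 'd::finite) problem \<Rightarrow> ipds_params \<Rightarrow>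
    (nat \<Rightarrow> nat \<Rightarrow> real^'d^'m \<Rightarrow> real^'d^'m \<Rightarrow> real^'d^'m) \<Rightarrow> nat \<Rightarrow> nat \<Rightarrow>
    ('m, 'd) ipds_state \<Rightarrow> real^'d^'m \<Rightarrow>
    (real^'d^'m) \<times> (real^'d^'m) \<times> (real^'d^'m) \<Rightarrow> real^'d^'m" where
  "sub_data P a start k t s v r =
     sub_g P (peta a k t) (pp a k) (v + adjoint (Aop P) (dual_step P a k t r))
       (fst (snd r)) (st_x s) (start_point start k t s r)"

primrec inner_loop :: "('m::finite, 'd::finite) problem \<Rightarrow> ipds_params \<Rightarrow>
    (real^'d^'m \<Rightarrow> real^'d^'m) \<Rightarrow> (nat \<Rightarrow> nat \<Rightarrow> real^'d^'m \<Rightarrow> real^'d^'m \<Rightarrow> real^'d^'m) \<Rightarrow>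
    nat \<Rightarrow> ('m, 'd) ipds_state \<Rightarrow> real^'d^'m \<Rightarrow> nat \<Rightarrow>
    (real^'d^'m) \<times> (real^'d^'m) \<times> (real^'d^'m)" where
  "inner_loop P a lo start k s v 0 = (st_xlast s, st_x s, st_z s)"
| "inner_loop P a lo start k s v (Suc t) =
     (let r = inner_loop P a lo start k s v t in
      (fst (snd r),
       cgs_output lo (ptol a k (Suc t)) (sub_data P a start k (Suc t) s v r)
         (sub_b P (peta a k (Suc t)) (pp a k)) (start_point start k (Suc t) s r),
       dual_step P a k (Suc t) r))"

definition outer_step :: "('m::finite, 'd::finite) problem \<Rightarrow> ipds_params \<Rightarrow>
    (real^'d^'m \<Rightarrow> real^'d^'m) \<Rightarrow> (nat \<Rightarrow> nat \<Rightarrow> real^'d^'m \<Rightarrow> real^'d^'m \<Rightarrow> real^'d^'m) \<Rightarrow>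
    nat \<Rightarrow> ('m, 'd) ipds_state \<Rightarrow> real^'d^'m \<Rightarrow> ('m, 'd) ipds_state" where
  "outer_step P a lo start k s v =
     (let r = inner_loop P a lo start k s v in
      \<lparr> st_x = fst (snd (r (pT a k))),
        st_xprev = st_x s,
        st_xlast = fst (r (pT a k)),
        st_xhat = (1 / real (pT a k)) *\<^sub>R (\<Sum>t=1..pT a k. fst (snd (r t))),
        st_xul = query_point a k s,
        st_z = snd (snd (r (pT a k))) \<rparr>)"

text \<open>\<open>w k\<close> is the gradient estimate used in outer iteration \<open>k\<close>.\<close>

primrec ipds :: "('m::finite, 'd::finite) problem \<Rightarrow> ipds_params \<Rightarrow>
    (real^'d^'m \<Rightarrow> real^'d^'m) \<Rightarrow> (nat \<Rightarrow> nat \<Rightarrow> real^'d^'m \<Rightarrow> real^'d^'m \<Rightarrow> real^'d^'m) \<Rightarrow>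
    (nat \<Rightarrow> real^'d^'m) \<Rightarrow> nat \<Rightarrow> ('m, 'd) ipds_state" where
  "ipds P a lo start w 0 =
     \<lparr> st_x = x0 P, st_xprev = x0 P, st_xlast = x0 P, st_xhat = x0 P, st_xul = x0 P, st_z = 0 \<rparr>"
| "ipds P a lo start w (Suc k) =
     outer_step P a lo start (Suc k) (ipds P a lo start w k) (w (Suc k))"

definition ipds_query :: "('m::finite, 'd::finite) problem \<Rightarrow> ipds_params \<Rightarrow>
    (real^'d^'m \<Rightarrow> real^'d^'m) \<Rightarrow> (nat \<Rightarrow> nat \<Rightarrow> real^'d^'m \<Rightarrow> real^'d^'m \<Rightarrow> real^'d^'m) \<Rightarrow>
    (nat \<Rightarrow> real^'d^'m) \<Rightarrow> nat \<Rightarrow> real^'d^'m" where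
  "ipds_query P a lo start w k = query_point a k (ipds P a lo start w (k - 1))"

definition ipds_output :: "('m::finite, 'd::finite) problem \<Rightarrow> ipds_params \<Rightarrow>
    (real^'d^'m \<Rightarrow> real^'d^'m) \<Rightarrow> (nat \<Rightarrow> nat \<Rightarrow> real^'d^'m \<Rightarrow> real^'d^'m \<Rightarrow> real^'d^'m) \<Rightarrow>
    (nat \<Rightarrow> real^'d^'m) \<Rightarrow> real^'d^'m" where
  "ipds_output P a lo start w =
     (1 / (\<Sum>k=1..pN a. pbeta a k)) *\<^sub>R
       (\<Sum>k=1..pN a. pbeta a k *\<^sub>R st_xhat (ipds P a lo start w k))"

definition sampling_complexity :: "ipds_params \<Rightarrow> nat" where
  "sampling_complexity a = (\<Sum>k=1..pN a. pc a k)"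

definition communication_complexity :: "ipds_params \<Rightarrow> nat" where
  "communication_complexity a = 2 * (\<Sum>k=1..pN a. pT a k)"

definition lo_complexity :: "('m::finite, 'd::finite) problem \<Rightarrow> ipds_params \<Rightarrow>
    (real^'d^'m \<Rightarrow> real^'d^'m) \<Rightarrow> (nat \<Rightarrow> nat \<Rightarrow> real^'d^'m \<Rightarrow> real^'d^'m \<Rightarrow> real^'d^'m) \<Rightarrow>
    (nat \<Rightarrow> real^'d^'m) \<Rightarrow> enat" where
  "lo_complexity P a lo start w =
     (\<Sum>k=1..pN a. \<Sum>t=1..pT a k.
        (let s = ipds P a lo start w (k - 1); r = inner_loop P a lo start k s (w k) (t - 1) in
         cgs_calls lo (ptol a k t) (sub_data P a start k t s (w k) r)
           (sub_b P (peta a k t) (pp a k)) (start_point start k t s r)))"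

section \<open>The stochastic oracle\<close>

text \<open>\<open>F (k - 1)\<close> is the information available before the samples of outer iteration \<open>k\<close> are
  drawn, and \<open>v k\<close> is the gradient estimate computed from these samples.\<close>

definition oracle_run :: "('m::finite, 'd::finite) problem \<Rightarrow> ipds_params \<Rightarrow>
    (real^'d^'m \<Rightarrow> real^'d^'m) \<Rightarrow> (nat \<Rightarrow> nat \<Rightarrow> real^'d^'m \<Rightarrow> real^'d^'m \<Rightarrow> real^'d^'m) \<Rightarrow>
    'w measure \<Rightarrow> (nat \<Rightarrow> 'w measure) \<Rightarrow> (nat \<Rightarrow> 'w \<Rightarrow> real^'d^'m) \<Rightarrow> bool" where
  "oracle_run P a lo start M F v \<longleftrightarrow>
     prob_space M \<and> filtration (space M) F \<and> (\<forall>k. subalgebra M (F k)) \<and>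
     (\<forall>k\<in>{1..pN a}.
        v k \<in> borel_measurable (F k) \<and>
        (\<forall>i j. integrable M (\<lambda>\<omega>. v k \<omega> $ i $ j) \<and>
           (AE \<omega> in M. real_cond_exp M (F (k - 1)) (\<lambda>\<omega>. v k \<omega> $ i $ j) \<omega> =
              grad_ft P (ipds_query P a lo start (\<lambda>l. v l \<omega>) k) $ i $ j)) \<and>
        (\<forall>i. AE \<omega> in M.
           nn_cond_exp M (F (k - 1)) (\<lambda>\<omega>. ennreal
             ((norm (v k \<omega> $ i - grad_ft P (ipds_query P a lo start (\<lambda>l. v l \<omega>) k) $ i))\<^sup>2)) \<omega>
           \<le> ennreal ((noise P)\<^sup>2 / real (pc a k))) \<and>
        (noise P = 0 \<longrightarrow>
           (\<forall>\<omega>\<in>space M. v k \<omega> = grad_ft P (ipds_query P a lo start (\<lambda>l. v l \<omega>) k))))"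

definition start_rule :: "(real^'d^'m) set \<Rightarrow>
    (nat \<Rightarrow> nat \<Rightarrow> real^'d^'m \<Rightarrow> real^'d^'m \<Rightarrow> real^'d^'m) \<Rightarrow> bool" where
  "start_rule X start \<longleftrightarrow> (\<forall>k t.
     (\<lambda>(x, y). start k t x y) \<in> borel_measurable borel \<and>
     (\<forall>x\<in>X. \<forall>y\<in>X. start k t x y \<in> X))"

definition eps_solution :: "('m::finite, 'd::finite) problem \<Rightarrow> 'w measure \<Rightarrow> real \<Rightarrow>
    ('w \<Rightarrow> real^'d^'m) \<Rightarrow> bool" where
  "eps_solution P M \<epsilon> xb \<longleftrightarrow>
     (if noise P = 0 then
        \<forall>\<omega>\<in>space M. obj P (xb \<omega>) - obj P (xstar P) \<le> \<epsilon> \<and> norm (Aop P (xb \<omega>)) \<le> \<epsilon>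
      else
        integrable M (\<lambda>\<omega>. obj P (xb \<omega>) - obj P (xstar P)) \<and>
        integrable M (\<lambda>\<omega>. norm (Aop P (xb \<omega>))) \<and>
        (\<integral>\<omega>. obj P (xb \<omega>) - obj P (xstar P) \<partial>M) \<le> \<epsilon> \<and>
        (\<integral>\<omega>. norm (Aop P (xb \<omega>)) \<partial>M) \<le> \<epsilon>)"

section \<open>The parameter choice\<close>

definition tau_of :: "real \<Rightarrow> real \<Rightarrow> real" where
  "tau_of L m = 2 * sqrt (L / m)"

definition Delta_of :: "real \<Rightarrow> real \<Rightarrow> enat" where
  "Delta_of L m = (if m > 0 then enat (nat \<lceil>2 * tau_of L m + 1\<rceil>) else \<infinity>)"

definition lam_of :: "real \<Rightarrow> real \<Rightarrow> real" where
  "lam_of L m = tau_of L m / (1 + tau_of L m)"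

definition beta_of :: "real \<Rightarrow> real \<Rightarrow> nat \<Rightarrow> real" where
  "beta_of L m k =
     (if enat k \<le> Delta_of L m then real k
      else (let D = real (the_enat (Delta_of L m)) in D * lam_of L m powr (- (real k - D))))"

definition p_of :: "real \<Rightarrow> real \<Rightarrow> nat \<Rightarrow> real" where
  "p_of L m k =
     (if enat k \<le> Delta_of L m then 4 * L / real k else 2 * L / (1 + tau_of L m))"

definition T_of :: "real \<Rightarrow> real \<Rightarrow> real \<Rightarrow> real \<Rightarrow> nat \<Rightarrow> nat" where
  "T_of L m A R k =
     (if enat k \<le> Delta_of L m then nat \<lceil>real k * R * A / L\<rceil>
      else (let D = real (the_enat (Delta_of L m)) in
        nat \<lceil>2 * (1 + tau_of L m) * R * A / (L * lam_of L m powr ((real k - D) / 2))\<rceil>))"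

definition c_of :: "real \<Rightarrow> real \<Rightarrow> nat \<Rightarrow> real \<Rightarrow> nat \<Rightarrow> nat" where
  "c_of L m N c k =
     (if enat k \<le> Delta_of L m
      then nat \<lceil>real (the_enat (min (enat N) (Delta_of L m))) * beta_of L m k * c / (p_of L m k * L)\<rceil>
      else (let D = real (the_enat (Delta_of L m)) in
        nat \<lceil>(1 + tau_of L m)\<^sup>2 * D * c /
             (L\<^sup>2 * lam_of L m powr ((real k + real N - 2 * D) / 2))\<rceil>))"

definition ipds_choice :: "('m::finite, 'd::finite) problem \<Rightarrow> nat \<Rightarrow> real \<Rightarrow> real \<Rightarrow>
    (nat \<Rightarrow> nat \<Rightarrow> real) \<Rightarrow> ipds_params" where
  "ipds_choice P N R c tol =
     (let L = Lt P; m = mu P; T = T_of L m (onorm (Aop P)) R; \<beta> = beta_of L m; p = p_of L m in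
      \<lparr> pN = N,
        ptau = (\<lambda>k. if enat k \<le> Delta_of L m then (real k - 1) / 2 else tau_of L m),
        plam = (\<lambda>k. if enat k \<le> Delta_of L m then (real k - 1) / real k else lam_of L m),
        pbeta = \<beta>,
        pp = p,
        pT = T,
        pc = c_of L m N c,
        peta = (\<lambda>k t. (p k + m) * (real t - 1) + p k * real (T k)),
        pq = (\<lambda>k t. L * real (T k) / (4 * \<beta> k * R\<^sup>2)),
        palpha = (\<lambda>k t. if k \<ge> 2 \<and> t = 1
                        then \<beta> (k - 1) * real (T k) / (\<beta> k * real (T (k - 1))) else 1),
        ptol = tol \<rparr>)"

text \<open>Correctness and LO bound for every run with the parameters \<open>a\<close>: every probability space
  over \<open>'w\<close>, stochastic oracle, LO oracle and choice of CGS starting points.\<close>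

definition ipds_solves :: "('m::finite, 'd::finite) problem \<Rightarrow> 'w itself \<Rightarrow> ipds_params \<Rightarrow>
    real \<Rightarrow> real \<Rightarrow> bool" where
  "ipds_solves P W a \<epsilon> B \<longleftrightarrow>
     (\<forall>(M :: 'w measure) F v lo start.
        lin_oracle (feas P) lo \<and> start_rule (feas P) start \<and> oracle_run P a lo start M F v \<longrightarrow>
        eps_solution P M \<epsilon> (\<lambda>\<omega>. ipds_output P a lo start (\<lambda>k. v k \<omega>)) \<and>
        (\<forall>\<omega>\<in>space M. ereal_of_enat (lo_complexity P a lo start (\<lambda>k. v k \<omega>)) \<le> ereal B))"

end

theory Submission
  imports Defs "HOL-Real_Asymp.Real_Asymp"
begin

text \<open>
  The Laplacian is symmetric and annihilates the optimal solution \<open>x\<^sup>*\<close>, so the decentralized problem is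
  a bilinearly coupled saddle point problem. Along a run, an energy estimate is proved that holds for
  every realization of the gradient estimates. For every dual vector \<open>z\<close>, it bounds the
  value of \<open>f - f\<^sup>* + \<langle>A x, z\<rangle>\<close> at the averaged output, times the total weight of the average, by \<open>L\<close>
  times a quadratic function of the initial distances, the weighted tolerances of the subproblems, and
  two noise terms (\<open>sliding_trace.gap_estimate\<close>). Three potentials
  telescope in it. The inner loops are a linearized primal-dual method for the coupling; the
  parameters continue the potential of one inner loop in the next one. The gradient extrapolation is a
  proximal step on the conjugate of the smooth part; the conjugate is avoided by expressing its
  Bregman distances through those of the smooth part itself, which dominate squared gradient
  differences by co-coercivity. Finally, each subproblem is an exact quadratic, so that a Wolfe gap
  below the tolerance gives the three-point inequality of the exact proximal step up to this tolerance
  (\<open>cgs_output_optimality\<close>).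

  Testing with \<open>z\<close> of norm \<open>\<parallel>z\<^sup>*\<parallel> + 1\<close> in the direction of the consensus error of the output turns the
  estimate into a bound for an exact penalty function, which controls the objective gap and the
  consensus error separately (\<open>output_accuracy\<close>). Of the noise terms, the one linear in the oracle error
  pairs it with a point that is known before the samples are drawn. This requires all iterates,
  including the outputs of the CGS procedure with its data-dependent number of steps, to be
  measurable with respect to the past; the term then has mean zero. The quadratic one is
  bounded through the batch sizes (\<open>linear_noise\<close>, \<open>quadratic_noise\<close>). Together with the
  \<open>O(1/e)\<close> bound for the number of calls that the CGS procedure needs for a Wolfe gap \<open>e\<close>
  (\<open>cgs_calls_bound\<close>), this reduces the theorem to inequalities between the parameters
  (\<open>ipds_solves_of_budget\<close>).

  These are solved with \<open>R = 1\<close> and \<open>c\<close> slightly larger than \<open>\<sigma>\<^sup>2\<close>. In the convex case \<open>N\<close> is of order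
  \<open>sqrt (L / \<epsilon>)\<close> and all sums are polynomial in \<open>N\<close> (\<open>convex_case\<close>). In the strongly convex case a first
  phase whose length does not depend on \<open>\<epsilon>\<close> is followed by a phase of logarithmic length in which all
  quantities are geometric (\<open>strongly_convex_case\<close>).
\<close>

section \<open>Smooth convex functions\<close>

lemma convex_gradient_inequality:
  fixes f :: "'a::real_inner \<Rightarrow> real"
  assumes cvx: "convex_on UNIV f" and grad: "GDERIV f x :> g"
  shows "f y \<ge> f x + g \<bullet> (y - x)"
proof -
  define l where "l = (\<lambda>t. x + t *\<^sub>R (y - x))"
  have l: "(l has_derivative (\<lambda>t. t *\<^sub>R (y - x))) (at 0)"
    unfolding l_def by (auto intro!: derivative_eq_intros)
  have l0: "l 0 = x" by (simp add: l_def)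
  have "(f has_derivative (\<lambda>h. h \<bullet> g)) (at (l 0))"
    using grad by (simp add: gderiv_def l0)
  from has_derivative_compose[OF l this]
  have "((\<lambda>t. f (l t)) has_derivative (\<lambda>t. (t *\<^sub>R (y - x)) \<bullet> g)) (at 0)" .
  hence der: "((\<lambda>t. f (l t)) has_field_derivative (g \<bullet> (y - x))) (at 0)"
    by (simp add: has_field_derivative_def inner_commute mult.commute[of _ "g \<bullet> (y - x)"])
  have cvx': "convex_on UNIV (\<lambda>t. f (l t))"
  proof (rule convex_onI)
    fix t a b :: real
    assume t: "0 < t" "t < 1"
    have "l ((1 - t) *\<^sub>R a + t *\<^sub>R b) = (1 - t) *\<^sub>R l a + t *\<^sub>R l b"
      by (simp add: l_def algebra_simps)
    thus "f (l ((1 - t) *\<^sub>R a + t *\<^sub>R b)) \<le> (1 - t) * f (l a) + t * f (l b)"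
      using convex_onD[OF cvx, of t "l a" "l b"] t by simp
  qed simp
  have "f (l 1) - f (l 0) \<ge> (g \<bullet> (y - x)) * (1 - 0)"
    using convex_on_imp_above_tangent[OF cvx', of 0 1] der by simp
  thus ?thesis by (simp add: l_def)
qed

text \<open>The lower bound comes from comparing the tangent at \<open>x\<close> with the quadratic upper model at \<open>y\<close>
  in the point where a gradient step of length \<open>1/L\<close> for \<open>f - \<langle>g x, \<cdot>\<rangle>\<close> leads from \<open>y\<close>.\<close>

lemma smooth_convex_bregman_lower:
  fixes f :: "'a::real_inner \<Rightarrow> real"
  assumes tangent: "\<And>x y. f y \<ge> f x + g x \<bullet> (y - x)"
    and smooth: "\<And>x y. f y - f x - g x \<bullet> (y - x) \<le> L / 2 * (norm (x - y))\<^sup>2"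
    and L: "L > 0"
  shows "f y - f x - g x \<bullet> (y - x) \<ge> (norm (g y - g x))\<^sup>2 / (2 * L)"
proof -
  define d where "d = g y - g x"
  define z where "z = y - (1 / L) *\<^sub>R d"
  have a: "f z \<ge> f x + g x \<bullet> (z - x)" by (rule tangent)
  have b: "f z - f y - g y \<bullet> (z - y) \<le> L / 2 * (norm (y - z))\<^sup>2" by (rule smooth)
  have c: "norm (y - z) ^ 2 = d \<bullet> d / L\<^sup>2"
    by (simp add: z_def power2_norm_eq_inner[symmetric] power_divide power_mult_distrib)
  have e: "L / 2 * (norm (y - z))\<^sup>2 = d \<bullet> d / (2 * L)"
    unfolding c using L by (simp add: power2_eq_square)
  have f1: "g y \<bullet> (z - y) = g x \<bullet> (z - y) - d \<bullet> d / L"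
    by (simp add: z_def d_def inner_diff_left inner_diff_right algebra_simps diff_divide_distrib
        add_divide_distrib inner_commute)
  have f2: "g x \<bullet> (z - x) = g x \<bullet> (z - y) + g x \<bullet> (y - x)"
    by (simp add: inner_diff_right)
  have h: "d \<bullet> d / L = 2 * (d \<bullet> d / (2 * L))" using L by simp
  have "f y - f x - g x \<bullet> (y - x) \<ge> d \<bullet> d / (2 * L)"
    using a b e f1 f2 h by linarith
  thus ?thesis by (simp add: d_def power2_norm_eq_inner)
qed

lemma tangent_jensen:
  fixes f :: "'a::real_inner \<Rightarrow> real"
  assumes tangent: "\<And>x y. f y \<ge> f x + g x \<bullet> (y - x)"
    and w: "\<And>i. i \<in> I \<Longrightarrow> w i \<ge> 0"
    and W: "W = (\<Sum>i\<in>I. w i)" "W > 0"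
  shows "W * f ((1 / W) *\<^sub>R (\<Sum>i\<in>I. w i *\<^sub>R y i)) \<le> (\<Sum>i\<in>I. w i * f (y i))"
proof -
  define m where "m = (1 / W) *\<^sub>R (\<Sum>i\<in>I. w i *\<^sub>R y i)"
  have m: "W *\<^sub>R m = (\<Sum>i\<in>I. w i *\<^sub>R y i)" using W(2) by (simp add: m_def)
  have "(\<Sum>i\<in>I. w i * (f m + g m \<bullet> (y i - m))) \<le> (\<Sum>i\<in>I. w i * f (y i))"
    by (intro sum_mono mult_left_mono tangent w)
  also have "(\<Sum>i\<in>I. w i * (f m + g m \<bullet> (y i - m)))
      = W * f m + g m \<bullet> ((\<Sum>i\<in>I. w i *\<^sub>R y i) - W *\<^sub>R m)"
    by (simp add: W(1) ring_distribs inner_diff_right inner_sum_right sum.distrib sum_subtractf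
        sum_distrib_right sum_distrib_left scaleR_sum_left)
  finally show ?thesis unfolding m diff_self inner_zero_right add_0_right by (simp only: m_def)
qed

section \<open>Structure of the consensus problem\<close>

lemma linear_kron_id: "linear (kron_id B :: real^'d::finite^'m::finite \<Rightarrow> _)"
  by (rule linearI)
     (simp_all add: kron_id_def vec_eq_iff scaleR_sum_right sum.distrib algebra_simps)

lemma kron_id_symmetric:
  assumes "\<And>i j. B $ i $ j = B $ j $ i"
  shows "kron_id B x \<bullet> (y :: real^'d::finite^'m::finite) = x \<bullet> kron_id B y"
proof -
  have "kron_id B x \<bullet> y = (\<Sum>i\<in>UNIV. \<Sum>j\<in>UNIV. B $ i $ j * (x $ j \<bullet> y $ i))"
    by (simp add: inner_vec_def[where ?'b="'m" and ?'a="real^'d"] kron_id_def inner_sum_left)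
  also have "\<dots> = (\<Sum>j\<in>UNIV. \<Sum>i\<in>UNIV. B $ i $ j * (x $ j \<bullet> y $ i))" by (rule sum.swap)
  also have "\<dots> = (\<Sum>j\<in>UNIV. \<Sum>i\<in>UNIV. B $ j $ i * (x $ j \<bullet> y $ i))"
    using assms by simp
  also have "\<dots> = x \<bullet> kron_id B y"
    by (simp add: inner_vec_def[where ?'b="'m" and ?'a="real^'d"] kron_id_def inner_sum_right)
  finally show ?thesis .
qed

definition ft_sum :: "('m::finite, 'd::finite) problem \<Rightarrow> real^'d^'m \<Rightarrow> real" where
  "ft_sum P x = (\<Sum>i\<in>UNIV. ft P i (x $ i))"

context
  fixes P :: "('m::finite, 'd::finite) problem"
  assumes P: "pds_problem P"
begin

lemma Aop_linear: "linear (Aop P)"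
  by (simp add: Aop_def linear_kron_id)

lemma Aop_symmetric: "Aop P x \<bullet> y = x \<bullet> Aop P y"
proof -
  have "symp (edge P)" using P by (simp add: pds_problem_def)
  hence "laplacian (edge P) $ i $ j = laplacian (edge P) $ j $ i" for i j
    by (auto simp: laplacian_def symp_def)
  thus ?thesis unfolding Aop_def by (intro kron_id_symmetric)
qed

lemma adjoint_Aop: "adjoint (Aop P) = Aop P"
  by (rule adjoint_unique) (simp add: Aop_symmetric)

lemma norm_Aop_le: "norm (Aop P x) \<le> onorm (Aop P) * norm x"
  by (rule onorm) (simp add: Aop_linear linear_conv_bounded_linear[symmetric])

text \<open>In a connected graph with two or more vertices some vertex has a neighbour, and the
  Laplacian moves the indicator of this vertex.\<close>

lemma onorm_Aop_pos: "onorm (Aop P) > 0"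
proof -
  have "CARD('m) \<ge> 2" using P by (simp add: pds_problem_def)
  then obtain i j :: 'm where ij: "i \<noteq> j"
    by (metis card_2_iff' card_le_Suc0_iff_eq finite not_less_eq_eq numeral_2_eq_2 UNIV_I)
  have "(edge P)\<^sup>*\<^sup>* i j" using P by (simp add: pds_problem_def)
  with ij obtain l where l: "edge P i l" by (metis converse_rtranclpE)
  have "\<not> edge P i i" using P by (auto simp: pds_problem_def irreflp_def)
  with l have il: "i \<noteq> l" by auto
  define x :: "real^'d^'m" where "x = axis l 1"
  have "Aop P x $ i = (\<Sum>j\<in>UNIV. laplacian (edge P) $ i $ j *\<^sub>R (if j = l then 1 else 0))"
    by (simp add: Aop_def kron_id_def x_def axis_def)
  also have "\<dots> = laplacian (edge P) $ i $ l *\<^sub>R 1"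
    by (simp add: if_distrib[of "scaleR _"] sum.delta cong: if_cong)
  also have "\<dots> = - 1" using l il by (simp add: laplacian_def)
  finally have "Aop P x $ i \<noteq> 0" by (simp add: vec_eq_iff)
  hence "Aop P x \<noteq> 0" by (metis zero_index)
  hence "0 < norm (Aop P x)" by simp
  also have "\<dots> \<le> onorm (Aop P) * norm x" by (rule norm_Aop_le)
  finally show ?thesis by (metis mult_nonpos_nonneg norm_ge_zero not_le)
qed

lemma Aop_xstar: "Aop P (xstar P) = 0"
proof -
  let ?a = "Aop P (xstar P)"
  have "saddle_point P (xstar P) (zstar P)" using P by (simp add: pds_problem_def)
  hence "?a \<bullet> (zstar P + ?a) \<le> ?a \<bullet> zstar P" by (simp add: saddle_point_def)
  hence "?a \<bullet> ?a \<le> 0" by (simp add: inner_add_right)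
  thus ?thesis by (metis inner_eq_zero_iff inner_ge_zero order_antisym)
qed

lemma xstar_feas: "xstar P \<in> feas P"
  using P by (simp add: pds_problem_def saddle_point_def)

lemma obj_ge_saddle:
  assumes "x \<in> feas P"
  shows "obj P x - obj P (xstar P) \<ge> - (norm (zstar P) * norm (Aop P x))"
proof -
  have "saddle_point P (xstar P) (zstar P)" using P by (simp add: pds_problem_def)
  hence "obj P (xstar P) \<le> obj P x + Aop P x \<bullet> zstar P"
    using assms by (simp add: saddle_point_def Aop_xstar)
  moreover have "Aop P x \<bullet> zstar P \<le> norm (Aop P x) * norm (zstar P)"
    by (rule norm_cauchy_schwarz)
  ultimately show ?thesis by (simp add: mult.commute)
qed

lemma feas_convex: "convex (feas P)"
proof -
  have "convex (Xset P i)" for i using P by (simp add: pds_problem_def)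
  thus ?thesis by (auto simp: feas_def convex_def)
qed

lemma feas_compact: "compact (feas P)"
proof -
  have X: "compact (Xset P i)" for i using P by (simp add: pds_problem_def)
  have "closed (feas P)"
  proof -
    have "feas P = (\<Inter>i. (\<lambda>x. x $ i) -` Xset P i)" by (auto simp: feas_def)
    moreover have "closed ((\<lambda>x::real^'d^'m. x $ i) -` Xset P i)" for i
      by (intro closed_vimage compact_imp_closed X continuous_intros)
    ultimately show ?thesis by auto
  qed
  moreover have "bounded (feas P)"
  proof -
    have "\<exists>B. \<forall>y\<in>Xset P i. norm y \<le> B" for i
      using X compact_imp_bounded bounded_iff by blast
    then obtain B where B: "\<And>i y. y \<in> Xset P i \<Longrightarrow> norm y \<le> B i" by metis
    have "norm x \<le> (\<Sum>i\<in>UNIV. B i)" if "x \<in> feas P" for x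
    proof -
      have "norm x \<le> (\<Sum>i\<in>UNIV. norm (x $ i))" 
        unfolding norm_vec_def by (rule L2_set_le_sum) simp
      also have "\<dots> \<le> (\<Sum>i\<in>UNIV. B i)" using that by (intro sum_mono B) (auto simp: feas_def)
      finally show ?thesis .
    qed
    thus ?thesis by (auto simp: bounded_iff)
  qed
  ultimately show ?thesis by (simp add: compact_eq_bounded_closed)
qed

lemma obj_eq: "obj P x = ft_sum P x + mu P * nu_sum P x"
  by (simp add: obj_def ft_sum_def nu_sum_def sum.distrib sum_distrib_left)

lemma Lt_pos: "Lt P > 0" and mu_nonneg: "mu P \<ge> 0"
  using P by (auto simp: pds_problem_def)

lemma prox_eq: "prox P xh x = (norm (xh - x))\<^sup>2"
  using P by (simp add: pds_problem_def)

lemma ft_tangent: "ft P i y \<ge> ft P i x + gft P i x \<bullet> (y - x)"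
  using P by (intro convex_gradient_inequality) (auto simp: pds_problem_def)

lemma ft_sum_bregman_lower:
  "ft_sum P y - ft_sum P x - grad_ft P x \<bullet> (y - x) \<ge> (norm (grad_ft P y - grad_ft P x))\<^sup>2 / (2 * Lt P)"
proof -
  have sm: "ft P i y - ft P i x - gft P i x \<bullet> (y - x) \<le> Lt P / 2 * (norm (x - y))\<^sup>2" for i x y
    using P by (auto simp: pds_problem_def smooth_with_def)
  have "(\<Sum>i\<in>UNIV. (norm (gft P i (y $ i) - gft P i (x $ i)))\<^sup>2 / (2 * Lt P))
     \<le> (\<Sum>i\<in>UNIV. ft P i (y $ i) - ft P i (x $ i) - gft P i (x $ i) \<bullet> (y $ i - x $ i))"
    by (intro sum_mono smooth_convex_bregman_lower ft_tangent sm Lt_pos)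
  thus ?thesis
    by (simp add: sum_subtractf ft_sum_def grad_ft_def power2_norm_eq_inner
        inner_vec_def[where ?'b="'m" and ?'a="real^'d"] sum_divide_distrib)
qed

lemma grad_ft_lipschitz: "norm (grad_ft P y - grad_ft P x) \<le> Lt P * norm (y - x)"
proof -
  let ?d = "grad_ft P y - grad_ft P x"
  have s: "Lt P * ((norm ?d)\<^sup>2 / (2 * Lt P)) = (norm ?d)\<^sup>2 / 2"
    using Lt_pos by simp
  have "2 * ((norm ?d)\<^sup>2 / (2 * Lt P)) \<le> ?d \<bullet> (y - x)"
    using ft_sum_bregman_lower[of x y] ft_sum_bregman_lower[of y x] 
    by (simp add: inner_diff_left inner_diff_right norm_minus_commute)
  also have "\<dots> \<le> norm ?d * norm (y - x)" by (rule norm_cauchy_schwarz)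
  finally have "Lt P * (2 * ((norm ?d)\<^sup>2 / (2 * Lt P))) \<le> Lt P * (norm ?d * norm (y - x))"
    by (rule mult_left_mono) (use Lt_pos in simp)
  hence "norm ?d * norm ?d \<le> norm ?d * (Lt P * norm (y - x))"
    using s unfolding power2_eq_square mult.left_commute[of "norm ?d" "Lt P"] by linarith
  thus ?thesis 
    using Lt_pos by (cases "norm ?d = 0") (auto simp: mult_le_cancel_left)
qed

lemma continuous_grad_ft: "continuous_on UNIV (grad_ft P)"
proof -
  have "(Lt P)-lipschitz_on UNIV (grad_ft P)"
    using Lt_pos grad_ft_lipschitz by (intro lipschitz_onI) (auto simp: dist_norm)
  thus ?thesis by (rule lipschitz_on_continuous_on)
qed

lemma nu_sum_expand: "nu_sum P x = nu_sum P u + grad_nu P u \<bullet> (x - u) + (norm (x - u))\<^sup>2"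
  using prox_eq[of u x] by (simp add: prox_def norm_minus_commute)

lemma nu_sum_tangent: "nu_sum P x \<ge> nu_sum P u + grad_nu P u \<bullet> (x - u)"
  by (simp add: nu_sum_expand[of x u])

text \<open>Since the prox function is a quadratic form, \<open>nu_sum\<close> is a quadratic function. This is what makes
  its gradient continuous, hence measurable, and the subproblems exact quadratics.\<close>

lemma grad_nu_affine: "grad_nu P u = grad_nu P 0 + 2 *\<^sub>R u"
proof -
  have "grad_nu P u \<bullet> d = (grad_nu P 0 + 2 *\<^sub>R u) \<bullet> d" for d
    using nu_sum_expand[of "u + d" u] nu_sum_expand[of "u + d" 0] nu_sum_expand[of u 0]
    by (simp add: power2_norm_eq_inner inner_add_left inner_add_right inner_commute)
  hence "\<forall>d. grad_nu P u \<bullet> d = (grad_nu P 0 + 2 *\<^sub>R u) \<bullet> d" by blast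
  thus ?thesis by (simp only: vector_eq_rdot)
qed

lemma continuous_obj: "continuous_on UNIV (obj P)"
proof -
  have d1: "GDERIV (ft P i) x :> gft P i x" and d2: "GDERIV (nu P i) x :> gnu P i x" for i x
    using P by (auto simp: pds_problem_def)
  have c: "continuous_on UNIV h" if "\<And>x. GDERIV h x :> g x" for h :: "real^'d \<Rightarrow> real" and g
    using that by (intro continuous_at_imp_continuous_on ballI has_derivative_continuous)
      (auto simp: gderiv_def)
  have c1: "continuous_on UNIV (ft P i)" and c2: "continuous_on UNIV (nu P i)" for i
    using c[of "ft P i"] c[of "nu P i"] d1 d2 by blast+
  show ?thesis unfolding obj_def
    by (intro continuous_intros continuous_on_compose2[OF c1] continuous_on_compose2[OF c2]) auto
qed

end

section \<open>The conditional gradient sliding procedure\<close>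

declare cgs_iter.simps(2)[simp del]

context
  fixes X :: "'a::euclidean_space set" and lo :: "'a \<Rightarrow> 'a" and g u :: 'a and b :: real
  assumes lo: "lin_oracle X lo" and cvx: "convex X" and bdd: "bounded X"
    and u: "u \<in> X" and b: "b > 0"
begin

private definition "phi y = g \<bullet> y + b / 2 * (norm (y - u))\<^sup>2"
private definition "grad y = g + b *\<^sub>R (y - u)"
private abbreviation "y \<equiv> cgs_iter lo g b u"
private abbreviation "gap \<equiv> wolfe_gap lo g b u"

lemma lo_mem: "lo h \<in> X" and lo_min: "x \<in> X \<Longrightarrow> h \<bullet> lo h \<le> h \<bullet> x"
  using lo by (auto simp: lin_oracle_def)

lemma phi_expand: "phi x = phi w + grad w \<bullet> (x - w) + b / 2 * (norm (x - w))\<^sup>2"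
  unfolding phi_def grad_def
  by (simp add: power2_norm_eq_inner inner_diff_left inner_diff_right inner_add_left
      algebra_simps inner_commute[of w x] inner_commute[of u x] inner_commute[of w u] inner_commute[of w g] inner_commute[of x g])

text \<open>The step size of the procedure minimizes \<open>phi\<close> on the segment from the current point to the
  oracle's answer, hence the step is at least as good as any other one.\<close>

lemma cgs_step:
  assumes yX: "y s \<in> X"
  shows "y (Suc s) \<in> X"
    and "0 \<le> a \<Longrightarrow> a \<le> 1 \<Longrightarrow>
      phi (y (Suc s)) \<le> phi (y s) - a * gap (y s) + a\<^sup>2 * (b * (diameter X)\<^sup>2) / 2"
proof -
  define v where "v = lo (grad (y s))"
  define G where "G = gap (y s)"
  define n where "n = (norm (v - y s))\<^sup>2"
  define al where "al = min 1 (G / (b * n))"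
  have G: "G = grad (y s) \<bullet> (y s - v)"
    by (simp add: G_def wolfe_gap_def v_def grad_def)
  have G': "(b *\<^sub>R (u - y s) - g) \<bullet> (v - y s) = G"
    by (simp add: G grad_def inner_diff_left inner_diff_right inner_add_left algebra_simps)
  have step: "y (Suc s) = (1 - al) *\<^sub>R y s + al *\<^sub>R v"
    by (simp add: cgs_iter.simps(2) Let_def al_def n_def G'[symmetric] v_def grad_def)
  have vX: "v \<in> X" by (simp add: v_def lo_mem)
  have G0: "G \<ge> 0" using lo_min[OF yX, of "grad (y s)"] by (simp add: G v_def inner_diff_right)
  have n0: "n \<ge> 0" by (simp add: n_def)
  have al: "0 \<le> al" "al \<le> 1" using G0 n0 b by (auto simp: al_def)
  show "y (Suc s) \<in> X" unfolding step using cvx yX vX al by (simp add: convex_alt)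
  have val: "phi ((1 - t) *\<^sub>R y s + t *\<^sub>R v) = phi (y s) - t * G + t\<^sup>2 * (b * n) / 2" for t
  proof -
    have eq: "(1 - t) *\<^sub>R y s + t *\<^sub>R v - y s = t *\<^sub>R (v - y s)" by (simp add: algebra_simps)
    show ?thesis unfolding phi_expand[of "(1 - t) *\<^sub>R y s + t *\<^sub>R v" "y s"] eq norm_scaleR
      by (simp add: G n_def inner_diff_right power_mult_distrib algebra_simps)
  qed
  assume a: "0 \<le> a" "a \<le> 1"
  have "norm (v - y s) \<le> diameter X"
    using diameter_bounded_bound[OF bdd vX yX] by (simp add: dist_norm)
  hence nD: "n \<le> (diameter X)\<^sup>2" unfolding n_def by (intro power_mono) auto
  have opt: "- al * G + al\<^sup>2 * (b * n) / 2 \<le> - a * G + a\<^sup>2 * (b * n) / 2"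
  proof (cases "n = 0")
    case True
    hence "G = 0" by (simp add: G n_def)
    with True show ?thesis by simp
  next
    case False
    define c where "c = b * n"
    have c: "c > 0" using False n0 b by (simp add: c_def)
    define r where "r = G / c"
    have Gr: "G = r * c" using c by (simp add: r_def)
    have "(al - r)\<^sup>2 \<le> (a - r)\<^sup>2"
    proof (cases "r \<le> 1")
      case True thus ?thesis by (simp add: al_def r_def c_def)
    next
      case False
      hence "al = 1" by (simp add: al_def r_def c_def)
      thus ?thesis using False a by (intro abs_le_square_iff[THEN iffD1]) auto
    qed
    hence "c * (al - r)\<^sup>2 \<le> c * (a - r)\<^sup>2" using c by simp
    thus ?thesis unfolding c_def[symmetric] Gr by (simp add: power2_eq_square algebra_simps)
  qed
  have "phi (y (Suc s)) = phi (y s) + (- al * G + al\<^sup>2 * (b * n) / 2)"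
    unfolding step val by simp
  also have "\<dots> \<le> phi (y s) - a * G + a\<^sup>2 * (b * n) / 2" using opt by simp
  also have "\<dots> \<le> phi (y s) - a * G + a\<^sup>2 * (b * (diameter X)\<^sup>2) / 2"
    using nD b by (intro add_left_mono divide_right_mono mult_left_mono) auto
  finally show "phi (y (Suc s)) \<le> phi (y s) - a * gap (y s) + a\<^sup>2 * (b * (diameter X)\<^sup>2) / 2"
    by (simp add: G_def)
qed

lemma cgs_iter_mem: "y s \<in> X"
  by (induction s) (use u cgs_step(1) in auto)

lemma phi_gap: 
  assumes "x \<in> X" shows "phi w - phi x \<le> gap w"
proof -
  have "grad w \<bullet> lo (grad w) \<le> grad w \<bullet> x" using assms by (rule lo_min)
  moreover have "0 \<le> b / 2 * (norm (x - w))\<^sup>2" using b by simp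
  ultimately show ?thesis using phi_expand[of x w]
    unfolding wolfe_gap_def grad_def[symmetric] inner_diff_right by linarith
qed

text \<open>The classical rate of the conditional gradient method. It is independent of the starting point:
  one full step to the answer of the oracle already leaves a suboptimality of at most half of
  \<open>b\<close> times the squared diameter.\<close>

lemma cgs_rate:
  assumes "x \<in> X"
  shows "phi (y (Suc s)) - phi x \<le> 2 * (b * (diameter X)\<^sup>2) / (real s + 3)"
proof (induction s)
  case 0
  let ?C = "b * (diameter X)\<^sup>2"
  have "phi (y 1) \<le> phi (y 0) - gap (y 0) + ?C / 2"
    using cgs_step(2)[OF cgs_iter_mem, of 1 0] by simp
  moreover have "?C \<ge> 0" using b by simp
  ultimately show ?case using phi_gap[OF assms, of "y 0"] by simp
next
  case (Suc s)
  define C where "C = b * (diameter X)\<^sup>2"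
  have C: "C \<ge> 0" using b by (simp add: C_def)
  \<comment> \<open>the step length for which the bound reproduces itself\<close>
  define a where "a = 2 / (real s + 3)"
  have a: "0 \<le> a" "a \<le> 1" by (auto simp: a_def field_simps)
  have "phi (y (Suc (Suc s))) - phi x \<le> phi (y (Suc s)) - phi x - a * gap (y (Suc s)) + a\<^sup>2 * C / 2"
    using cgs_step(2)[OF cgs_iter_mem a, of "Suc s"] by (simp add: C_def)
  also have "a * gap (y (Suc s)) \<ge> a * (phi (y (Suc s)) - phi x)"
    using a by (intro mult_left_mono phi_gap assms)
  hence "phi (y (Suc s)) - phi x - a * gap (y (Suc s)) + a\<^sup>2 * C / 2
      \<le> (1 - a) * (phi (y (Suc s)) - phi x) + a\<^sup>2 * C / 2" by (simp add: algebra_simps)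
  also have "\<dots> \<le> (1 - a) * (2 * C / (real s + 3)) + a\<^sup>2 * C / 2"
    using Suc a by (intro add_right_mono mult_left_mono) (auto simp: C_def)
  also have "\<dots> = C * (2 * (real s + 2) / (real s + 3)\<^sup>2)"
    by (simp add: a_def divide_simps power2_eq_square) (simp add: algebra_simps)
  also have "2 * (real s + 2) / (real s + 3)\<^sup>2 \<le> 2 / (real s + 4)"
    by (simp add: divide_simps power2_eq_square) (simp add: algebra_simps)
  hence "C * (2 * (real s + 2) / (real s + 3)\<^sup>2) \<le> C * (2 / (real s + 4))"
    using C by (rule mult_left_mono)
  finally show ?case by (simp add: C_def algebra_simps)
qed

text \<open>If the gap stayed above \<open>e\<close> between the iterations \<open>n\<close> and \<open>2 n\<close>, steps of length
  \<open>2 / (n + 2)\<close> would decrease \<open>phi\<close> below its minimum, because the first \<open>n\<close> iterations leave only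
  a suboptimality of order \<open>1 / n\<close>.\<close>

lemma cgs_terminates:
  assumes n: "n \<ge> 1" and e: "2 * (b * (diameter X)\<^sup>2) / real n \<le> e"
  shows "\<exists>s < 2 * n. gap (y s) \<le> e"
proof (rule ccontr)
  assume "\<not> ?thesis"
  hence big: "gap (y s) > e" if "s < 2 * n" for s using that by force
  define C where "C = b * (diameter X)\<^sup>2"
  have C: "C \<ge> 0" using b by (simp add: C_def)
  define a where "a = 2 / (real n + 2)"
  have a: "0 < a" "a \<le> 1" by (auto simp: a_def field_simps)
  have "phi (y (n + j)) \<le> phi (y n) + real j * (a\<^sup>2 * C / 2 - a * e)" if "j \<le> n" for j
    using that
  proof (induction j)
    case (Suc j)
    have "phi (y (Suc (n + j))) \<le> phi (y (n + j)) - a * gap (y (n + j)) + a\<^sup>2 * C / 2"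
      using cgs_step(2)[OF cgs_iter_mem, of a "n + j"] a by (simp add: C_def)
    moreover have "a * gap (y (n + j)) \<ge> a * e"
      using big[of "n + j"] Suc.prems a by (intro mult_left_mono) auto
    ultimately show ?case using Suc by (simp add: algebra_simps add_divide_distrib)
  qed simp
  from this[of n] have A: "phi (y (2 * n)) \<le> phi (y n) + real n * (a\<^sup>2 * C / 2 - a * e)"
    by (simp add: mult_2)
  have B: "phi (y n) - phi (y (2 * n)) \<le> a * C"
    using cgs_rate[OF cgs_iter_mem[of "2 * n"], of "n - 1"] n
    by (simp add: C_def a_def of_nat_diff add.commute)
  have big2: "gap (y (2 * n - 1)) > e" using n by (intro big) auto
  have "real n * (a * e) \<le> a * (C + real n * (a * C / 2))"
    using A B by (simp add: algebra_simps power2_eq_square)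
  hence "real n * e \<le> C + real n * (a * C / 2)"
    using a(1) by (simp add: mult.left_commute)
  also have "\<dots> = C * (1 + real n / (real n + 2))"
  proof -
    have "real n * (a * C / 2) = C * (real n * (a / 2))" by simp
    also have "a / 2 = 1 / (real n + 2)" unfolding a_def by (simp only: divide_divide_eq_left) (simp add: divide_simps)
    finally show ?thesis by (simp only: distrib_left) simp
  qed
  finally have 1: "real n * e \<le> C * (1 + real n / (real n + 2))" .
  have 2: "2 * C \<le> real n * e" using e n by (simp add: C_def field_simps)
  show False
  proof (cases "C = 0")
    case True
    have D0: "(diameter X)\<^sup>2 = 0" using True b by (simp add: C_def)
    have "norm (y (2*n-1) - lo (grad (y (2*n-1)))) \<le> diameter X"
      using diameter_bounded_bound[OF bdd cgs_iter_mem lo_mem] by (simp add: dist_norm)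
    hence "y (2*n-1) - lo (grad (y (2*n-1))) = 0" using D0 by simp
    hence "gap (y (2*n-1)) = 0" by (simp add: wolfe_gap_def grad_def)
    moreover have "e \<ge> 0" using 2 True n by (simp add: zero_le_mult_iff)
    ultimately show False using big2 by simp
  next
    case False
    with C have "C > 0" by simp
    moreover have "real n / (real n + 2) < 1" by simp
    ultimately have "C * (1 + real n / (real n + 2)) < C * 2" by (intro mult_strict_left_mono) auto
    thus False using 1 2 by simp
  qed
qed

lemma cgs_calls_bound:
  assumes e: "e > 0"
  obtains n where "cgs_calls lo e g b u \<le> enat n"
    and "real n \<le> 4 * (b * (diameter X)\<^sup>2) / e + 4"
proof -
  define C where "C = b * (diameter X)\<^sup>2"
  have C: "C \<ge> 0" using b by (simp add: C_def)
  define n where "n = nat \<lceil>2 * C / e\<rceil> + 1"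
  have n1: "real n \<ge> 2 * C / e" "n \<ge> 1" unfolding n_def by (auto intro: order_trans[OF real_nat_ceiling_ge])
  have n2: "real n \<le> 2 * C / e + 2"
    using C e of_int_ceiling_le_add_one[of "2 * C / e"] by (simp add: n_def add.commute)
  have "2 * C / real n \<le> e" using n1 e by (simp add: field_simps)
  then obtain s where s: "s < 2 * n" "gap (y s) \<le> e"
    using cgs_terminates[OF n1(2)] by (auto simp: C_def)
  have "cgs_calls lo e g b u \<le> enat (Suc s)"
    unfolding cgs_calls_def using s(2) by (intro INF_lower) auto
  also have "\<dots> \<le> enat (2 * n)" using s(1) by simp
  finally show ?thesis using n2 by (intro that[of "2 * n"]) (auto simp: C_def)
qed

lemma cgs_output_mem: "cgs_output lo e g b u \<in> X"
  by (simp add: cgs_output_def cgs_iter_mem)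

text \<open>A small Wolfe gap is the variational inequality of the subproblem up to the tolerance, and
  since \<open>phi\<close> is exactly quadratic the full strong convexity term survives.\<close>

lemma cgs_output_optimality:
  assumes e: "e > 0" and x: "x \<in> X"
  defines "r \<equiv> cgs_output lo e g b u"
  shows "g \<bullet> r + b / 2 * (norm (r - u))\<^sup>2 + b / 2 * (norm (x - r))\<^sup>2
       \<le> g \<bullet> x + b / 2 * (norm (x - u))\<^sup>2 + e"
proof -
  define C where "C = b * (diameter X)\<^sup>2"
  have "\<exists>s. gap (y s) \<le> e"
  proof -
    obtain n :: nat where n: "2 * C / e < real n" using reals_Archimedean2 by blast
    have "0 \<le> 2 * C / e" using b e by (simp add: C_def)
    hence "n \<ge> 1" using n by linarith
    moreover have "2 * C / real n \<le> e" using n e \<open>n \<ge> 1\<close> by (simp add: field_simps)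
    ultimately show ?thesis using cgs_terminates by (auto simp: C_def)
  qed
  hence gap: "gap r \<le> e" unfolding r_def cgs_output_def by (rule LeastI_ex)
  have "grad r \<bullet> lo (grad r) \<le> grad r \<bullet> x" using x by (rule lo_min)
  hence "grad r \<bullet> (r - x) \<le> e" 
    using gap unfolding wolfe_gap_def grad_def[symmetric] inner_diff_right by linarith
  thus ?thesis using phi_expand[of x r] unfolding phi_def inner_diff_right by linarith
qed

end

section \<open>One run of inexact primal-dual sliding\<close>

lemma inner_young:
  fixes a b :: "'a::real_inner"
  assumes "c > 0"
  shows "a \<bullet> b \<le> (norm a)\<^sup>2 / (2 * c) + c / 2 * (norm b)\<^sup>2"
proof -
  have "0 \<le> (norm (a - c *\<^sub>R b))\<^sup>2" by simp
  also have "\<dots> = (norm a)\<^sup>2 - 2 * c * (a \<bullet> b) + c\<^sup>2 * (norm b)\<^sup>2"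
    unfolding power2_norm_eq_inner
    by (simp add: inner_diff_left inner_diff_right inner_commute[of b a] power2_eq_square algebra_simps)
  finally have "2 * c * (a \<bullet> b) \<le> (norm a)\<^sup>2 + c\<^sup>2 * (norm b)\<^sup>2" by simp
  hence "a \<bullet> b \<le> ((norm a)\<^sup>2 + c\<^sup>2 * (norm b)\<^sup>2) / (2 * c)"
    using assms by (simp add: field_simps)
  also have "\<dots> = (norm a)\<^sup>2 / (2 * c) + c / 2 * (norm b)\<^sup>2"
    using assms by (simp add: add_divide_distrib power2_eq_square)
  finally show ?thesis .
qed

text \<open>The new primal point differs from the extrapolated point at which the dual step was taken. Paired
  with a dual vector \<open>z\<close>, this difference leaves two bilinear terms of consecutive steps, which
  telescope except for a pairing with the dual increment. The latter is absorbed by the dual proximal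
  term and by the multiple \<open>An\<^sup>2 / (2 q)\<close> of the squared length of the preceding primal step. Each
  step sets this multiple aside for the next one, so \<open>eta\<close> must dominate it.\<close>

lemma primal_dual_inner_step:
  fixes A :: "'a::real_inner \<Rightarrow> 'a" and nu :: "'a \<Rightarrow> real"
  assumes A: "linear A" "\<And>x y. A x \<bullet> y = x \<bullet> A y" "\<And>x. norm (A x) \<le> An * norm x"
    and x: "A x = 0" and q: "q > 0" and eta: "An\<^sup>2 / (2 * q) \<le> eta"
    and dual: "Z' = Z + (1 / q) *\<^sub>R A (X + al *\<^sub>R (X - Y))"
    and primal: "m * nu X' + (v + A Z') \<bullet> X' + eta * (norm (X - X'))\<^sup>2 + p * (norm (X0 - X'))\<^sup>2
        + (m + eta + p) * (norm (X' - x))\<^sup>2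
      \<le> m * nu x + (v + A Z') \<bullet> x + eta * (norm (X - x))\<^sup>2 + p * (norm (X0 - x))\<^sup>2 + e"
  shows "m * nu X' - m * nu x + v \<bullet> (X' - x) + A X' \<bullet> z + p * (norm (X0 - X'))\<^sup>2
    \<le> p * (norm (X0 - x))\<^sup>2 + e
      + (eta * (norm (X - x))\<^sup>2 + q / 2 * (norm (Z - z))\<^sup>2
         - al * (A (X - Y) \<bullet> (z - Z)) + al\<^sup>2 * (An\<^sup>2 / (2 * q)) * (norm (X - Y))\<^sup>2)
      - ((eta + (p + m)) * (norm (X' - x))\<^sup>2 + q / 2 * (norm (Z' - z))\<^sup>2
         - A (X' - X) \<bullet> (z - Z') + An\<^sup>2 / (2 * q) * (norm (X' - X))\<^sup>2)"
proof -
  interpret A: linear A by (rule A)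
  have U: "q *\<^sub>R (Z' - Z) = A X + al *\<^sub>R A (X - Y)"
    using q by (simp add: dual A.add A.scaleR)
  have 1: "A X' \<bullet> z = A Z' \<bullet> X' - A Z' \<bullet> x + A X' \<bullet> (z - Z')"
    using x by (simp add: A(2) inner_diff_right inner_commute[of Z'])
  have "A X' = q *\<^sub>R (Z' - Z) + A (X' - X) - al *\<^sub>R A (X - Y)"
    unfolding U by (simp add: A.diff)
  hence 2: "A X' \<bullet> (z - Z') = q * ((Z' - Z) \<bullet> (z - Z')) + A (X' - X) \<bullet> (z - Z')
      - al * (A (X - Y) \<bullet> (z - Z'))"
    by (simp add: inner_add_left inner_diff_left)
  have "(Z' - Z) \<bullet> (z - Z') = ((norm (Z - z))\<^sup>2 - (norm (Z' - z))\<^sup>2 - (norm (Z' - Z))\<^sup>2) / 2"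
    by (simp add: power2_norm_eq_inner inner_diff_left inner_diff_right inner_commute field_simps)
  note polar = this
  have 3: "q * ((Z' - Z) \<bullet> (z - Z'))
      = q / 2 * (norm (Z - z))\<^sup>2 - q / 2 * (norm (Z' - z))\<^sup>2 - q / 2 * (norm (Z' - Z))\<^sup>2"
    unfolding polar by (simp add: right_diff_distrib diff_divide_distrib)
  have 4: "al * (A (X - Y) \<bullet> (z - Z'))
      = al * (A (X - Y) \<bullet> (z - Z)) - (al *\<^sub>R A (X - Y)) \<bullet> (Z' - Z)"
    by (simp add: inner_diff_right algebra_simps)
  have "(al *\<^sub>R A (X - Y)) \<bullet> (Z' - Z) \<le> (norm (al *\<^sub>R A (X - Y)))\<^sup>2 / (2 * q) + q / 2 * (norm (Z' - Z))\<^sup>2"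
    using q by (rule inner_young)
  also have "(norm (al *\<^sub>R A (X - Y)))\<^sup>2 = al\<^sup>2 * (norm (A (X - Y)))\<^sup>2"
    by (simp add: power_mult_distrib)
  also have "al\<^sup>2 * (norm (A (X - Y)))\<^sup>2 / (2 * q) \<le> al\<^sup>2 * (An * norm (X - Y))\<^sup>2 / (2 * q)"
    using q by (intro divide_right_mono mult_left_mono power_mono A) auto
  finally have 5: "(al *\<^sub>R A (X - Y)) \<bullet> (Z' - Z)
      \<le> al\<^sup>2 * (An\<^sup>2 / (2 * q)) * (norm (X - Y))\<^sup>2 + q / 2 * (norm (Z' - Z))\<^sup>2"
    by (simp add: power_mult_distrib)
  have 6: "An\<^sup>2 / (2 * q) * (norm (X' - X))\<^sup>2 \<le> eta * (norm (X - X'))\<^sup>2"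
    unfolding norm_minus_commute[of X' X] using eta by (rule mult_right_mono) simp
  have 7: "(m + eta + p) * (norm (X' - x))\<^sup>2 = (eta + (p + m)) * (norm (X' - x))\<^sup>2" by simp
  show ?thesis
    using primal 1 2 3 4 5 6 7 unfolding inner_add_left inner_diff_right by linarith
qed

text \<open>The inequalities between the step sizes under which the estimates of consecutive iterations
  telescope; \<open>An\<close> bounds the operator norm of the coupling operator.\<close>

locale sliding_params =
  fixes L m R An :: real and tau lam beta p :: "nat \<Rightarrow> real" and T :: "nat \<Rightarrow> nat"
  assumes L: "L > 0" and m: "m \<ge> 0" and R: "R > 0"
    and beta_pos: "k \<ge> 1 \<Longrightarrow> beta k > 0"
    and p_pos: "k \<ge> 1 \<Longrightarrow> p k > 0"
    and T_pos: "k \<ge> 1 \<Longrightarrow> T k \<ge> 1"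
    and tau_nonneg: "k \<ge> 1 \<Longrightarrow> tau k \<ge> 0"
    and tau_1: "tau 1 = 0" and beta_p_1: "beta 1 * p 1 = 4 * L"
    and prox_weights: "k \<ge> 1 \<Longrightarrow> 2 * (beta (Suc k) * p (Suc k)) \<le> beta k * (2 * p k + m)"
    and coupling: "k \<ge> 1 \<Longrightarrow> 2 * beta k * R\<^sup>2 * An\<^sup>2 \<le> L * p k * (real (T k))\<^sup>2"
    and tau_weights: "k \<ge> 1 \<Longrightarrow> beta (Suc k) * tau (Suc k) \<le> beta k * (1 + tau k)"
    and lam_weights: "k \<ge> 1 \<Longrightarrow> beta (Suc k) * lam (Suc k) = beta k"
    and extrapolation: "k \<ge> 1 \<Longrightarrow> 2 * beta k * L \<le> beta (Suc k) * tau (Suc k) * p k"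
    and last_step: "k \<ge> 1 \<Longrightarrow> 2 * L \<le> (1 + tau k) * p k"
begin

definition q :: "nat \<Rightarrow> real" where "q k = L * real (T k) / (4 * beta k * R\<^sup>2)"

definition eta :: "nat \<Rightarrow> nat \<Rightarrow> real" where
  "eta k t = (p k + m) * (real t - 1) + p k * real (T k)"

definition alpha :: "nat \<Rightarrow> nat \<Rightarrow> real" where
  "alpha k t = (if k \<ge> 2 \<and> t = 1 then beta (k - 1) * real (T k) / (beta k * real (T (k - 1))) else 1)"

lemma q_pos: "k \<ge> 1 \<Longrightarrow> q k > 0"
  using L R beta_pos[of k] T_pos[of k] by (simp add: q_def)

lemma weight_q: "k \<ge> 1 \<Longrightarrow> beta k / real (T k) * (q k / 2) = L / (8 * R\<^sup>2)"
  using beta_pos[of k] T_pos[of k] R by (simp add: q_def field_simps)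

lemma eta_Suc: "eta k (Suc (Suc t)) = eta k (Suc t) + (p k + m)"
  by (simp add: eta_def algebra_simps)

lemma coupling_eta: 
  assumes k: "k \<ge> 1" shows "An\<^sup>2 / (2 * q k) \<le> eta k (Suc t)"
proof -
  have T: "real (T k) > 0" using T_pos[OF k] by simp
  have "An\<^sup>2 / (2 * q k) = 2 * beta k * R\<^sup>2 * An\<^sup>2 / (L * real (T k))"
    using L R beta_pos[OF k] T by (simp add: q_def field_simps)
  also have "\<dots> \<le> L * p k * (real (T k))\<^sup>2 / (L * real (T k))"
    using coupling[OF k] L T by (intro divide_right_mono) auto
  also have "\<dots> = p k * real (T k)" using L T by (simp add: power2_eq_square)
  also have "\<dots> \<le> eta k (Suc t)" using p_pos[OF k] m by (simp add: eta_def)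
  finally show ?thesis .
qed

end

text \<open>The relations between the iterates of one run that enter the energy estimate. \<open>X k t\<close> and
  \<open>Z k t\<close> are the inner iterates, \<open>Y k t\<close> is the primal inner iterate that precedes \<open>X k t\<close>, and
  \<open>xs\<close>, \<open>ys\<close>, \<open>zs\<close> are their values at the end of an outer iteration. The subproblems enter only
  through the three-point inequality of a proximal step, relaxed by the tolerance \<open>e k t\<close>.\<close>

locale sliding_trace = sliding_params L m R An tau lam beta p T
  for L m R An :: real and tau lam beta p :: "nat \<Rightarrow> real" and T :: "nat \<Rightarrow> nat" +
  fixes f nu :: "'a::real_inner \<Rightarrow> real" and g gnu A :: "'a \<Rightarrow> 'a" and S :: "'a set"
    and xs ys zs xh xu v :: "nat \<Rightarrow> 'a" and X Y Z :: "nat \<Rightarrow> nat \<Rightarrow> 'a" and e :: "nat \<Rightarrow> nat \<Rightarrow> real"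
  assumes bregman: "f b - f a - g a \<bullet> (b - a) \<ge> (norm (g b - g a))\<^sup>2 / (2 * L)"
    and nu_tangent: "nu b \<ge> nu a + gnu a \<bullet> (b - a)"
    and A: "linear A" "\<And>a b. A a \<bullet> b = a \<bullet> A b" "\<And>a. norm (A a) \<le> An * norm a"
    and init: "xh 0 = xs 0" "ys 0 = xs 0" "zs 0 = 0"
    and inner_init: "X (Suc k) 0 = xs k" "Y (Suc k) 0 = ys k" "Z (Suc k) 0 = zs k"
    and inner_Y: "Y (Suc k) (Suc t) = X (Suc k) t"
    and inner_Z: "Z (Suc k) (Suc t) = Z (Suc k) t +
        (1 / q (Suc k)) *\<^sub>R A (X (Suc k) t + alpha (Suc k) (Suc t) *\<^sub>R (X (Suc k) t - Y (Suc k) t))"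
    and inner_X: "a \<in> S \<Longrightarrow>
        m * nu (X (Suc k) (Suc t)) + (v (Suc k) + A (Z (Suc k) (Suc t))) \<bullet> X (Suc k) (Suc t)
        + eta (Suc k) (Suc t) * (norm (X (Suc k) t - X (Suc k) (Suc t)))\<^sup>2
        + p (Suc k) * (norm (xs k - X (Suc k) (Suc t)))\<^sup>2
        + (m + eta (Suc k) (Suc t) + p (Suc k)) * (norm (X (Suc k) (Suc t) - a))\<^sup>2
      \<le> m * nu a + (v (Suc k) + A (Z (Suc k) (Suc t))) \<bullet> a
        + eta (Suc k) (Suc t) * (norm (X (Suc k) t - a))\<^sup>2
        + p (Suc k) * (norm (xs k - a))\<^sup>2 + e (Suc k) (Suc t)"
    and outer: "xs (Suc k) = X (Suc k) (T (Suc k))" "ys (Suc k) = Y (Suc k) (T (Suc k))"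
      "zs (Suc k) = Z (Suc k) (T (Suc k))"
    and average: "xh (Suc k) = (1 / real (T (Suc k))) *\<^sub>R (\<Sum>t=1..T (Suc k). X (Suc k) t)"
    and query: "(1 + tau (Suc k)) *\<^sub>R xu (Suc k)
        = xs k + lam (Suc k) *\<^sub>R (xh k - xs (k - 1)) + tau (Suc k) *\<^sub>R xu k"
begin

text \<open>The part of the potential that carries over from one inner step to the next; \<open>al\<close> is the
  extrapolation weight that the next step uses.\<close>

definition inner_potential :: "'a \<Rightarrow> 'a \<Rightarrow> nat \<Rightarrow> nat \<Rightarrow> real \<Rightarrow> real" where
  "inner_potential x z k t al =
     eta k (Suc t) * (norm (X k t - x))\<^sup>2 + q k / 2 * (norm (Z k t - z))\<^sup>2
     - al * (A (X k t - Y k t) \<bullet> (z - Z k t))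
     + al\<^sup>2 * (An\<^sup>2 / (2 * q k)) * (norm (X k t - Y k t))\<^sup>2"

text \<open>At the start there is no preceding step, and the first prox weight is \<open>2 beta 1 * p 1 = 8 L\<close>.\<close>

definition outer_potential :: "'a \<Rightarrow> 'a \<Rightarrow> nat \<Rightarrow> real" where
  "outer_potential x z k =
     (if k = 0 then 8 * L * (norm (xs 0 - x))\<^sup>2 + L / (8 * R\<^sup>2) * (norm z)\<^sup>2
      else beta k * (2 * p k + m) * (norm (xs k - x))\<^sup>2 + L / (8 * R\<^sup>2) * (norm (zs k - z))\<^sup>2
        - beta k / real (T k) * (A (xs k - ys k) \<bullet> (z - zs k))
        + beta k / real (T k) * (An\<^sup>2 / (2 * q k)) * (norm (xs k - ys k))\<^sup>2)"

lemma inner_step: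
  assumes x: "x \<in> S" "A x = 0"
  shows "m * nu (X (Suc k) (Suc t)) - m * nu x + v (Suc k) \<bullet> (X (Suc k) (Suc t) - x)
      + A (X (Suc k) (Suc t)) \<bullet> z + p (Suc k) * (norm (xs k - X (Suc k) (Suc t)))\<^sup>2
    \<le> p (Suc k) * (norm (xs k - x))\<^sup>2 + e (Suc k) (Suc t)
      + inner_potential x z (Suc k) t (alpha (Suc k) (Suc t))
      - inner_potential x z (Suc k) (Suc t) 1"
  using primal_dual_inner_step[OF A x(2) q_pos coupling_eta inner_Z inner_X[OF x(1)]]
  by (simp add: inner_potential_def eta_Suc inner_Y)

lemma inner_loop_estimate:
  assumes x: "x \<in> S" "A x = 0"
  shows "(\<Sum>t=1..Suc n. m * nu (X (Suc k) t) - m * nu x + v (Suc k) \<bullet> (X (Suc k) t - x)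
      + A (X (Suc k) t) \<bullet> z + p (Suc k) * (norm (xs k - X (Suc k) t))\<^sup>2)
    \<le> real (Suc n) * (p (Suc k) * (norm (xs k - x))\<^sup>2) + (\<Sum>t=1..Suc n. e (Suc k) t)
      + inner_potential x z (Suc k) 0 (alpha (Suc k) 1) - inner_potential x z (Suc k) (Suc n) 1"
proof (induction n)
  case 0
  show ?case using inner_step[OF x, of k 0 z] by simp
next
  case (Suc n)
  have a: "alpha (Suc k) (Suc (Suc n)) = 1" by (simp add: alpha_def)
  have r: "real (Suc (Suc n)) * c = real (Suc n) * c + c" for c by (simp add: algebra_simps)
  show ?case using Suc inner_step[OF x, of k "Suc n" z] 
    unfolding a sum.cl_ivl_Suc[of _ 1 "Suc n"] r by simp
qed

lemma inner_potential_end: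
  "beta (Suc k) / real (T (Suc k)) * inner_potential x z (Suc k) (T (Suc k)) 1
    = outer_potential x z (Suc k)"
proof -
  have T: "real (T (Suc k)) > 0" using T_pos[of "Suc k"] by simp
  have "beta (Suc k) / real (T (Suc k)) * eta (Suc k) (Suc (T (Suc k)))
      = beta (Suc k) * (2 * p (Suc k) + m)"
    using T by (simp add: eta_def field_simps)
  moreover have "beta (Suc k) / real (T (Suc k)) * (q (Suc k) / 2) = L / (8 * R\<^sup>2)"
    by (rule weight_q) simp
  moreover have "X (Suc k) (T (Suc k)) - Y (Suc k) (T (Suc k)) = xs (Suc k) - ys (Suc k)"
    by (simp add: outer)
  ultimately show ?thesis
    unfolding inner_potential_def outer_potential_def distrib_left right_diff_distrib mult.assoc[symmetric]
    by (simp add: outer)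
qed

text \<open>The extrapolation weight of the first inner step is chosen such that the bilinear term left
  over by the previous outer iteration is continued with the same weight.\<close>

lemma inner_potential_start:
  "beta (Suc k) / real (T (Suc k)) * inner_potential x z (Suc k) 0 (alpha (Suc k) 1)
     + beta (Suc k) * (p (Suc k) * (norm (xs k - x))\<^sup>2)
    \<le> outer_potential x z k"
proof -
  define a where "a = beta (Suc k) / real (T (Suc k))"
  have T: "real (T (Suc k)) > 0" using T_pos[of "Suc k"] by simp
  have b: "beta (Suc k) > 0" using beta_pos by simp
  have e1: "a * eta (Suc k) (Suc 0) = beta (Suc k) * p (Suc k)"
    using T by (simp add: eta_def a_def)
  have w: "a * (q (Suc k) / 2) = L / (8 * R\<^sup>2)" using weight_q[of "Suc k"] by (simp add: a_def)
  have exp: "a * inner_potential x z (Suc k) 0 al + beta (Suc k) * (p (Suc k) * (norm (xs k - x))\<^sup>2)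
     = 2 * (beta (Suc k) * p (Suc k)) * (norm (xs k - x))\<^sup>2 + L / (8 * R\<^sup>2) * (norm (zs k - z))\<^sup>2
       - a * al * (A (xs k - ys k) \<bullet> (z - zs k))
       + a * al\<^sup>2 * (An\<^sup>2 / (2 * q (Suc k))) * (norm (xs k - ys k))\<^sup>2" for al
    using e1 w unfolding inner_potential_def inner_init
    by (simp add: distrib_left right_diff_distrib mult.assoc[symmetric])
  show ?thesis
  proof (cases "k = 0")
    case True
    have "2 * (beta (Suc k) * p (Suc k)) = 8 * L" using True beta_p_1 by simp
    thus ?thesis using exp[of "alpha (Suc k) 1"] A(1) True unfolding a_def[symmetric]
      by (simp add: outer_potential_def init linear_0)
  next
    case False
    define al where "al = alpha (Suc k) 1"
    have T': "real (T k) > 0" "beta k > 0" using T_pos[of k] beta_pos[of k] False by simp_all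
    have al: "a * al = beta k / real (T k)"
      using False b T T' by (simp add: al_def alpha_def a_def)
    have "q (Suc k) = L / (4 * R\<^sup>2 * a)" "q k = L / (4 * R\<^sup>2 * (beta k / real (T k)))"
      by (simp_all add: q_def a_def)
    note qs = this
    have gen: "c * s\<^sup>2 * (An\<^sup>2 / (2 * (L / (4 * R\<^sup>2 * c)))) = (c * s)\<^sup>2 * (2 * R\<^sup>2 * An\<^sup>2 / L)"
      if "c > 0" for c s
      using that L R by (simp add: field_simps power2_eq_square)
    have "a * al\<^sup>2 * (An\<^sup>2 / (2 * q (Suc k))) = (a * al)\<^sup>2 * (2 * R\<^sup>2 * An\<^sup>2 / L)"
      unfolding qs using b T by (intro gen) (simp add: a_def)
    moreover have "beta k / real (T k) * 1\<^sup>2 * (An\<^sup>2 / (2 * q k))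
        = (beta k / real (T k) * 1)\<^sup>2 * (2 * R\<^sup>2 * An\<^sup>2 / L)"
      unfolding qs using T' by (intro gen) simp
    ultimately have al2: "a * al\<^sup>2 * (An\<^sup>2 / (2 * q (Suc k))) = beta k / real (T k) * (An\<^sup>2 / (2 * q k))"
      by (simp add: al)
    have "2 * (beta (Suc k) * p (Suc k)) * (norm (xs k - x))\<^sup>2
        \<le> beta k * (2 * p k + m) * (norm (xs k - x))\<^sup>2"
      using prox_weights[of k] False by (intro mult_right_mono) auto
    thus ?thesis using exp[of al] False
      unfolding al2 unfolding al unfolding al_def[symmetric] a_def[symmetric] outer_potential_def by simp
  qed
qed

lemma outer_potential_nonneg: "outer_potential x z k \<ge> 0"
proof (cases "k = 0")
  case True
  thus ?thesis using L by (simp add: outer_potential_def)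
next
  case False
  hence k: "k \<ge> 1" by simp
  have a: "beta k / real (T k) > 0" using beta_pos[OF k] T_pos[OF k] by simp
  have "A (xs k - ys k) \<bullet> (z - zs k) \<le> (norm (A (xs k - ys k)))\<^sup>2 / (2 * q k) + q k / 2 * (norm (z - zs k))\<^sup>2"
    using q_pos[OF k] by (rule inner_young)
  also have "(norm (A (xs k - ys k)))\<^sup>2 / (2 * q k) \<le> (An * norm (xs k - ys k))\<^sup>2 / (2 * q k)"
    using q_pos[OF k] by (intro divide_right_mono power_mono A) auto
  finally have "A (xs k - ys k) \<bullet> (z - zs k)
      \<le> An\<^sup>2 / (2 * q k) * (norm (xs k - ys k))\<^sup>2 + q k / 2 * (norm (zs k - z))\<^sup>2"
    by (simp add: power_mult_distrib norm_minus_commute)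
  hence "beta k / real (T k) * (A (xs k - ys k) \<bullet> (z - zs k)) \<le> beta k / real (T k) *
      (An\<^sup>2 / (2 * q k) * (norm (xs k - ys k))\<^sup>2 + q k / 2 * (norm (zs k - z))\<^sup>2)"
    using a by (intro mult_left_mono) auto
  also have "\<dots> = beta k / real (T k) * (An\<^sup>2 / (2 * q k)) * (norm (xs k - ys k))\<^sup>2
      + L / (8 * R\<^sup>2) * (norm (zs k - z))\<^sup>2"
    by (simp only: distrib_left mult.assoc[symmetric] weight_q[OF k])
  finally have "beta k / real (T k) * (A (xs k - ys k) \<bullet> (z - zs k)) \<le> \<dots>" .
  moreover have "beta k * (2 * p k + m) * (norm (xs k - x))\<^sup>2 \<ge> 0"
    using beta_pos[OF k] p_pos[OF k] m by simp
  ultimately show ?thesis using False by (simp add: outer_potential_def)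
qed

definition step :: "nat \<Rightarrow> 'a" where "step k = xh k - xs (k - 1)"

lemma outer_estimate:
  assumes x: "x \<in> S" "A x = 0"
  shows "beta (Suc k) * (m * nu (xh (Suc k)) - m * nu x + v (Suc k) \<bullet> (xh (Suc k) - x)
      + A (xh (Suc k)) \<bullet> z + p (Suc k) * (norm (step (Suc k)))\<^sup>2)
    \<le> beta (Suc k) / real (T (Suc k)) * (\<Sum>t=1..T (Suc k). e (Suc k) t)
      + outer_potential x z k - outer_potential x z (Suc k)"
proof -
  define n where "n = T (Suc k)"
  have n: "n \<ge> 1" "real n > 0" using T_pos[of "Suc k"] by (simp_all add: n_def)
  define a where "a = beta (Suc k) / real n"
  have a: "a > 0" "a * real n = beta (Suc k)" using n beta_pos[of "Suc k"] by (simp_all add: a_def)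
  interpret A: linear A by (rule A)
  have xh: "xh (Suc k) = (1 / real n) *\<^sub>R (\<Sum>t\<in>{1..n}. 1 *\<^sub>R X (Suc k) t)"
    by (simp add: average n_def)
  have sumX: "(\<Sum>t=1..n. X (Suc k) t) = real n *\<^sub>R xh (Suc k)"
    using n by (simp add: xh)
  have 1: "real n * nu (xh (Suc k)) \<le> (\<Sum>t=1..n. nu (X (Suc k) t))"
    using tangent_jensen[of nu gnu "{1..n}" "\<lambda>_. 1" "real n" "X (Suc k)"] nu_tangent n
    by (simp add: xh)
  have tsq: "(norm (xs k - b))\<^sup>2 \<ge> (norm (xs k - c))\<^sup>2 + (2 *\<^sub>R (c - xs k)) \<bullet> (b - c)" for b c
  proof -
    have "0 \<le> (norm (b - c))\<^sup>2" by simp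
    thus ?thesis
      by (simp add: power2_norm_eq_inner inner_diff_left inner_diff_right inner_commute)
  qed
  have 2: "real n * (norm (xs k - xh (Suc k)))\<^sup>2 \<le> (\<Sum>t=1..n. (norm (xs k - X (Suc k) t))\<^sup>2)"
    using tangent_jensen[of "\<lambda>b. (norm (xs k - b))\<^sup>2" "\<lambda>c. 2 *\<^sub>R (c - xs k)" "{1..n}" "\<lambda>_. 1" "real n" "X (Suc k)", OF tsq] n
    by (simp add: xh)
  have "real n * (m * nu (xh (Suc k)) - m * nu x + v (Suc k) \<bullet> (xh (Suc k) - x)
      + A (xh (Suc k)) \<bullet> z + p (Suc k) * (norm (step (Suc k)))\<^sup>2)
    = m * (real n * nu (xh (Suc k))) - real n * (m * nu x)
      + v (Suc k) \<bullet> (real n *\<^sub>R xh (Suc k)) - real n * (v (Suc k) \<bullet> x)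
      + A (real n *\<^sub>R xh (Suc k)) \<bullet> z + p (Suc k) * (real n * (norm (xs k - xh (Suc k)))\<^sup>2)"
    by (simp add: step_def A.scaleR inner_diff_right norm_minus_commute algebra_simps)
  also have "\<dots> \<le> m * (\<Sum>t=1..n. nu (X (Suc k) t)) - real n * (m * nu x)
      + v (Suc k) \<bullet> (\<Sum>t=1..n. X (Suc k) t) - real n * (v (Suc k) \<bullet> x)
      + A (\<Sum>t=1..n. X (Suc k) t) \<bullet> z + p (Suc k) * (\<Sum>t=1..n. (norm (xs k - X (Suc k) t))\<^sup>2)"
    unfolding sumX using 1 2 m p_pos[of "Suc k"]
    by (intro add_mono diff_mono mult_left_mono) auto
  also have "\<dots> = (\<Sum>t=1..n. m * nu (X (Suc k) t) - m * nu x + v (Suc k) \<bullet> (X (Suc k) t - x)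
      + A (X (Suc k) t) \<bullet> z + p (Suc k) * (norm (xs k - X (Suc k) t))\<^sup>2)"
    by (simp add: sum.distrib sum_subtractf sum_distrib_left A.sum inner_sum_left inner_sum_right
        inner_diff_right)
  also have "\<dots> \<le> real n * (p (Suc k) * (norm (xs k - x))\<^sup>2) + (\<Sum>t=1..n. e (Suc k) t)
      + inner_potential x z (Suc k) 0 (alpha (Suc k) 1) - inner_potential x z (Suc k) n 1"
    using inner_loop_estimate[OF x, of k z "n - 1"] n(1) by simp
  finally have "a * (real n * (m * nu (xh (Suc k)) - m * nu x + v (Suc k) \<bullet> (xh (Suc k) - x)
      + A (xh (Suc k)) \<bullet> z + p (Suc k) * (norm (step (Suc k)))\<^sup>2))
    \<le> a * (real n * (p (Suc k) * (norm (xs k - x))\<^sup>2) + (\<Sum>t=1..n. e (Suc k) t)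
      + inner_potential x z (Suc k) 0 (alpha (Suc k) 1) - inner_potential x z (Suc k) n 1)"
    using a by (intro mult_left_mono) auto
  also have "\<dots> = beta (Suc k) * (p (Suc k) * (norm (xs k - x))\<^sup>2) + a * (\<Sum>t=1..n. e (Suc k) t)
      + a * inner_potential x z (Suc k) 0 (alpha (Suc k) 1) - a * inner_potential x z (Suc k) n 1"
    by (simp only: a(2)[symmetric]) (simp add: algebra_simps)
  finally show ?thesis
    using inner_potential_start[of k x z] inner_potential_end[of k x z]
    unfolding mult.assoc[symmetric] a(2) n_def[symmetric] a_def[symmetric] by (simp add: mult.assoc)
qed

text \<open>The gradient extrapolation is the proximal step \<open>y\<^sub>k = grad f (xu k)\<close> of the conjugate of
  \<open>f\<close>. Expressed through \<open>f\<close> itself, the value of the conjugate at \<open>grad f (c)\<close> is \<open>conj c\<close> and its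
  Bregman distances are those of \<open>f\<close> with exchanged arguments.\<close>

definition conj :: "'a \<Rightarrow> real" where "conj c = c \<bullet> g c - f c"
definition breg :: "'a \<Rightarrow> 'a \<Rightarrow> real" where "breg a b = f a - f b - g b \<bullet> (a - b)"

lemma breg_lower: "breg a b \<ge> (norm (g a - g b))\<^sup>2 / (2 * L)"
  unfolding breg_def by (rule bregman)

lemma breg_nonneg: "breg a b \<ge> 0"
  using breg_lower[of b a] L by (smt (verit) breg_lower divide_nonneg_pos zero_le_power2)

lemma conj_three_point:
  assumes "(1 + t) *\<^sub>R c = d + t *\<^sub>R b"
  shows "conj c - conj w + d \<bullet> (g w - g c) = t * breg b w - (1 + t) * breg c w - t * breg b c"
proof -
  have d: "d = (1 + t) *\<^sub>R c - t *\<^sub>R b" using assms by (simp add: algebra_simps)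
  show ?thesis unfolding d conj_def breg_def
    by (simp add: inner_diff_left inner_diff_right inner_add_left inner_commute algebra_simps)
qed

text \<open>It starts from 0 because the first query point is not averaged (\<open>tau 1 = 0\<close>) and no step precedes
  the first iteration.\<close>

definition accel_potential :: "'a \<Rightarrow> nat \<Rightarrow> real" where
  "accel_potential w k = (if k = 0 then 0 else
     beta k * (1 + tau k) * breg (xu k) w - beta k * (step k \<bullet> (g w - g (xu k)))
     + beta k * p k / 4 * (norm (step k))\<^sup>2)"

text \<open>The extrapolation replaces the current displacement \<open>step (Suc k)\<close> by the previous one. The error
  telescopes up to a pairing of the previous displacement with the change of the gradient, which is
  paid by the Bregman distance of the two query points (a bound for the squared gradient change) and
  by a quarter of the primal proximal term. The other three quarters are kept for the noise.\<close>

lemma accel_step: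
  "beta (Suc k) * (conj (xu (Suc k)) - conj w + xh (Suc k) \<bullet> g w - x \<bullet> g (xu (Suc k)))
    \<le> beta (Suc k) * (g (xu (Suc k)) \<bullet> (xh (Suc k) - x)) + beta (Suc k) * p (Suc k) / 4 * (norm (step (Suc k)))\<^sup>2
      + accel_potential w k - accel_potential w (Suc k)"
proof -
  define b where "b = beta (Suc k)"
  define t where "t = tau (Suc k)"
  define y where "y = g (xu (Suc k))"
  define l where "l = lam (Suc k)"
  have b: "b > 0" using beta_pos[of "Suc k"] by (simp add: b_def)
  have tp: "conj (xu (Suc k)) - conj w + (xs k + l *\<^sub>R step k) \<bullet> (g w - y)
      = t * breg (xu k) w - (1 + t) * breg (xu (Suc k)) w - t * breg (xu k) (xu (Suc k))"
    unfolding y_def t_def l_def using query[of k] by (intro conj_three_point) (simp add: step_def)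
  have xh: "xh (Suc k) = xs k + step (Suc k)" by (simp add: step_def)
  have id: "conj (xu (Suc k)) - conj w + xh (Suc k) \<bullet> g w - x \<bullet> y
    = y \<bullet> (xh (Suc k) - x) + (conj (xu (Suc k)) - conj w + (xs k + l *\<^sub>R step k) \<bullet> (g w - y))
      + step (Suc k) \<bullet> (g w - y) - l * (step k \<bullet> (g w - y))"
    by (simp add: xh inner_diff_right inner_add_left inner_add_right inner_commute[of y] algebra_simps)
  have main: "b * t * breg (xu k) w - b * t * breg (xu k) (xu (Suc k)) - b * l * (step k \<bullet> (g w - y))
     \<le> accel_potential w k"
  proof (cases "k = 0")
    case True
    have "t = 0" "step k = 0" using True tau_1 by (simp_all add: t_def step_def init)
    thus ?thesis using True by (simp add: accel_potential_def)
  next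
    case False
    hence k: "k \<ge> 1" by simp
    have bl: "b * l = beta k" using lam_weights[OF k] by (simp add: b_def l_def)
    have bt: "b * t * breg (xu k) w \<le> beta k * (1 + tau k) * breg (xu k) w"
      using tau_weights[OF k] by (intro mult_right_mono breg_nonneg) (simp add: b_def t_def)
    have t: "t > 0"
    proof (rule ccontr)
      assume "\<not> t > 0"
      hence "t = 0" using tau_nonneg[of "Suc k"] by (simp add: t_def)
      thus False using extrapolation[OF k] L beta_pos[OF k] by (simp add: t_def zero_le_mult_iff mult_le_0_iff)
    qed
    have "beta k * (step k \<bullet> (y - g (xu k))) \<le> b * t * breg (xu k) (xu (Suc k)) + beta k * p k / 4 * (norm (step k))\<^sup>2"
    proof -
      have c: "b * t / L > 0" using b t L by simp
      have "(beta k *\<^sub>R step k) \<bullet> (y - g (xu k)) \<le> (norm (beta k *\<^sub>R step k))\<^sup>2 / (2 * (b * t / L))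
         + (b * t / L) / 2 * (norm (y - g (xu k)))\<^sup>2"
        using c by (rule inner_young)
      also have "(b * t / L) / 2 * (norm (y - g (xu k)))\<^sup>2 = b * t * ((norm (g (xu k) - y))\<^sup>2 / (2 * L))"
        by (simp add: norm_minus_commute)
      also have "\<dots> \<le> b * t * breg (xu k) (xu (Suc k))"
        unfolding y_def using b t by (intro mult_left_mono breg_lower) auto
      also have "(norm (beta k *\<^sub>R step k))\<^sup>2 / (2 * (b * t / L))
          = beta k * (2 * beta k * L) / (4 * (b * t)) * (norm (step k))\<^sup>2"
        using L by (simp add: power_mult_distrib power2_eq_square)
      also have "\<dots> \<le> beta k * (b * t * p k) / (4 * (b * t)) * (norm (step k))\<^sup>2"
        using extrapolation[OF k] beta_pos[OF k] b t 
        by (intro mult_right_mono divide_right_mono mult_left_mono) (auto simp: b_def t_def)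
      also have "\<dots> = beta k * p k / 4 * (norm (step k))\<^sup>2"
        using b t by simp
      finally show ?thesis by simp
    qed
    moreover have "beta k * (step k \<bullet> (g w - y)) 
        = beta k * (step k \<bullet> (g w - g (xu k))) - beta k * (step k \<bullet> (y - g (xu k)))"
      by (simp add: inner_diff_right algebra_simps)
    ultimately show ?thesis using bt False unfolding bl accel_potential_def by simp
  qed
  have "b * (conj (xu (Suc k)) - conj w + xh (Suc k) \<bullet> g w - x \<bullet> y)
     = b * (y \<bullet> (xh (Suc k) - x)) + b * t * breg (xu k) w - b * (1 + t) * breg (xu (Suc k)) w
       - b * t * breg (xu k) (xu (Suc k)) + b * (step (Suc k) \<bullet> (g w - y)) - b * l * (step k \<bullet> (g w - y))"
    unfolding id tp by (simp add: algebra_simps)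
  also have "\<dots> \<le> b * (y \<bullet> (xh (Suc k) - x)) + accel_potential w k
      - b * (1 + t) * breg (xu (Suc k)) w + b * (step (Suc k) \<bullet> (g w - y))"
    using main by linarith
  finally show ?thesis unfolding accel_potential_def[of w "Suc k"] b_def y_def t_def by simp
qed

lemma accel_potential_nonneg: "accel_potential w k \<ge> 0"
proof (cases "k = 0")
  case False
  hence k: "k \<ge> 1" by simp
  define c where "c = (1 + tau k) / L"
  have c: "c > 0" using tau_nonneg[OF k] L by (simp add: c_def)
  have "step k \<bullet> (g w - g (xu k)) \<le> (norm (step k))\<^sup>2 / (2 * c) + c / 2 * (norm (g w - g (xu k)))\<^sup>2"
    using c by (rule inner_young)
  also have "c / 2 * (norm (g w - g (xu k)))\<^sup>2 = (1 + tau k) * ((norm (g (xu k) - g w))\<^sup>2 / (2 * L))"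
    by (simp add: c_def norm_minus_commute)
  also have "\<dots> \<le> (1 + tau k) * breg (xu k) w"
    using tau_nonneg[OF k] by (intro mult_left_mono breg_lower) auto
  also have "(norm (step k))\<^sup>2 / (2 * c) = 2 * L / (4 * (1 + tau k)) * (norm (step k))\<^sup>2"
    using L tau_nonneg[OF k] by (simp add: c_def divide_simps)
  also have "\<dots> \<le> (1 + tau k) * p k / (4 * (1 + tau k)) * (norm (step k))\<^sup>2"
    using last_step[OF k] tau_nonneg[OF k] by (intro mult_right_mono divide_right_mono) auto
  also have "\<dots> = p k / 4 * (norm (step k))\<^sup>2"
    using tau_nonneg[OF k] by (simp add: divide_simps)
  finally have "beta k * (step k \<bullet> (g w - g (xu k)))
      \<le> beta k * (p k / 4 * (norm (step k))\<^sup>2 + (1 + tau k) * breg (xu k) w)"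
    using beta_pos[OF k] by (intro mult_left_mono) auto
  thus ?thesis using False by (simp add: accel_potential_def algebra_simps)
qed (simp add: accel_potential_def)

text \<open>The energy estimate of the method: primal, dual and accelerated parts are telescoped
  together, and the quadratic terms in \<open>step\<close> pay for the extrapolation and for the noise.\<close>

theorem gap_estimate:
  assumes x: "x \<in> S" "A x = 0" and N: "N \<ge> 1"
  defines "B \<equiv> \<Sum>k=1..N. beta k"
  defines "w \<equiv> (1 / B) *\<^sub>R (\<Sum>k=1..N. beta k *\<^sub>R xh k)"
  shows "B * ((f w + m * nu w) - (f x + m * nu x) + A w \<bullet> z)
    \<le> 8 * L * (norm (xs 0 - x))\<^sup>2 + L / (8 * R\<^sup>2) * (norm z)\<^sup>2
      + (\<Sum>k=1..N. beta k / real (T k) * (\<Sum>t=1..T k. e k t))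
      + (\<Sum>k=1..N. beta k * ((v k - g (xu k)) \<bullet> (x - xs (k - 1))))
      + (\<Sum>k=1..N. beta k * (norm (v k - g (xu k)))\<^sup>2 / (3 * p k))"
proof -
  interpret A: linear A by (rule A)
  define u where "u k = v k - g (xu k)" for k
  define lhs where "lhs k = beta k * (conj (xu k) - conj w + xh k \<bullet> g w - x \<bullet> g (xu k)
       + m * nu (xh k) - m * nu x + A (xh k) \<bullet> z)" for k
  define rhs where "rhs k = beta k / real (T k) * (\<Sum>t=1..T k. e k t) + beta k * (u k \<bullet> (x - xs (k - 1)))
       + beta k * (norm (u k))\<^sup>2 / (3 * p k)" for k
  define pot where "pot k = outer_potential x z k + accel_potential w k" for k
  have one: "lhs (Suc k) \<le> rhs (Suc k) + pot k - pot (Suc k)" for k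
  proof -
    define b where "b = beta (Suc k)"
    define P where "P = p (Suc k)"
    have P: "P > 0" and b: "b > 0" using p_pos beta_pos by (simp_all add: P_def b_def)
    have vu: "v (Suc k) = g (xu (Suc k)) + u (Suc k)" by (simp add: u_def)
    \<comment> \<open>the weight is chosen such that exactly three quarters of the proximal term are used\<close>
    have "- u (Suc k) \<bullet> step (Suc k) \<le> (norm (- u (Suc k)))\<^sup>2 / (2 * (3 / 2 * P)) + (3 / 2 * P) / 2 * (norm (step (Suc k)))\<^sup>2"
      using P by (intro inner_young) auto
    hence "u (Suc k) \<bullet> step (Suc k) \<ge> - ((norm (u (Suc k)))\<^sup>2 / (3 * P)) - 3 / 4 * P * (norm (step (Suc k)))\<^sup>2"
      by simp
    hence "b * (u (Suc k) \<bullet> step (Suc k)) \<ge> b * (- ((norm (u (Suc k)))\<^sup>2 / (3 * P)) - 3 / 4 * P * (norm (step (Suc k)))\<^sup>2)"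
      using b by (intro mult_left_mono) auto
    moreover have "u (Suc k) \<bullet> (xh (Suc k) - x) = u (Suc k) \<bullet> step (Suc k) - u (Suc k) \<bullet> (x - xs k)"
      by (simp add: step_def inner_diff_right)
    ultimately have noise: "b * (u (Suc k) \<bullet> (xh (Suc k) - x)) \<ge> - (b * (norm (u (Suc k)))\<^sup>2 / (3 * P))
        - 3 / 4 * b * P * (norm (step (Suc k)))\<^sup>2 - b * (u (Suc k) \<bullet> (x - xs k))"
      by (simp add: algebra_simps)
    show ?thesis
      using outer_estimate[OF x, of k z] accel_step[of k w x] noise
      unfolding lhs_def rhs_def pot_def vu inner_add_left b_def P_def
      by (simp add: algebra_simps)
  qed
  have tele: "(\<Sum>k=1..n. lhs k) \<le> (\<Sum>k=1..n. rhs k) + pot 0 - pot n" for n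
  proof (induction n)
    case (Suc n) thus ?case using one[of n] by simp
  qed simp
  have B: "B > 0" unfolding B_def using N beta_pos by (intro sum_pos) auto
  have Bw: "B *\<^sub>R w = (\<Sum>k=1..N. beta k *\<^sub>R xh k)" using B by (simp add: w_def)
  have fx: "f x \<ge> x \<bullet> g (xu k) - conj (xu k)" for k
    using breg_nonneg[of x "xu k"] by (simp add: breg_def conj_def inner_diff_right inner_commute)
  have nuB: "B * nu w \<le> (\<Sum>k=1..N. beta k * nu (xh k))"
    unfolding w_def by (rule tangent_jensen[of nu gnu]) (use nu_tangent B beta_pos in \<open>auto simp: B_def less_imp_le\<close>)
  have "B * ((f w + m * nu w) - (f x + m * nu x) + A w \<bullet> z)
     = (B *\<^sub>R w) \<bullet> g w - B * conj w - B * f x + m * (B * nu w) - B * (m * nu x) + A (B *\<^sub>R w) \<bullet> z"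
    by (simp add: conj_def A.scaleR algebra_simps)
  also have "\<dots> \<le> (B *\<^sub>R w) \<bullet> g w - B * conj w - B * f x + m * (\<Sum>k=1..N. beta k * nu (xh k))
      - B * (m * nu x) + A (B *\<^sub>R w) \<bullet> z"
    using nuB m by (simp add: mult_left_mono)
  also have "\<dots> = (\<Sum>k=1..N. beta k * (xh k \<bullet> g w - conj w - f x + m * nu (xh k) - m * nu x + A (xh k) \<bullet> z))"
    unfolding Bw
    by (simp add: B_def A.sum A.scaleR inner_sum_left sum_distrib_left sum_distrib_right
        sum.distrib sum_subtractf algebra_simps)
  also have "\<dots> \<le> (\<Sum>k=1..N. lhs k)"
    unfolding lhs_def using fx beta_pos 
    by (intro sum_mono mult_left_mono) (auto simp: algebra_simps less_imp_le)
  also have "\<dots> \<le> (\<Sum>k=1..N. rhs k) + pot 0"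
    using tele[of N] outer_potential_nonneg[of x z N] accel_potential_nonneg[of w N] 
    by (simp add: pot_def)
  also have "pot 0 = 8 * L * (norm (xs 0 - x))\<^sup>2 + L / (8 * R\<^sup>2) * (norm z)\<^sup>2"
    by (simp add: pot_def outer_potential_def accel_potential_def)
  finally show ?thesis by (simp add: rhs_def u_def sum.distrib)
qed

end

section \<open>The parameter choice\<close>

context
  fixes L m :: real
  assumes L: "L > 0" and m: "m \<ge> 0"
begin

private abbreviation "tau \<equiv> tau_of L m"
private abbreviation "lam \<equiv> lam_of L m"
private abbreviation "D \<equiv> the_enat (Delta_of L m)"

lemma tau_of_pos: "m > 0 \<Longrightarrow> tau > 0" and tau_of_square: "m > 0 \<Longrightarrow> tau\<^sup>2 = 4 * L / m"
  using L by (simp_all add: tau_of_def power_mult_distrib)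

lemma lam_of_pos: "m > 0 \<Longrightarrow> lam > 0"
  using tau_of_pos by (simp_all add: lam_of_def)

lemma Delta_of_bounds:
  assumes "m > 0"
  shows "Delta_of L m = enat D" "2 * tau + 1 \<le> real D" "real D \<le> 2 * tau + 2"
proof -
  show "Delta_of L m = enat D" using assms by (simp add: Delta_of_def)
  have D: "real D = of_int \<lceil>2 * tau + 1\<rceil>"
    using assms tau_of_pos[OF assms] by (simp add: Delta_of_def)
  show "2 * tau + 1 \<le> real D" "real D \<le> 2 * tau + 2" unfolding D by linarith+
qed

lemma late_imp_mu_pos: "\<not> enat k \<le> Delta_of L m \<Longrightarrow> m > 0"
  using m by (auto simp: Delta_of_def split: if_splits)

lemma early_values:
  assumes "enat k \<le> Delta_of L m"
  shows "beta_of L m k = real k" "p_of L m k = 4 * L / real k"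
  using assms by (simp_all add: beta_of_def p_of_def)

lemma late_values:
  assumes "\<not> enat k \<le> Delta_of L m"
  shows "beta_of L m k = real D * lam powr (- (real k - real D))"
    and "p_of L m k = 2 * L / (1 + tau)"
  using assms by (simp_all add: beta_of_def p_of_def Let_def)

lemma beta_of_late_Suc:
  assumes late: "\<not> enat (Suc k) \<le> Delta_of L m"
  shows "beta_of L m (Suc k) = beta_of L m k * (1 + tau) / tau"
proof -
  have mp: "m > 0" using late by (rule late_imp_mu_pos)
  have tau: "tau > 0" and lam: "lam > 0" using mp by (rule tau_of_pos lam_of_pos)+
  have "- (real (Suc k) - real D) = - (real k - real D) + - 1" by simp
  hence "beta_of L m (Suc k) = real D * (lam powr (- (real k - real D)) * lam powr (- 1))"
    unfolding late_values(1)[OF late] by (simp only: powr_add)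
  also have "lam powr (- 1) = (1 + tau) / tau"
    using lam tau by (simp add: powr_minus lam_of_def inverse_eq_divide)
  finally have step: "beta_of L m (Suc k) = real D * lam powr (- (real k - real D)) * ((1 + tau) / tau)"
    by simp
  show ?thesis
  proof (cases "enat k \<le> Delta_of L m")
    case True
    hence "k = D" using late Delta_of_bounds(1)[OF mp] by (cases "Delta_of L m") auto
    thus ?thesis using step early_values(1)[OF True] lam by simp
  next
    case False
    thus ?thesis using step late_values(1)[OF False] by simp
  qed
qed

lemma beta_of_pos: "k \<ge> 1 \<Longrightarrow> beta_of L m k > 0"
proof (cases "enat k \<le> Delta_of L m")
  case False
  thus ?thesis using late_imp_mu_pos[OF False] tau_of_pos lam_of_pos Delta_of_bounds
    by (simp add: late_values)
qed (simp add: early_values)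

lemma p_of_pos: "k \<ge> 1 \<Longrightarrow> p_of L m k > 0"
proof (cases "enat k \<le> Delta_of L m")
  case False
  thus ?thesis using late_imp_mu_pos[OF False] tau_of_pos L by (simp add: late_values)
qed (use L in \<open>simp add: early_values\<close>)

context
  fixes A R :: real
  assumes A: "A > 0" and R: "R > 0"
begin

private abbreviation "T \<equiv> T_of L m A R"

lemma T_of_early: "enat k \<le> Delta_of L m \<Longrightarrow> real (T k) \<ge> real k * R * A / L"
  by (simp add: T_of_def real_nat_ceiling_ge)

lemma T_of_late:
  "\<not> enat k \<le> Delta_of L m \<Longrightarrow>
    real (T k) \<ge> 2 * (1 + tau) * R * A / (L * lam powr ((real k - real D) / 2))"
  by (simp add: T_of_def Let_def real_nat_ceiling_ge)

lemma T_of_pos: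
  assumes k: "k \<ge> 1" shows "T k \<ge> 1"
proof -
  have "real (T k) > 0"
  proof (cases "enat k \<le> Delta_of L m")
    case True
    have "0 < real k * R * A / L" using k L R A by simp
    also note T_of_early[OF True]
    finally show ?thesis .
  next
    case False
    have "0 < 2 * (1 + tau) * R * A / (L * lam powr ((real k - real D) / 2))"
      using late_imp_mu_pos[OF False] tau_of_pos lam_of_pos L R A by simp
    also note T_of_late[OF False]
    finally show ?thesis .
  qed
  thus ?thesis by simp
qed

text \<open>\<open>Delta\<close> is where the two phases fit together: the requirement on \<open>tau\<close> needs
  \<open>Delta \<ge> 2 tau + 1\<close>, and those on the primal steps need \<open>Delta \<le> 2 tau + 2\<close>.\<close>

lemma ipds_parameters_admissible:
  "sliding_params L m R A (\<lambda>k. if enat k \<le> Delta_of L m then (real k - 1) / 2 else tau)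
     (\<lambda>k. if enat k \<le> Delta_of L m then (real k - 1) / real k else lam) (beta_of L m) (p_of L m) T"
    (is "sliding_params _ _ _ _ ?tau ?lam ?beta ?p _")
proof
  fix k :: nat assume k: "1 \<le> k"
  have kr: "real k > 0" using k by simp
  show "beta_of L m k > 0" "p_of L m k > 0" "T k \<ge> 1"
    using beta_of_pos p_of_pos T_of_pos k by auto
  show "?tau k \<ge> 0"
    using k late_imp_mu_pos[of k] tau_of_pos by (cases "enat k \<le> Delta_of L m") auto
  have b: "?beta k > 0" by (rule beta_of_pos[OF k])
  have facts: "4 * L = m * tau\<^sup>2" "tau > 0" if "m > 0"
    using that tau_of_pos[OF that] by (simp_all add: tau_of_square)
  consider (ee) "enat (Suc k) \<le> Delta_of L m" "enat k \<le> Delta_of L m"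
    | (el) "\<not> enat (Suc k) \<le> Delta_of L m" "enat k \<le> Delta_of L m"
    | (ll) "\<not> enat (Suc k) \<le> Delta_of L m" "\<not> enat k \<le> Delta_of L m"
    by (metis Suc_ile_eq order.strict_implies_order)
  note transition = this
  show "2 * (?beta (Suc k) * ?p (Suc k)) \<le> ?beta k * (2 * ?p k + m)"
  proof (cases rule: transition)
    case ee thus ?thesis using kr m by (simp add: early_values distrib_left)
  next
    case el
    hence mp: "m > 0" using late_imp_mu_pos by blast
    note f = facts[OF mp] 
    have kD: "real k = real D"
      using el Delta_of_bounds(1)[OF mp] by (cases "Delta_of L m") auto
    have "2 * (?beta (Suc k) * ?p (Suc k)) = real k * (4 * L) / tau"
      using f(2) el by (simp add: beta_of_late_Suc late_values(2) early_values divide_simps)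
    also have "\<dots> = m * (tau * real k)" unfolding f(1) using f(2) by (simp add: power2_eq_square)
    also have "\<dots> \<le> m * (2 * tau\<^sup>2 + real k)"
    proof (intro mult_left_mono)
      show "tau * real k \<le> 2 * tau\<^sup>2 + real k"
      proof (cases "tau \<le> 1")
        case True
        hence "tau * real k \<le> 1 * real k" by (intro mult_right_mono) auto
        moreover have "0 \<le> 2 * tau\<^sup>2" by simp
        ultimately show ?thesis by linarith
      next
        case False
        hence "(tau - 1) * real k \<le> (tau - 1) * (2 * tau + 2)"
          using Delta_of_bounds(3)[OF mp] kD by (intro mult_left_mono) auto
        thus ?thesis by (simp add: algebra_simps power2_eq_square)
      qed
    qed (use mp in simp)
    also have "\<dots> = 2 * (4 * L) + real k * m" unfolding f(1) by (simp add: algebra_simps)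
    also have "\<dots> = ?beta k * (2 * ?p k + m)"
      using kr el by (simp add: early_values distrib_left)
    finally show ?thesis .
  next
    case ll
    hence mp: "m > 0" using late_imp_mu_pos by blast
    note f = facts[OF mp]
    have "2 * (?beta (Suc k) * ?p (Suc k)) = ?beta k * (4 * L / tau)"
      using f(2) ll by (simp add: beta_of_late_Suc late_values(2) divide_simps)
    also have "4 * L / tau = m * tau" unfolding f(1) using f(2) by (simp add: power2_eq_square)
    also have "m * tau \<le> m * tau\<^sup>2 / (1 + tau) + m"
      using f(2) mp by (simp add: divide_simps power2_eq_square algebra_simps)
    also have "\<dots> = 2 * ?p k + m"
      unfolding f(1)[symmetric] using ll by (simp add: late_values(2))
    finally show ?thesis using b by simp
  qed
  show "2 * ?beta k * R\<^sup>2 * A\<^sup>2 \<le> L * ?p k * (real (T k))\<^sup>2"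
  proof (cases "enat k \<le> Delta_of L m")
    case True
    have "2 * ?beta k * R\<^sup>2 * A\<^sup>2 \<le> 4 * real k * R\<^sup>2 * A\<^sup>2"
      using True by (simp add: early_values)
    also have "\<dots> = L * (4 * L / real k) * (real k * R * A / L)\<^sup>2"
      using L kr by (simp add: power2_eq_square field_simps)
    also have "\<dots> \<le> L * (4 * L / real k) * (real (T k))\<^sup>2"
      using L kr R A T_of_early[OF True] by (intro mult_left_mono power_mono) auto
    finally show ?thesis using True by (simp add: early_values)
  next
    case False
    have mp: "m > 0" using False by (rule late_imp_mu_pos)
    note f = facts[OF mp]
    define s where "s = lam powr ((real k - real D) / 2)"
    have s: "s > 0" using lam_of_pos[OF mp] by (simp add: s_def)
    have s2: "s\<^sup>2 = lam powr (real k - real D)"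
      using lam_of_pos[OF mp] by (simp add: s_def power2_eq_square powr_add[symmetric])
    have "2 * ?beta k * R\<^sup>2 * A\<^sup>2 = 2 * real D * (R\<^sup>2 * A\<^sup>2 / s\<^sup>2)"
      using False lam_of_pos[OF mp] by (simp add: late_values s2 powr_diff divide_simps)
    also have "\<dots> \<le> 8 * (1 + tau) * (R\<^sup>2 * A\<^sup>2 / s\<^sup>2)"
      using Delta_of_bounds(3)[OF mp] f(2) by (intro mult_right_mono) auto
    also have "\<dots> = L * (2 * L / (1 + tau)) * (2 * (1 + tau) * R * A / (L * s))\<^sup>2"
      using L f(2) s by (simp add: power2_eq_square divide_simps) (simp add: algebra_simps)
    also have "\<dots> \<le> L * (2 * L / (1 + tau)) * (real (T k))\<^sup>2"
      using L f(2) R A s T_of_late[OF False] by (intro mult_left_mono power_mono) (auto simp: s_def)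
    finally show ?thesis using False by (simp add: late_values)
  qed
  show "?beta (Suc k) * ?tau (Suc k) \<le> ?beta k * (1 + ?tau k)"
  proof (cases rule: transition)
    case ee thus ?thesis by (simp add: early_values field_simps)
  next
    case el
    hence mp: "m > 0" using late_imp_mu_pos by blast
    note f = facts[OF mp]
    have kD: "real k = real D"
      using el Delta_of_bounds(1)[OF mp] by (cases "Delta_of L m") auto
    have "?beta (Suc k) * ?tau (Suc k) = ?beta k * (1 + tau)"
      using f el by (simp add: beta_of_late_Suc)
    also have "\<dots> \<le> ?beta k * (1 + ?tau k)"
      using b el Delta_of_bounds(2)[OF mp] kD by (intro mult_left_mono) auto
    finally show ?thesis .
  next
    case ll
    thus ?thesis using facts(2)[OF late_imp_mu_pos[OF ll(1)]] by (simp add: beta_of_late_Suc)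
  qed
  show "?beta (Suc k) * ?lam (Suc k) = ?beta k"
  proof (cases "enat (Suc k) \<le> Delta_of L m")
    case True
    hence "enat k \<le> Delta_of L m" by (metis Suc_ile_eq order.strict_implies_order)
    thus ?thesis using True by (simp add: early_values)
  next
    case False
    thus ?thesis using facts(2)[OF late_imp_mu_pos[OF False]]
      by (simp add: beta_of_late_Suc) (simp add: lam_of_def divide_simps)
  qed
  show "2 * ?beta k * L \<le> ?beta (Suc k) * ?tau (Suc k) * ?p k"
  proof (cases rule: transition)
    case ee thus ?thesis using kr L by (simp add: early_values field_simps)
  next
    case el
    hence mp: "m > 0" using late_imp_mu_pos by blast
    note f = facts[OF mp]
    have kD: "real k = real D"
      using el Delta_of_bounds(1)[OF mp] by (cases "Delta_of L m") auto
    have "2 * ?beta k * L = 2 * L * real k" using el by (simp add: early_values)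
    also have "\<dots> \<le> 2 * L * (2 * (1 + tau))"
      using L kD Delta_of_bounds(3)[OF mp] by (intro mult_left_mono) auto
    also have "\<dots> = ?beta (Suc k) * ?tau (Suc k) * ?p k"
      using f(2) el kr by (simp add: beta_of_late_Suc early_values)
    finally show ?thesis .
  next
    case ll
    thus ?thesis using facts(2)[OF late_imp_mu_pos[OF ll(1)]] by (simp add: beta_of_late_Suc late_values(2))
  qed
  show "2 * L \<le> (1 + ?tau k) * ?p k"
  proof (cases "enat k \<le> Delta_of L m")
    case True thus ?thesis using kr L by (simp add: early_values field_simps)
  next
    case False
    thus ?thesis using facts(2)[OF late_imp_mu_pos[OF False]] by (simp add: late_values(2))
  qed
next
  have D1: "enat 1 \<le> Delta_of L m"
  proof (cases "m > 0")
    case True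
    have "1 \<le> D" using Delta_of_bounds(2)[OF True] tau_of_pos[OF True] by simp
    thus ?thesis by (subst Delta_of_bounds(1)[OF True]) simp
  qed (simp add: Delta_of_def)
  thus "?tau 1 = 0" "?beta 1 * ?p 1 = 4 * L"
    by (simp_all add: early_values)
qed (use L m R in auto)

end

end

section \<open>The algorithm as a primal-dual run\<close>

definition oracle_error where
  "oracle_error P a lo start w k = w k - grad_ft P (ipds_query P a lo start w k)"

text \<open>The right-hand side of the energy estimate for a dual test vector of norm at most
  \<open>\<parallel>z\<^sup>*\<parallel> + 1\<close>.\<close>

definition gap_bound where
  "gap_bound P a R lo start w =
     8 * Lt P * (norm (x0 P - xstar P))\<^sup>2 + Lt P / (8 * R\<^sup>2) * (norm (zstar P) + 1)\<^sup>2
     + (\<Sum>k=1..pN a. pbeta a k / real (pT a k) * (\<Sum>t=1..pT a k. ptol a k t))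
     + (\<Sum>k=1..pN a. pbeta a k *
          (oracle_error P a lo start w k \<bullet> (xstar P - st_x (ipds P a lo start w (k - 1)))))
     + (\<Sum>k=1..pN a. pbeta a k * (norm (oracle_error P a lo start w k))\<^sup>2 / (3 * pp a k))"

context
  fixes P :: "('m::finite, 'd::finite) problem" and a :: ipds_params and N R c tol
    and lo :: "real^'d^'m \<Rightarrow> real^'d^'m"
    and start :: "nat \<Rightarrow> nat \<Rightarrow> real^'d^'m \<Rightarrow> real^'d^'m \<Rightarrow> real^'d^'m"
  assumes P: "pds_problem P" and R: "R > 0" and tol: "\<And>k t. tol k t > 0"
    and a: "a = ipds_choice P N R c tol"
    and lo: "lin_oracle (feas P) lo" and start: "start_rule (feas P) start"
begin

lemma ipds_choice_simps:
  "pN a = N" "ptau a = (\<lambda>k. if enat k \<le> Delta_of (Lt P) (mu P) then (real k - 1) / 2 else tau_of (Lt P) (mu P))"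
  "plam a = (\<lambda>k. if enat k \<le> Delta_of (Lt P) (mu P) then (real k - 1) / real k else lam_of (Lt P) (mu P))"
  "pbeta a = beta_of (Lt P) (mu P)" "pp a = p_of (Lt P) (mu P)"
  "pT a = T_of (Lt P) (mu P) (onorm (Aop P)) R" "pc a = c_of (Lt P) (mu P) N c" "ptol a = tol"
  by (simp_all add: a ipds_choice_def Let_def)

lemma sliding_params_ipds:
  "sliding_params (Lt P) (mu P) R (onorm (Aop P)) (ptau a) (plam a) (pbeta a) (pp a) (pT a)"
  unfolding ipds_choice_simps
  by (intro ipds_parameters_admissible Lt_pos mu_nonneg onorm_Aop_pos P R)

interpretation sp: sliding_params "Lt P" "mu P" R "onorm (Aop P)" "ptau a" "plam a" "pbeta a" "pp a" "pT a"
  by (rule sliding_params_ipds)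

lemma ipds_choice_steps: "peta a k t = sp.eta k t" "pq a k t = sp.q k" "palpha a k t = sp.alpha k t"
  unfolding sp.eta_def sp.q_def sp.alpha_def by (simp_all add: a ipds_choice_def Let_def)

lemma sub_b_pos: "sub_b P (peta a (Suc k) (Suc t)) (pp a (Suc k)) > 0"
proof -
  have "pp a (Suc k) > 0" by (rule sp.p_pos) simp
  thus ?thesis using sp.m by (simp add: sub_b_def ipds_choice_steps sp.eta_def add_nonneg_pos)
qed

context
  fixes w :: "nat \<Rightarrow> real^'d^'m"
begin

private abbreviation "st \<equiv> ipds P a lo start w"
private abbreviation "run k \<equiv> inner_loop P a lo start k (st (k - 1)) (w k)"

lemma start_feas:
  assumes "x \<in> feas P" "y \<in> feas P" shows "start k t x y \<in> feas P"
  using start assms by (auto simp: start_rule_def)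

lemma iterates_feas:
  "st_x (st k) \<in> feas P" "fst (snd (run (Suc k) t)) \<in> feas P"
proof -
  have step: "fst (snd (inner_loop P a lo start (Suc k) s v t)) \<in> feas P" if "st_x s \<in> feas P" for k s v t
  proof (induction t)
    case 0 thus ?case using that by simp
  next
    case (Suc t)
    thus ?case using that
      by (auto simp: Let_def start_point_def case_prod_unfold
          intro!: cgs_output_mem[OF lo feas_convex compact_imp_bounded[OF feas_compact]] start_feas sub_b_pos P)
  qed
  show st: "st_x (st k) \<in> feas P" for k
  proof (induction k)
    case 0 thus ?case using P by (simp add: pds_problem_def)
  next
    case (Suc k) thus ?case using step by (simp add: outer_step_def Let_def)
  qed
  show "fst (snd (run (Suc k) t)) \<in> feas P" using step st by simp
qed

lemma average_feas: "k \<ge> 1 \<Longrightarrow> st_xhat (st k) \<in> feas P"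
proof (cases k)
  case (Suc j)
  have T: "real (pT a (Suc j)) > 0" using sp.T_pos[of "Suc j"] by simp
  have "(\<Sum>t=1..pT a (Suc j). (1 / real (pT a (Suc j))) *\<^sub>R fst (snd (run (Suc j) t))) \<in> feas P"
    using T iterates_feas(2)[of j] feas_convex[OF P] by (intro convex_sum) auto
  thus ?thesis by (simp add: Suc outer_step_def Let_def scaleR_sum_right)
qed simp

lemma output_feas:
  assumes N: "N \<ge> 1" shows "ipds_output P a lo start w \<in> feas P"
proof -
  define B where "B = (\<Sum>k=1..N. pbeta a k)"
  have B: "B > 0" unfolding B_def using N sp.beta_pos by (intro sum_pos) auto
  have "(\<Sum>k=1..N. pbeta a k / B) = 1"
    using B unfolding sum_divide_distrib[symmetric] B_def[symmetric] by simp
  hence "(\<Sum>k=1..N. (pbeta a k / B) *\<^sub>R st_xhat (st k)) \<in> feas P"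
    using B average_feas sp.beta_pos feas_convex[OF P]
    by (intro convex_sum) (auto simp: less_imp_le)
  thus ?thesis by (simp add: ipds_output_def ipds_choice_simps(1) B_def scaleR_sum_right)
qed

text \<open>The subproblem objective is exactly quadratic with curvature \<open>sub_b\<close>, so the CGS procedure gives
  the same guarantee for it from every starting point.\<close>

lemma subproblem_optimality:
  fixes k t :: nat
  assumes x: "x \<in> feas P"
  defines "z' \<equiv> snd (snd (run (Suc k) (Suc t)))" and "y \<equiv> fst (snd (run (Suc k) (Suc t)))"
    and "y0 \<equiv> fst (snd (run (Suc k) t))"
  shows "subobj P (peta a (Suc k) (Suc t)) (pp a (Suc k)) (w (Suc k) + Aop P z') y0 (st_x (st k)) y
     + sub_b P (peta a (Suc k) (Suc t)) (pp a (Suc k)) / 2 * (norm (x - y))\<^sup>2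
    \<le> subobj P (peta a (Suc k) (Suc t)) (pp a (Suc k)) (w (Suc k) + Aop P z') y0 (st_x (st k)) x
     + tol (Suc k) (Suc t)"
proof -
  define r where "r = run (Suc k) t"
  define g where "g = sub_data P a start (Suc k) (Suc t) (st k) (w (Suc k)) r"
  define b where "b = sub_b P (peta a (Suc k) (Suc t)) (pp a (Suc k))"
  define u where "u = start_point start (Suc k) (Suc t) (st k) r"
  have y0: "fst (snd r) \<in> feas P" unfolding r_def by (rule iterates_feas)
  have u: "u \<in> feas P" unfolding u_def start_point_def case_prod_unfold
    by (intro start_feas y0 iterates_feas)
  have z': "z' = dual_step P a (Suc k) (Suc t) r" by (simp add: z'_def r_def Let_def)
  have y: "y = cgs_output lo (tol (Suc k) (Suc t)) g b u"
    by (simp add: y_def Let_def g_def b_def u_def r_def ipds_choice_simps(8))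
  have g: "g = sub_g P (peta a (Suc k) (Suc t)) (pp a (Suc k)) (w (Suc k) + Aop P z') y0 (st_x (st k)) u"
    by (simp add: g_def sub_data_def u_def z' adjoint_Aop[OF P] y0_def r_def)
  have "g \<bullet> y + b / 2 * (norm (y - u))\<^sup>2 + b / 2 * (norm (x - y))\<^sup>2
       \<le> g \<bullet> x + b / 2 * (norm (x - u))\<^sup>2 + tol (Suc k) (Suc t)"
    unfolding y by (intro cgs_output_optimality[OF lo feas_convex compact_imp_bounded[OF feas_compact]] P u tol x)
      (simp add: b_def sub_b_pos)
  thus ?thesis
    using subobj_quadratic[OF prox_eq[OF P], of "peta a (Suc k) (Suc t)" "pp a (Suc k)" "w (Suc k) + Aop P z'" y0 "st_x (st k)" y u]
      subobj_quadratic[OF prox_eq[OF P], of "peta a (Suc k) (Suc t)" "pp a (Suc k)" "w (Suc k) + Aop P z'" y0 "st_x (st k)" x u]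
    unfolding g[symmetric] b_def[symmetric] by linarith
qed

lemma sliding_trace_ipds:
  "sliding_trace (Lt P) (mu P) R (onorm (Aop P)) (ptau a) (plam a) (pbeta a) (pp a) (pT a)
    (ft_sum P) (nu_sum P) (grad_ft P) (grad_nu P) (Aop P) (feas P)
    (\<lambda>k. st_x (st k)) (\<lambda>k. st_xlast (st k)) (\<lambda>k. st_z (st k)) (\<lambda>k. st_xhat (st k)) (\<lambda>k. st_xul (st k)) w
    (\<lambda>k t. fst (snd (run k t))) (\<lambda>k t. fst (run k t)) (\<lambda>k t. snd (snd (run k t))) tol"
proof (intro sliding_trace.intro sliding_trace_axioms.intro sliding_params_ipds, goal_cases)
  case (1 a b) show ?case by (rule ft_sum_bregman_lower[OF P])
next
  case (2 a b) show ?case by (rule nu_sum_tangent[OF P])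
next
  case (14 x k t)
  have n: "prox P u v = (norm (u - v))\<^sup>2" for u v by (rule prox_eq[OF P])
  have b: "sub_b P eta p / 2 = mu P + eta + p" for eta p by (simp add: sub_b_def)
  show ?case using subproblem_optimality[OF 14, of k t]
    unfolding subobj_def n ipds_choice_steps b norm_minus_commute[of x]
    by (simp del: inner_loop.simps)
next
  case (19 k)
  have "st_xprev (st k) = st_x (st (k - 1))" by (cases k) (simp_all add: outer_step_def Let_def)
  moreover have "1 + ptau a (Suc k) > 0" using sp.tau_nonneg[of "Suc k"] by simp
  ultimately show ?case by (simp add: outer_step_def Let_def query_point_def)
qed (auto simp: Aop_symmetric[OF P] norm_Aop_le[OF P] Aop_linear[OF P] outer_step_def Let_def
   dual_step_def case_prod_unfold ipds_choice_steps)

lemma lo_complexity_le: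
  "ereal_of_enat (lo_complexity P a lo start w) \<le>
    ereal (\<Sum>k=1..N. \<Sum>t=1..pT a k.
      4 * (sub_b P (peta a k t) (pp a k) * (diameter (feas P))\<^sup>2) / tol k t + 4)"
proof -
  define bound where "bound k t = 4 * (sub_b P (peta a k t) (pp a k) * (diameter (feas P))\<^sup>2) / tol k t + 4" for k t
  define calls where "calls k t = cgs_calls lo (ptol a k t) (sub_data P a start k t (st (k - 1)) (w k) (run k (t - 1)))
      (sub_b P (peta a k t) (pp a k)) (start_point start k t (st (k - 1)) (run k (t - 1)))" for k t
  have "\<exists>n. calls k t \<le> enat n \<and> real n \<le> bound k t" if k: "k \<in> {1..N}" and t: "t \<in> {1..pT a k}" for k t
  proof -
    obtain i j where ij: "k = Suc i" "t = Suc j" using k t by (cases k; cases t) auto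
    have u: "start_point start k t (st (k - 1)) (run k (t - 1)) \<in> feas P"
      unfolding ij start_point_def case_prod_unfold by (intro start_feas iterates_feas)
    have b: "sub_b P (peta a k t) (pp a k) > 0" unfolding ij by (rule sub_b_pos)
    show ?thesis unfolding calls_def bound_def ipds_choice_simps(8)
      using cgs_calls_bound[OF lo feas_convex[OF P] compact_imp_bounded[OF feas_compact[OF P]] u b tol] by metis
  qed
  then obtain n where n: "\<And>k t. k \<in> {1..N} \<Longrightarrow> t \<in> {1..pT a k} \<Longrightarrow> calls k t \<le> enat (n k t) \<and> real (n k t) \<le> bound k t"
    by metis
  have "lo_complexity P a lo start w = (\<Sum>k=1..N. \<Sum>t=1..pT a k. calls k t)"
    by (simp add: lo_complexity_def calls_def ipds_choice_simps(1) Let_def)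
  also have "\<dots> \<le> (\<Sum>k=1..N. \<Sum>t=1..pT a k. enat (n k t))"
    using n by (intro sum_mono) blast
  also have "\<dots> = enat (\<Sum>k=1..N. \<Sum>t=1..pT a k. n k t)"
    by (simp only: of_nat_eq_enat[symmetric] of_nat_sum)
  finally have "ereal_of_enat (lo_complexity P a lo start w)
      \<le> ereal_of_enat (enat (\<Sum>k=1..N. \<Sum>t=1..pT a k. n k t))"
    by (simp only: ereal_of_enat_le_iff)
  also have "\<dots> = ereal (\<Sum>k=1..N. \<Sum>t=1..pT a k. real (n k t))" by simp
  also have "\<dots> \<le> ereal (\<Sum>k=1..N. \<Sum>t=1..pT a k. bound k t)"
    using n by (simp only: ereal_less_eq) (intro sum_mono, blast)
  finally show ?thesis by (simp only: bound_def)
qed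

text \<open>Testing the gap estimate with the dual vector of norm \<open>\<parallel>z\<^sup>*\<parallel> + 1\<close> in the direction of the
  consensus error bounds an exact penalty function. The saddle point inequality shows that the
  objective cannot fall below the optimal value by more than \<open>\<parallel>z\<^sup>*\<parallel>\<close> times the consensus error,
  so that the penalty bounds both quantities separately.\<close>

lemma output_accuracy:
  assumes N: "N \<ge> 1"
  defines "xb \<equiv> ipds_output P a lo start w" and "B \<equiv> \<Sum>k=1..N. pbeta a k"
  shows "B * (obj P xb - obj P (xstar P)) \<le> gap_bound P a R lo start w" "B * norm (Aop P xb) \<le> gap_bound P a R lo start w"
proof -
  define z where "z = ((norm (zstar P) + 1) / norm (Aop P xb)) *\<^sub>R Aop P xb"
  have B: "B > 0" unfolding B_def using N sp.beta_pos by (intro sum_pos) auto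
  have q: "w k - grad_ft P (st_xul (st k)) = oracle_error P a lo start w k" if "k \<in> {1..N}" for k
    using that by (cases k) (simp_all add: oracle_error_def ipds_query_def outer_step_def Let_def)
  have zn: "norm z \<le> norm (zstar P) + 1" by (simp add: z_def)
  have zi: "Aop P xb \<bullet> z = (norm (zstar P) + 1) * norm (Aop P xb)"
    by (simp add: z_def power2_norm_eq_inner[symmetric] power2_eq_square)
  have xb: "(1 / B) *\<^sub>R (\<Sum>k=1..N. pbeta a k *\<^sub>R st_xhat (st k)) = xb"
    by (simp only: xb_def ipds_output_def ipds_choice_simps(1) B_def)
  have "B * (obj P xb - obj P (xstar P) + Aop P xb \<bullet> z)
     \<le> 8 * Lt P * (norm (x0 P - xstar P))\<^sup>2 + Lt P / (8 * R\<^sup>2) * (norm z)\<^sup>2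
     + (\<Sum>k=1..N. pbeta a k / real (pT a k) * (\<Sum>t=1..pT a k. tol k t))
     + (\<Sum>k=1..N. pbeta a k * (oracle_error P a lo start w k \<bullet> (xstar P - st_x (st (k - 1)))))
     + (\<Sum>k=1..N. pbeta a k * (norm (oracle_error P a lo start w k))\<^sup>2 / (3 * pp a k))"
    using sliding_trace.gap_estimate[OF sliding_trace_ipds xstar_feas[OF P] Aop_xstar[OF P] N, of z]
    unfolding B_def[symmetric] xb obj_eq[OF P, symmetric] by (simp add: q)
  also have "\<dots> \<le> gap_bound P a R lo start w"
    unfolding gap_bound_def ipds_choice_simps(1,8) using zn sp.L by (intro add_right_mono add_left_mono mult_left_mono power_mono) auto
  finally have main: "B * (obj P xb - obj P (xstar P) + (norm (zstar P) + 1) * norm (Aop P xb)) \<le> gap_bound P a R lo start w"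
    by (simp add: zi)
  have lower: "obj P xb - obj P (xstar P) \<ge> - (norm (zstar P) * norm (Aop P xb))"
    unfolding xb_def by (intro obj_ge_saddle[OF P] output_feas N)
  have "B * (obj P xb - obj P (xstar P)) \<le> B * (obj P xb - obj P (xstar P) + (norm (zstar P) + 1) * norm (Aop P xb))"
    using B by (intro mult_left_mono) auto
  with main show "B * (obj P xb - obj P (xstar P)) \<le> gap_bound P a R lo start w" by linarith
  have "B * norm (Aop P xb) \<le> B * (obj P xb - obj P (xstar P) + (norm (zstar P) + 1) * norm (Aop P xb))"
    using B lower by (intro mult_left_mono) (auto simp: algebra_simps)
  with main show "B * norm (Aop P xb) \<le> gap_bound P a R lo start w" by linarith
qed

end

end

section \<open>Random runs\<close>

definition state_measurable :: "'w measure \<Rightarrow> ('w \<Rightarrow> ('m::finite, 'd::finite) ipds_state) \<Rightarrow> bool" where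
  "state_measurable G s \<longleftrightarrow> (\<lambda>\<omega>. st_x (s \<omega>)) \<in> borel_measurable G \<and>
     (\<lambda>\<omega>. st_xprev (s \<omega>)) \<in> borel_measurable G \<and> (\<lambda>\<omega>. st_xlast (s \<omega>)) \<in> borel_measurable G \<and>
     (\<lambda>\<omega>. st_xhat (s \<omega>)) \<in> borel_measurable G \<and> (\<lambda>\<omega>. st_xul (s \<omega>)) \<in> borel_measurable G \<and>
     (\<lambda>\<omega>. st_z (s \<omega>)) \<in> borel_measurable G"

lemma cgs_iter_measurable:
  fixes lo :: "'a::euclidean_space \<Rightarrow> 'a"
  assumes [measurable]: "lo \<in> borel_measurable borel" "g \<in> borel_measurable M" "u \<in> borel_measurable M"
  shows "(\<lambda>\<omega>. cgs_iter lo (g \<omega>) b (u \<omega>) s) \<in> borel_measurable M"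
proof (induction s)
  case 0 show ?case by simp
next
  case (Suc s)
  note [measurable] = Suc
  show ?case unfolding cgs_iter.simps Let_def by measurable
qed

text \<open>The CGS procedure stops after a number of iterations that depends on its input, so its output
  is measurable as a countable family of measurable iterates evaluated at a measurable index.\<close>

lemma cgs_output_measurable:
  fixes lo :: "'a::euclidean_space \<Rightarrow> 'a"
  assumes [measurable]: "lo \<in> borel_measurable borel" "g \<in> borel_measurable M" "u \<in> borel_measurable M"
  shows "(\<lambda>\<omega>. cgs_output lo e (g \<omega>) b (u \<omega>)) \<in> borel_measurable M"
proof -
  have [measurable]: "(\<lambda>\<omega>. cgs_iter lo (g \<omega>) b (u \<omega>) s) \<in> borel_measurable M" for s
    by (rule cgs_iter_measurable) measurable
  have "(\<lambda>\<omega>. LEAST s. wolfe_gap lo (g \<omega>) b (u \<omega>) (cgs_iter lo (g \<omega>) b (u \<omega>) s) \<le> e)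
      \<in> measurable M (count_space UNIV)"
    unfolding wolfe_gap_def by measurable
  thus ?thesis unfolding cgs_output_def
    by (rule measurable_compose_countable[rotated]) measurable
qed

context
  fixes P :: "('m::finite, 'd::finite) problem" and a :: ipds_params
    and lo :: "real^'d^'m \<Rightarrow> real^'d^'m"
    and start :: "nat \<Rightarrow> nat \<Rightarrow> real^'d^'m \<Rightarrow> real^'d^'m \<Rightarrow> real^'d^'m"
    and G :: "'w measure" and v :: "nat \<Rightarrow> 'w \<Rightarrow> real^'d^'m"
  assumes P: "pds_problem P" and lo: "lin_oracle (feas P) lo" and start: "start_rule (feas P) start"
begin

private abbreviation "state k \<omega> \<equiv> ipds P a lo start (\<lambda>l. v l \<omega>) k"

lemma Aop_measurable [measurable]: "Aop P \<in> borel_measurable borel"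
  by (intro borel_measurable_continuous_onI linear_continuous_on)
     (simp add: linear_conv_bounded_linear[symmetric] Aop_linear[OF P])

lemma grad_nu_measurable [measurable]: "grad_nu P \<in> borel_measurable borel"
proof -
  have "grad_nu P = (\<lambda>u. grad_nu P 0 + 2 *\<^sub>R u)" using grad_nu_affine[OF P] by blast
  moreover have "(\<lambda>u. grad_nu P 0 + 2 *\<^sub>R u) \<in> borel_measurable borel" by measurable
  ultimately show ?thesis by simp
qed

lemma grad_ft_measurable [measurable]: "grad_ft P \<in> borel_measurable borel"
  by (intro borel_measurable_continuous_onI continuous_grad_ft P)

lemma lo_measurable [measurable]: "lo \<in> borel_measurable borel"
  using lo by (simp add: lin_oracle_def)

lemma start_measurable [measurable]:
  assumes [measurable]: "x \<in> borel_measurable G" "y \<in> borel_measurable G"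
  shows "(\<lambda>\<omega>. start k t (x \<omega>) (y \<omega>)) \<in> borel_measurable G"
proof -
  have "(\<lambda>(x, y). start k t x y) \<in> borel_measurable borel"
    using start by (simp add: start_rule_def)
  moreover have "(\<lambda>\<omega>. (x \<omega>, y \<omega>)) \<in> borel_measurable G" by measurable
  ultimately have "(\<lambda>\<omega>. (\<lambda>(x, y). start k t x y) (x \<omega>, y \<omega>)) \<in> borel_measurable G"
    by (rule measurable_compose[rotated])
  thus ?thesis by simp
qed

lemma inner_loop_measurable:
  assumes s: "state_measurable G s" and w [measurable]: "w \<in> borel_measurable G"
  shows "(\<lambda>\<omega>. fst (inner_loop P a lo start k (s \<omega>) (w \<omega>) t)) \<in> borel_measurable G \<and>
    (\<lambda>\<omega>. fst (snd (inner_loop P a lo start k (s \<omega>) (w \<omega>) t))) \<in> borel_measurable G \<and>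
    (\<lambda>\<omega>. snd (snd (inner_loop P a lo start k (s \<omega>) (w \<omega>) t))) \<in> borel_measurable G"
proof (induction t)
  case 0
  thus ?case using s by (simp add: state_measurable_def)
next
  case (Suc t)
  have [measurable]: "(\<lambda>\<omega>. st_x (s \<omega>)) \<in> borel_measurable G" using s by (simp add: state_measurable_def)
  have [measurable]: "(\<lambda>\<omega>. fst (inner_loop P a lo start k (s \<omega>) (w \<omega>) t)) \<in> borel_measurable G"
    "(\<lambda>\<omega>. fst (snd (inner_loop P a lo start k (s \<omega>) (w \<omega>) t))) \<in> borel_measurable G"
    "(\<lambda>\<omega>. snd (snd (inner_loop P a lo start k (s \<omega>) (w \<omega>) t))) \<in> borel_measurable G"
    using Suc by auto
  have dual [measurable]: "(\<lambda>\<omega>. dual_step P a k (Suc t) (inner_loop P a lo start k (s \<omega>) (w \<omega>) t)) \<in> borel_measurable G"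
    unfolding dual_step_def case_prod_unfold by measurable
  have u [measurable]: "(\<lambda>\<omega>. start_point start k (Suc t) (s \<omega>) (inner_loop P a lo start k (s \<omega>) (w \<omega>) t)) \<in> borel_measurable G"
    unfolding start_point_def case_prod_unfold by measurable
  have g [measurable]: "(\<lambda>\<omega>. sub_data P a start k (Suc t) (s \<omega>) (w \<omega>) (inner_loop P a lo start k (s \<omega>) (w \<omega>) t)) \<in> borel_measurable G"
    unfolding sub_data_def sub_g_def adjoint_Aop[OF P] by measurable
  show ?case using dual Suc cgs_output_measurable[OF lo_measurable g u]
    by (simp add: Let_def)
qed

lemma state_measurable_ipds:
  assumes "\<And>l. l \<in> {1..k} \<Longrightarrow> v l \<in> borel_measurable G"
  shows "state_measurable G (state k)"
  using assms
proof (induction k)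
  case 0
  show ?case by (simp add: state_measurable_def)
next
  case (Suc k)
  have s: "state_measurable G (state k)" using Suc by simp
  have v: "v (Suc k) \<in> borel_measurable G" using Suc.prems by simp
  note r = inner_loop_measurable[OF s v, of "Suc k"]
  note [measurable] = r[THEN conjunct1] r[THEN conjunct2, THEN conjunct1] r[THEN conjunct2, THEN conjunct2]
  have [measurable]: "(\<lambda>\<omega>. st_x (state k \<omega>)) \<in> borel_measurable G"
    "(\<lambda>\<omega>. st_xprev (state k \<omega>)) \<in> borel_measurable G" "(\<lambda>\<omega>. st_xhat (state k \<omega>)) \<in> borel_measurable G"
    "(\<lambda>\<omega>. st_xul (state k \<omega>)) \<in> borel_measurable G"
    using s by (simp_all add: state_measurable_def)
  have xhat: "(\<lambda>\<omega>. (1 / real (pT a (Suc k))) *\<^sub>R (\<Sum>t=1..pT a (Suc k).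
      fst (snd (inner_loop P a lo start (Suc k) (state k \<omega>) (v (Suc k) \<omega>) t)))) \<in> borel_measurable G"
    using r by (intro borel_measurable_scaleR borel_measurable_sum) auto
  have xul: "(\<lambda>\<omega>. query_point a (Suc k) (state k \<omega>)) \<in> borel_measurable G"
    unfolding query_point_def by measurable
  show ?case using r xhat xul s
    by (simp add: state_measurable_def outer_step_def Let_def)
qed

lemma ipds_query_measurable:
  assumes "\<And>l. l \<in> {1..k - 1} \<Longrightarrow> v l \<in> borel_measurable G"
  shows "(\<lambda>\<omega>. ipds_query P a lo start (\<lambda>l. v l \<omega>) k) \<in> borel_measurable G"
proof -
  have s: "state_measurable G (state (k - 1))" using assms by (rule state_measurable_ipds)
  have [measurable]: "(\<lambda>\<omega>. st_x (state (k - 1) \<omega>)) \<in> borel_measurable G"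
    "(\<lambda>\<omega>. st_xprev (state (k - 1) \<omega>)) \<in> borel_measurable G" "(\<lambda>\<omega>. st_xhat (state (k - 1) \<omega>)) \<in> borel_measurable G"
    "(\<lambda>\<omega>. st_xul (state (k - 1) \<omega>)) \<in> borel_measurable G"
    using s by (simp_all add: state_measurable_def)
  show ?thesis unfolding ipds_query_def query_point_def by measurable
qed

lemma ipds_output_measurable:
  assumes "\<And>l. l \<in> {1..pN a} \<Longrightarrow> v l \<in> borel_measurable G"
  shows "(\<lambda>\<omega>. ipds_output P a lo start (\<lambda>l. v l \<omega>)) \<in> borel_measurable G"
proof -
  have "(\<lambda>\<omega>. st_xhat (state k \<omega>)) \<in> borel_measurable G" if "k \<in> {1..pN a}" for k
  proof -
    have "state_measurable G (state k)" using that assms by (intro state_measurable_ipds) auto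
    thus ?thesis by (simp add: state_measurable_def)
  qed
  thus ?thesis unfolding ipds_output_def
    by (intro borel_measurable_scaleR borel_measurable_sum) auto
qed

end

context
  fixes P :: "('m::finite, 'd::finite) problem" and a :: ipds_params and N R c tol
    and lo :: "real^'d^'m \<Rightarrow> real^'d^'m"
    and start :: "nat \<Rightarrow> nat \<Rightarrow> real^'d^'m \<Rightarrow> real^'d^'m \<Rightarrow> real^'d^'m"
    and M :: "'w measure" and F :: "nat \<Rightarrow> 'w measure" and v :: "nat \<Rightarrow> 'w \<Rightarrow> real^'d^'m"
  assumes P: "pds_problem P" and R: "R > 0" and tol: "\<And>k t. tol k t > 0"
    and a: "a = ipds_choice P N R c tol"
    and lo: "lin_oracle (feas P) lo" and start: "start_rule (feas P) start"
    and run: "oracle_run P a lo start M F v"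
begin

private abbreviation "rstate k \<omega> \<equiv> ipds P a lo start (\<lambda>l. v l \<omega>) k"
private abbreviation "query k \<omega> \<equiv> ipds_query P a lo start (\<lambda>l. v l \<omega>) k"
private abbreviation "err k \<omega> \<equiv> oracle_error P a lo start (\<lambda>l. v l \<omega>) k"

interpretation M: prob_space M using run by (simp add: oracle_run_def)

lemma subalg: "subalgebra M (F k)" using run by (simp add: oracle_run_def)

lemma sigma_finite_subalg: "sigma_finite_subalgebra M (F k)"
proof -
  interpret finite_measure_subalgebra M "F k"
    by unfold_locales (rule subalg)
  show ?thesis by unfold_locales
qed

lemma pN_eq: "pN a = N" by (simp add: a ipds_choice_def Let_def)

lemma v_measurable_F: "l \<in> {1..N} \<Longrightarrow> l \<le> k \<Longrightarrow> v l \<in> borel_measurable (F k)"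
proof -
  assume l: "l \<in> {1..N}" "l \<le> k"
  have f: "filtration (space M) F" using run by (simp add: oracle_run_def)
  have "v l \<in> borel_measurable (F l)" using run l by (simp add: oracle_run_def pN_eq)
  moreover have "subalgebra (F k) (F l)"
    using filtration.sets_F_mono[OF f l(2)] filtration.space_F[OF f] by (simp add: subalgebra_def)
  ultimately show ?thesis using measurable_from_subalg by blast
qed

lemma v_measurable: "l \<in> {1..N} \<Longrightarrow> v l \<in> borel_measurable M"
  using measurable_from_subalg[OF subalg v_measurable_F] by blast

lemma past_measurable:
  assumes k: "k \<in> {1..N}"
  shows "(\<lambda>\<omega>. st_x (rstate (k - 1) \<omega>)) \<in> borel_measurable (F (k - 1))"
    and "query k \<in> borel_measurable (F (k - 1))"
proof -
  have v: "v l \<in> borel_measurable (F (k - 1))" if "l \<in> {1..k - 1}" for l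
    using that k by (intro v_measurable_F) auto
  show "(\<lambda>\<omega>. st_x (rstate (k - 1) \<omega>)) \<in> borel_measurable (F (k - 1))"
    using state_measurable_ipds[OF P lo start v, of "k - 1"] by (simp add: state_measurable_def)
  show "query k \<in> borel_measurable (F (k - 1))"
    by (rule ipds_query_measurable[OF P lo start v])
qed

text \<open>The previous iterate is known before the samples are drawn and stays in a bounded set, so the
  linear noise term has mean zero.\<close>

lemma linear_noise:
  assumes k: "k \<in> {1..N}"
  shows "integrable M (\<lambda>\<omega>. err k \<omega> \<bullet> (xstar P - st_x (rstate (k - 1) \<omega>)))"
    and "(\<integral>\<omega>. err k \<omega> \<bullet> (xstar P - st_x (rstate (k - 1) \<omega>)) \<partial>M) = 0"
proof -
  interpret Fk: sigma_finite_subalgebra M "F (k - 1)" by (rule sigma_finite_subalg)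
  define h where "h \<omega> = xstar P - st_x (rstate (k - 1) \<omega>)" for \<omega>
  define gq where "gq \<omega> = grad_ft P (query k \<omega>)" for \<omega>
  have hF: "h \<in> borel_measurable (F (k - 1))"
    unfolding h_def using past_measurable(1)[OF k] by simp
  have hM: "h \<in> borel_measurable M" using measurable_from_subalg[OF subalg hF] .
  have gF: "gq \<in> borel_measurable (F (k - 1))"
    unfolding gq_def by (rule measurable_compose[OF past_measurable(2)[OF k] grad_ft_measurable[OF P lo start]])
  have gM: "gq \<in> borel_measurable M" using measurable_from_subalg[OF subalg gF] .
  obtain K where K: "\<And>x. x \<in> feas P \<Longrightarrow> norm x \<le> K"
    using compact_imp_bounded[OF feas_compact[OF P]] by (auto simp: bounded_iff)
  have hb: "norm (h \<omega>) \<le> 2 * K" for \<omega>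
    using norm_triangle_ineq4[of "xstar P" "st_x (rstate (k - 1) \<omega>)"] K[OF xstar_feas[OF P]]
      K[OF iterates_feas(1)[OF P R tol a lo start, of "\<lambda>l. v l \<omega>" "k - 1"]]
    by (simp add: h_def)
  have comp: "integrable M (\<lambda>\<omega>. err k \<omega> $ i $ j * h \<omega> $ i $ j) \<and>
      (\<integral>\<omega>. err k \<omega> $ i $ j * h \<omega> $ i $ j \<partial>M) = 0" for i j
  proof -
    define V where "V \<omega> = v k \<omega> $ i $ j" for \<omega>
    define H where "H \<omega> = h \<omega> $ i $ j" for \<omega>
    define Q where "Q \<omega> = gq \<omega> $ i $ j" for \<omega>
    have V: "integrable M V" and ce: "AE \<omega> in M. real_cond_exp M (F (k - 1)) V \<omega> = Q \<omega>"
      using run k by (auto simp: oracle_run_def pN_eq V_def[abs_def] Q_def gq_def)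
    have Hb: "norm (H \<omega>) \<le> 2 * K" for \<omega>
      using hb[of \<omega>] Finite_Cartesian_Product.norm_nth_le[of "h \<omega>" i] component_le_norm_cart[of "h \<omega> $ i" j]
      by (simp add: H_def)
    have HF: "H \<in> borel_measurable (F (k - 1))"
    proof -
      have "(\<lambda>x::real^'d^'m. x $ i $ j) \<in> borel_measurable borel"
        by (intro borel_measurable_continuous_onI continuous_intros)
      from measurable_compose[OF hF this] show ?thesis by (simp add: H_def[abs_def])
    qed
    have HM: "H \<in> borel_measurable M" using measurable_from_subalg[OF subalg HF] .
    have QM: "Q \<in> borel_measurable M"
    proof -
      have "(\<lambda>x::real^'d^'m. x $ i $ j) \<in> borel_measurable borel"
        by (intro borel_measurable_continuous_onI continuous_intros)
      from measurable_compose[OF gM this] show ?thesis by (simp add: Q_def[abs_def])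
    qed
    have K0: "0 \<le> K" using order_trans[OF norm_ge_zero hb[of undefined]] by simp
    have HV: "integrable M (\<lambda>\<omega>. H \<omega> * V \<omega>)"
    proof (rule Bochner_Integration.integrable_bound)
      show "integrable M (\<lambda>\<omega>. 2 * K * V \<omega>)" using V by simp
      show "(\<lambda>\<omega>. H \<omega> * V \<omega>) \<in> borel_measurable M" using HM V by measurable
      show "AE \<omega> in M. norm (H \<omega> * V \<omega>) \<le> norm (2 * K * V \<omega>)"
        using Hb K0 by (intro AE_I2) (auto simp: abs_mult intro!: mult_right_mono)
    qed
    have HC: "integrable M (\<lambda>\<omega>. H \<omega> * real_cond_exp M (F (k - 1)) V \<omega>)"
      "(\<integral>\<omega>. H \<omega> * real_cond_exp M (F (k - 1)) V \<omega> \<partial>M) = (\<integral>\<omega>. H \<omega> * V \<omega> \<partial>M)"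
      using Fk.real_cond_exp_intg[OF HV HF] V by auto
    have ae: "AE \<omega> in M. H \<omega> * real_cond_exp M (F (k - 1)) V \<omega> = H \<omega> * Q \<omega>"
      using ce by eventually_elim simp
    have HQM: "(\<lambda>\<omega>. H \<omega> * Q \<omega>) \<in> borel_measurable M" using HM QM by measurable
    have "integrable M (\<lambda>\<omega>. H \<omega> * Q \<omega>)" 
      by (rule integrable_cong_AE_imp[OF HC(1) HQM]) (use ae in \<open>eventually_elim, simp\<close>)
    moreover have "(\<integral>\<omega>. H \<omega> * Q \<omega> \<partial>M) = (\<integral>\<omega>. H \<omega> * V \<omega> \<partial>M)"
      using integral_cong_AE[OF borel_measurable_integrable[OF HC(1)] HQM ae] HC(2) by simp
    ultimately have HQ: "integrable M (\<lambda>\<omega>. H \<omega> * Q \<omega>)" "(\<integral>\<omega>. H \<omega> * Q \<omega> \<partial>M) = (\<integral>\<omega>. H \<omega> * V \<omega> \<partial>M)"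
      by blast+
    have "(\<lambda>\<omega>. err k \<omega> $ i $ j * h \<omega> $ i $ j) = (\<lambda>\<omega>. H \<omega> * V \<omega> - H \<omega> * Q \<omega>)"
      by (simp add: fun_eq_iff oracle_error_def H_def V_def Q_def gq_def algebra_simps)
    thus ?thesis using HV HQ by simp
  qed
  have "err k \<omega> \<bullet> (xstar P - st_x (rstate (k - 1) \<omega>)) = (\<Sum>i\<in>UNIV. \<Sum>j\<in>UNIV. err k \<omega> $ i $ j * h \<omega> $ i $ j)" for \<omega>
    by (simp add: inner_vec_def h_def)
  thus "integrable M (\<lambda>\<omega>. err k \<omega> \<bullet> (xstar P - st_x (rstate (k - 1) \<omega>)))"
    and "(\<integral>\<omega>. err k \<omega> \<bullet> (xstar P - st_x (rstate (k - 1) \<omega>)) \<partial>M) = 0"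
    using comp by (simp_all add: Bochner_Integration.integral_sum)
qed

lemma quadratic_noise:
  assumes k: "k \<in> {1..N}"
  shows "integrable M (\<lambda>\<omega>. (norm (err k \<omega>))\<^sup>2)"
    and "(\<integral>\<omega>. (norm (err k \<omega>))\<^sup>2 \<partial>M) \<le> real CARD('m) * ((noise P)\<^sup>2 / real (pc a k))"
proof -
  interpret Fk: sigma_finite_subalgebra M "F (k - 1)" by (rule sigma_finite_subalg)
  define s where "s = (noise P)\<^sup>2 / real (pc a k)"
  have s: "s \<ge> 0" by (simp add: s_def)
  have qM: "(\<lambda>\<omega>. grad_ft P (query k \<omega>)) \<in> borel_measurable M"
    using measurable_compose[OF measurable_from_subalg[OF subalg past_measurable(2)[OF k]] grad_ft_measurable[OF P lo start]] .
  have eM: "err k \<in> borel_measurable M"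
    unfolding oracle_error_def by (rule borel_measurable_diff[OF v_measurable[OF k] qM])
  have nM: "(\<lambda>\<omega>. (norm (err k \<omega> $ i))\<^sup>2) \<in> borel_measurable M" for i
  proof -
    have "(\<lambda>x::real^'d^'m. (norm (x $ i))\<^sup>2) \<in> borel_measurable borel"
      by (intro borel_measurable_continuous_onI continuous_intros)
    from measurable_compose[OF eM this] show ?thesis .
  qed
  have comp: "integrable M (\<lambda>\<omega>. (norm (err k \<omega> $ i))\<^sup>2) \<and> (\<integral>\<omega>. (norm (err k \<omega> $ i))\<^sup>2 \<partial>M) \<le> s" for i
  proof -
    define f where "f \<omega> = ennreal ((norm (err k \<omega> $ i))\<^sup>2)" for \<omega>
    have f: "f \<in> borel_measurable M" unfolding f_def using nM by measurable
    have "(\<integral>\<^sup>+ \<omega>. f \<omega> \<partial>M) = (\<integral>\<^sup>+ \<omega>. 1 * nn_cond_exp M (F (k - 1)) f \<omega> \<partial>M)"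
      using Fk.nn_cond_exp_intg[OF _ f, of "\<lambda>_. 1"] by simp
    also have "\<dots> \<le> (\<integral>\<^sup>+ \<omega>. ennreal s \<partial>M)"
    proof (rule nn_integral_mono_AE)
      have "AE \<omega> in M. nn_cond_exp M (F (k - 1)) f \<omega> \<le> ennreal s"
        using run k by (auto simp: oracle_run_def pN_eq f_def[abs_def] oracle_error_def s_def)
      thus "AE \<omega> in M. 1 * nn_cond_exp M (F (k - 1)) f \<omega> \<le> ennreal s" by simp
    qed
    also have "\<dots> = ennreal s" by (simp add: M.emeasure_space_1)
    finally have le: "(\<integral>\<^sup>+ \<omega>. ennreal ((norm (err k \<omega> $ i))\<^sup>2) \<partial>M) \<le> ennreal s" by (simp add: f_def)
    have int: "integrable M (\<lambda>\<omega>. (norm (err k \<omega> $ i))\<^sup>2)"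
      using nM le by (intro integrableI_nonneg) (auto intro: le_less_trans)
    have "ennreal (\<integral>\<omega>. (norm (err k \<omega> $ i))\<^sup>2 \<partial>M) \<le> ennreal s"
      using le nn_integral_eq_integral[OF int] by simp
    thus ?thesis using int s by simp
  qed
  have n: "(norm (err k \<omega>))\<^sup>2 = (\<Sum>i\<in>UNIV. (norm (err k \<omega> $ i))\<^sup>2)" for \<omega>
    by (simp add: power2_norm_eq_inner inner_vec_def[where ?'b="'m" and ?'a="real^'d"])
  show "integrable M (\<lambda>\<omega>. (norm (err k \<omega>))\<^sup>2)" unfolding n using comp by simp
  have "(\<integral>\<omega>. (norm (err k \<omega>))\<^sup>2 \<partial>M) = (\<Sum>i\<in>UNIV. \<integral>\<omega>. (norm (err k \<omega> $ i))\<^sup>2 \<partial>M)"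
    unfolding n using comp by (simp add: Bochner_Integration.integral_sum)
  also have "\<dots> \<le> (\<Sum>i\<in>(UNIV :: 'm set). s)" using comp by (intro sum_mono) auto
  finally show "(\<integral>\<omega>. (norm (err k \<omega>))\<^sup>2 \<partial>M) \<le> real CARD('m) * ((noise P)\<^sup>2 / real (pc a k))"
    by (simp add: s_def)
qed

text \<open>Without noise the pathwise bound is deterministic. With noise its expectation is taken after the
  dual test vector, which depends on the random output, has already been eliminated; only the two
  noise terms are random, and the first has mean zero.\<close>

lemma eps_solution_ipds:
  assumes N: "N \<ge> 1"
    and eps: "8 * Lt P * (norm (x0 P - xstar P))\<^sup>2 + Lt P / (8 * R\<^sup>2) * (norm (zstar P) + 1)\<^sup>2
     + (\<Sum>k=1..N. pbeta a k / real (pT a k) * (\<Sum>t=1..pT a k. tol k t))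
     + (\<Sum>k=1..N. pbeta a k * (real CARD('m) * ((noise P)\<^sup>2 / real (pc a k))) / (3 * pp a k))
     \<le> (\<Sum>k=1..N. pbeta a k) * \<epsilon>"
  shows "eps_solution P M \<epsilon> (\<lambda>\<omega>. ipds_output P a lo start (\<lambda>k. v k \<omega>))"
proof -
  interpret sp: sliding_params "Lt P" "mu P" R "onorm (Aop P)" "ptau a" "plam a" "pbeta a" "pp a" "pT a"
    by (rule sliding_params_ipds[OF P R tol a lo start])
  define xb where "xb \<omega> = ipds_output P a lo start (\<lambda>k. v k \<omega>)" for \<omega>
  define B where "B = (\<Sum>k=1..N. pbeta a k)"
  have B: "B > 0" unfolding B_def using N sp.beta_pos by (intro sum_pos) auto
  define S where "S = 8 * Lt P * (norm (x0 P - xstar P))\<^sup>2 + Lt P / (8 * R\<^sup>2) * (norm (zstar P) + 1)\<^sup>2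
     + (\<Sum>k=1..N. pbeta a k / real (pT a k) * (\<Sum>t=1..pT a k. tol k t))"
  define gb where "gb \<omega> = gap_bound P a R lo start (\<lambda>k. v k \<omega>)" for \<omega>
  have gb: "gb \<omega> = S + (\<Sum>k=1..N. pbeta a k * (err k \<omega> \<bullet> (xstar P - st_x (rstate (k - 1) \<omega>))))
     + (\<Sum>k=1..N. pbeta a k * (norm (err k \<omega>))\<^sup>2 / (3 * pp a k))" for \<omega>
    by (simp add: gb_def gap_bound_def S_def ipds_choice_simps(1,8)[OF P R tol a lo start])
  have acc: "B * (obj P (xb \<omega>) - obj P (xstar P)) \<le> gb \<omega>" "B * norm (Aop P (xb \<omega>)) \<le> gb \<omega>" for \<omega>
    unfolding B_def xb_def gb_def by (rule output_accuracy[OF P R tol a lo start N])+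
  show ?thesis
  proof (cases "noise P = 0")
    case True
    have "gb \<omega> \<le> B * \<epsilon>" if "\<omega> \<in> space M" for \<omega>
    proof -
      have "err k \<omega> = 0" if "k \<in> {1..N}" for k
        using run True that \<open>\<omega> \<in> space M\<close> by (simp add: oracle_run_def pN_eq oracle_error_def)
      hence "gb \<omega> = S" by (simp add: gb)
      thus ?thesis using eps True by (simp add: S_def B_def)
    qed
    hence "B * (obj P (xb \<omega>) - obj P (xstar P)) \<le> B * \<epsilon>" "B * norm (Aop P (xb \<omega>)) \<le> B * \<epsilon>"
      if "\<omega> \<in> space M" for \<omega> using that acc order_trans by blast+
    thus ?thesis using True B by (simp add: eps_solution_def xb_def[symmetric])
  next
    case False
    have xbM: "xb \<in> borel_measurable M"
      unfolding xb_def using v_measurable by (intro ipds_output_measurable[OF P lo start]) (simp add: pN_eq)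
    have xbX: "xb \<omega> \<in> feas P" for \<omega>
      unfolding xb_def by (rule output_feas[OF P R tol a lo start N])
    have bounded_int: "integrable M (\<lambda>\<omega>. h (xb \<omega>))" if c: "continuous_on UNIV h" for h :: "real^'d^'m \<Rightarrow> real"
    proof -
      have "compact (h ` feas P)"
        using compact_continuous_image[OF continuous_on_subset[OF c] feas_compact[OF P]] by simp
      then obtain K where K: "\<And>x. x \<in> feas P \<Longrightarrow> norm (h x) \<le> K"
        using compact_imp_bounded[of "h ` feas P"] by (auto simp: bounded_iff)
      have "(\<lambda>\<omega>. h (xb \<omega>)) \<in> borel_measurable M"
        using measurable_compose[OF xbM borel_measurable_continuous_onI[OF c]] .
      thus ?thesis using K xbX by (intro M.integrable_const_bound[of _ K]) auto
    qed
    have o: "integrable M (\<lambda>\<omega>. obj P (xb \<omega>) - obj P (xstar P))"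
      by (intro bounded_int[of "\<lambda>x. obj P x - obj P (xstar P)"] continuous_intros continuous_obj P)
    have A: "integrable M (\<lambda>\<omega>. norm (Aop P (xb \<omega>)))"
      by (intro bounded_int[of "\<lambda>x. norm (Aop P x)"] continuous_intros linear_continuous_on)
         (simp add: linear_conv_bounded_linear[symmetric] Aop_linear[OF P])
    have gi: "integrable M gb" unfolding gb[abs_def]
      using linear_noise(1) quadratic_noise(1)
      by (intro Bochner_Integration.integrable_add Bochner_Integration.integrable_sum) auto
    define f1 where "f1 \<omega> = (\<Sum>k=1..N. pbeta a k * (err k \<omega> \<bullet> (xstar P - st_x (rstate (k - 1) \<omega>))))" for \<omega>
    define f2 where "f2 \<omega> = (\<Sum>k=1..N. pbeta a k * (norm (err k \<omega>))\<^sup>2 / (3 * pp a k))" for \<omega>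
    have f1: "integrable M f1"
        "(\<integral>\<omega>. f1 \<omega> \<partial>M) = (\<Sum>k=1..N. pbeta a k * (\<integral>\<omega>. err k \<omega> \<bullet> (xstar P - st_x (rstate (k - 1) \<omega>)) \<partial>M))"
      unfolding f1_def[abs_def] using linear_noise(1)
      by (auto intro!: Bochner_Integration.integrable_sum simp: Bochner_Integration.integral_sum)
    have f2: "integrable M f2"
        "(\<integral>\<omega>. f2 \<omega> \<partial>M) = (\<Sum>k=1..N. pbeta a k * (\<integral>\<omega>. (norm (err k \<omega>))\<^sup>2 \<partial>M) / (3 * pp a k))"
      unfolding f2_def[abs_def] using quadratic_noise(1)
      by (auto intro!: Bochner_Integration.integrable_sum simp: Bochner_Integration.integral_sum)
    have gbf: "gb \<omega> = S + f1 \<omega> + f2 \<omega>" for \<omega> by (simp add: gb f1_def f2_def)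
    have "(\<integral>\<omega>. gb \<omega> \<partial>M) = S + (\<integral>\<omega>. f1 \<omega> \<partial>M) + (\<integral>\<omega>. f2 \<omega> \<partial>M)"
      unfolding gbf using f1(1) f2(1) by (simp add: M.prob_space)
    also have "\<dots> = S + (\<Sum>k=1..N. pbeta a k * (\<integral>\<omega>. (norm (err k \<omega>))\<^sup>2 \<partial>M) / (3 * pp a k))"
      unfolding f1(2) f2(2) using linear_noise(2) by simp
    also have "\<dots> \<le> S + (\<Sum>k=1..N. pbeta a k * (real CARD('m) * ((noise P)\<^sup>2 / real (pc a k))) / (3 * pp a k))"
      using quadratic_noise(2) sp.beta_pos sp.p_pos
      by (intro add_left_mono sum_mono divide_right_mono mult_left_mono) (auto simp: less_imp_le)
    also have "\<dots> \<le> B * \<epsilon>" using eps by (simp add: S_def B_def)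
    finally have fin: "(\<integral>\<omega>. gb \<omega> \<partial>M) \<le> B * \<epsilon>" .
    have "B * (\<integral>\<omega>. obj P (xb \<omega>) - obj P (xstar P) \<partial>M) = (\<integral>\<omega>. B * (obj P (xb \<omega>) - obj P (xstar P)) \<partial>M)"
      using o by simp
    also have "\<dots> \<le> (\<integral>\<omega>. gb \<omega> \<partial>M)" by (intro integral_mono integrable_mult_right o gi acc)
    finally have 1: "B * (\<integral>\<omega>. obj P (xb \<omega>) - obj P (xstar P) \<partial>M) \<le> B * \<epsilon>" using fin by linarith
    have "B * (\<integral>\<omega>. norm (Aop P (xb \<omega>)) \<partial>M) = (\<integral>\<omega>. B * norm (Aop P (xb \<omega>)) \<partial>M)"
      using A by simp
    also have "\<dots> \<le> (\<integral>\<omega>. gb \<omega> \<partial>M)" by (intro integral_mono integrable_mult_right A gi acc)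
    finally have 2: "B * (\<integral>\<omega>. norm (Aop P (xb \<omega>)) \<partial>M) \<le> B * \<epsilon>" using fin by linarith
    from 1 2 show ?thesis using False o A B by (simp add: eps_solution_def xb_def[symmetric])
  qed
qed

end

lemma ipds_solvesI:
  fixes P :: "('m::finite, 'd::finite) problem" and N :: nat and R c :: real and tol
  assumes P: "pds_problem P" and R: "R > 0" and tol: "\<And>k t. tol k t > 0" and N: "N \<ge> 1"
  defines "a \<equiv> ipds_choice P N R c tol"
  assumes eps: "8 * Lt P * (norm (x0 P - xstar P))\<^sup>2 + Lt P / (8 * R\<^sup>2) * (norm (zstar P) + 1)\<^sup>2
     + (\<Sum>k=1..N. pbeta a k / real (pT a k) * (\<Sum>t=1..pT a k. tol k t))
     + (\<Sum>k=1..N. pbeta a k * (real CARD('m) * ((noise P)\<^sup>2 / real (pc a k))) / (3 * pp a k))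
     \<le> (\<Sum>k=1..N. pbeta a k) * \<epsilon>"
    and calls: "(\<Sum>k=1..N. \<Sum>t=1..pT a k.
      4 * (sub_b P (peta a k t) (pp a k) * (diameter (feas P))\<^sup>2) / tol k t + 4) \<le> B"
  shows "ipds_solves P W a \<epsilon> B"
  unfolding ipds_solves_def
proof (intro allI impI conjI ballI)
  fix M F v lo start and \<omega>
  assume h: "lin_oracle (feas P) lo \<and> start_rule (feas P) start \<and> oracle_run P a lo start M F v"
  show "eps_solution P M \<epsilon> (\<lambda>\<omega>. ipds_output P a lo start (\<lambda>k. v k \<omega>))"
    using eps_solution_ipds[OF P R tol meta_eq_to_obj_eq[OF a_def], of lo start M F v \<epsilon>] h eps N by blast
  show "ereal_of_enat (lo_complexity P a lo start (\<lambda>k. v k \<omega>)) \<le> ereal B"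
    using lo_complexity_le[OF P R tol meta_eq_to_obj_eq[OF a_def], of lo start "\<lambda>k. v k \<omega>"] h calls
    by (meson ereal_less_eq(3) order_trans)
qed

section \<open>Error budget and cost of the subproblems\<close>

text \<open>A bound for the total error, divided by \<open>L\<close>, of a run with \<open>R = 1\<close> whose tolerances contribute at most
  \<open>2 L\<close> and whose noise contributes at most \<open>L\<close> per worker.\<close>

definition budget :: "nat \<Rightarrow> real \<Rightarrow> real \<Rightarrow> real" where
  "budget n r Z = 8 * r\<^sup>2 + (Z + 1)\<^sup>2 / 8 + 2 + real n"

lemma budget_ge_2: "budget n r Z \<ge> 2"
  by (simp add: budget_def)

context
  fixes P :: "('m::finite, 'd::finite) problem" and N :: nat and c :: real and tk :: "nat \<Rightarrow> real"
  assumes P: "pds_problem P" and tk: "\<And>k. tk k > 0" and N: "N \<ge> 1"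
begin

private abbreviation "par \<equiv> ipds_choice P N 1 c (\<lambda>k t. tk k)"
private abbreviation "Tk \<equiv> T_of (Lt P) (mu P) (onorm (Aop P)) 1"
private abbreviation "pk \<equiv> p_of (Lt P) (mu P)"
private abbreviation "bk \<equiv> beta_of (Lt P) (mu P)"

text \<open>The curvature of the subproblems grows linearly along an inner loop, and so does the number of
  calls that a fixed tolerance requires. The last curvature bounds them all.\<close>

lemma inner_calls_le:
  assumes k: "k \<ge> 1"
  shows "(\<Sum>t=1..Tk k. 4 * (sub_b P (peta par k t) (pk k) * (diameter (feas P))\<^sup>2) / tk k + 4)
    \<le> (real (Tk k))\<^sup>2 * (8 * (2 * pk k + mu P) * (diameter (feas P))\<^sup>2 / tk k + 4)"
proof -
  have p: "pk k > 0"
    by (rule p_of_pos[OF Lt_pos[OF P] mu_nonneg[OF P] k])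
  have T: "Tk k \<ge> 1" by (intro T_of_pos Lt_pos mu_nonneg onorm_Aop_pos P k) simp
  have m: "mu P \<ge> 0" by (rule mu_nonneg[OF P])
  have b: "sub_b P (peta par k t) (pk k) \<le> 2 * (2 * pk k + mu P) * real (Tk k)" if "t \<in> {1..Tk k}" for t
  proof -
    have "sub_b P (peta par k t) (pk k) = 2 * ((pk k + mu P) * real t + pk k * real (Tk k))"
      by (simp add: sub_b_def ipds_choice_def Let_def algebra_simps)
    also have "\<dots> \<le> 2 * ((pk k + mu P) * real (Tk k) + pk k * real (Tk k))"
      using that p m by (intro mult_left_mono add_right_mono) auto
    finally show ?thesis by (simp add: algebra_simps)
  qed
  have "(\<Sum>t=1..Tk k. 4 * (sub_b P (peta par k t) (pk k) * (diameter (feas P))\<^sup>2) / tk k + 4)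
    \<le> (\<Sum>t=1..Tk k. 4 * (2 * (2 * pk k + mu P) * real (Tk k) * (diameter (feas P))\<^sup>2) / tk k + 4)"
    using b tk[of k] by (intro sum_mono add_right_mono divide_right_mono mult_left_mono mult_right_mono) auto
  also have "\<dots> = real (Tk k) * (real (Tk k) * (8 * (2 * pk k + mu P) * (diameter (feas P))\<^sup>2 / tk k) + 4)"
    by (simp add: algebra_simps)
  also have "\<dots> \<le> real (Tk k) * (real (Tk k) * (8 * (2 * pk k + mu P) * (diameter (feas P))\<^sup>2 / tk k) + real (Tk k) * 4)"
    using T by (intro mult_left_mono add_left_mono) auto
  finally show ?thesis by (simp add: power2_eq_square algebra_simps)
qed

lemma ipds_solves_of_budget:
  assumes tolerances: "(\<Sum>k=1..N. bk k * tk k) \<le> 2 * Lt P"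
    and noise: "(noise P)\<^sup>2 * (\<Sum>k=1..N. bk k / (pk k * real (c_of (Lt P) (mu P) N c k))) \<le> 2 * Lt P"
    and accuracy: "Lt P * budget CARD('m) (norm (x0 P - xstar P)) (norm (zstar P)) \<le> (\<Sum>k=1..N. bk k) * \<epsilon>"
    and calls: "(\<Sum>k=1..N. (real (Tk k))\<^sup>2 * (8 * (2 * pk k + mu P) * (diameter (feas P))\<^sup>2 / tk k + 4)) \<le> B"
  shows "ipds_solves P W par \<epsilon> B"
proof (rule ipds_solvesI[OF P _ tk N], goal_cases)
  case 1 show ?case by simp
next
  case 2
  have T: "Tk k \<ge> 1" if "k \<ge> 1" for k by (intro T_of_pos Lt_pos mu_nonneg onorm_Aop_pos P that) simp
  have s: "pbeta par = bk" "pT par = Tk" "pc par = c_of (Lt P) (mu P) N c" "pp par = pk"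
    by (simp_all add: ipds_choice_def Let_def)
  have t: "(\<Sum>k=1..N. bk k / real (Tk k) * (\<Sum>t=1..Tk k. tk k)) = (\<Sum>k=1..N. bk k * tk k)"
  proof (intro sum.cong refl)
    fix k assume "k \<in> {1..N}"
    thus "bk k / real (Tk k) * (\<Sum>t=1..Tk k. tk k) = bk k * tk k" using T[of k] by simp
  qed
  have "(\<Sum>k=1..N. bk k * (real CARD('m) * ((noise P)\<^sup>2 / real (c_of (Lt P) (mu P) N c k))) / (3 * pk k))
     = real CARD('m) / 3 * ((noise P)\<^sup>2 * (\<Sum>k=1..N. bk k / (pk k * real (c_of (Lt P) (mu P) N c k))))"
    by (simp add: sum_distrib_left mult_ac)
  also have "\<dots> \<le> real CARD('m) / 3 * (2 * Lt P)" using noise by (intro mult_left_mono) auto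
  also have "\<dots> \<le> real CARD('m) * Lt P" using Lt_pos[OF P] by simp
  finally have n: "(\<Sum>k=1..N. bk k * (real CARD('m) * ((noise P)\<^sup>2 / real (c_of (Lt P) (mu P) N c k))) / (3 * pk k))
    \<le> real CARD('m) * Lt P" .
  show ?case unfolding s t using n tolerances accuracy
    by (simp add: budget_def algebra_simps)
next
  case 3
  have s: "pT par = Tk" "pp par = pk" by (simp_all add: ipds_choice_def Let_def)
  show ?case unfolding s
    by (rule order_trans[OF sum_mono calls]) (use inner_calls_le in auto)
qed

end

section \<open>Complexity in the convex case\<close>

lemma sum_upto_le:
  assumes "\<And>k. k \<in> {1..n} \<Longrightarrow> f k \<le> (b :: real)"
  shows "(\<Sum>k=1..n. f k) \<le> real n * b"
  using sum_bounded_above[of "{1..n}" f b] assms by simp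

text \<open>The weights \<open>k\<close> sum up to more than \<open>N\<^sup>2 / 2\<close>, so that \<open>N\<close> of order \<open>sqrt (C L / \<epsilon>)\<close> suffices. As the
  inner loops have length of order \<open>k A / L\<close>, the communication is of order \<open>N\<^sup>2 A / L\<close>, and the
  linear optimizations, like the samples that reduce the noise, are of order \<open>N ^ 4\<close>.\<close>

lemma convex_case:
  fixes P :: "('m::finite, 'd::finite) problem"
  assumes P: "pds_problem P" and mu0: "mu P = 0"
  defines "D \<equiv> diameter (feas P)" and "C \<equiv> budget CARD('m) (norm (x0 P - xstar P)) (norm (zstar P))"
    and "A \<equiv> onorm (Aop P)" and "L \<equiv> Lt P" and "\<sigma> \<equiv> noise P"
  shows "\<forall>\<^sub>F \<epsilon> in at_right 0. \<exists>N R c tol. N \<ge> 1 \<and> R > 0 \<and> c > 0 \<and> (\<forall>k t. tol k t > 0) \<and>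
     (let a = ipds_choice P N R c tol in
      real (sampling_complexity a) \<le> 4 * sqrt (2 * C) * sqrt (L / \<epsilon>) + 16 * C\<^sup>2 * (\<sigma>\<^sup>2 / \<epsilon>\<^sup>2) \<and>
      real (communication_complexity a) \<le> 32 * C * (A / \<epsilon>) \<and>
      ipds_solves P W a \<epsilon> (64 * C\<^sup>2 * (256 * D\<^sup>2 + 16) * A\<^sup>2 * (1 / \<epsilon>\<^sup>2)))"
proof -
  have L: "L > 0" and A: "A > 0" unfolding L_def A_def by (intro Lt_pos onorm_Aop_pos P)+
  have C: "C \<ge> 2" unfolding C_def by (rule budget_ge_2)
  \<comment> \<open>below \<open>e0\<close>, \<open>N\<close> exceeds \<open>L / A\<close>, and rounding up at most doubles \<open>N\<close> and the bound \<open>N A / L\<close> for the inner loop lengths\<close>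
  define e0 where "e0 = 2 * C * L / (max 1 (L / A))\<^sup>2"
  have e0: "e0 > 0" using C L by (auto simp: e0_def intro!: divide_pos_pos)
  have "\<forall>\<^sub>F \<epsilon> in at_right 0. \<epsilon> \<in> {0<..<e0}" by (rule eventually_at_right_real[OF e0])
  thus ?thesis
  proof eventually_elim
    case (elim \<epsilon>)
    hence e: "0 < \<epsilon>" "\<epsilon> < e0" by auto
    define y where "y = sqrt (2 * C * L / \<epsilon>)"
    have y2: "y\<^sup>2 = 2 * C * L / \<epsilon>" using C L e by (simp add: y_def)
    have "(max 1 (L / A))\<^sup>2 \<le> 2 * C * L / \<epsilon>"
      using e C L by (simp add: e0_def field_simps)
    hence "max 1 (L / A) \<le> y" unfolding y_def by (intro real_le_rsqrt)
    hence y: "1 \<le> y" "L / A \<le> y" by auto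
    define N where "N = nat \<lceil>y\<rceil>"
    have Ny: "y \<le> real N" "real N \<le> 2 * y" using y by (simp_all add: N_def) linarith
    hence N1: "N \<ge> 1" using y by simp
    have N0: "real N > 0" using N1 by simp
    have N2: "(real N)\<^sup>2 \<ge> 2 * C * L / \<epsilon>" unfolding y2[symmetric] using Ny y by (intro power_mono) auto
    have N2': "(real N)\<^sup>2 \<le> 8 * C * L / \<epsilon>"
    proof -
      have "(real N)\<^sup>2 \<le> (2 * y)\<^sup>2" using Ny by (intro power_mono) auto
      thus ?thesis by (simp add: power_mult_distrib y2)
    qed
    have N4: "(real N)^4 \<le> 64 * C\<^sup>2 * L\<^sup>2 / \<epsilon>\<^sup>2"
    proof -
      have "((real N)\<^sup>2)\<^sup>2 \<le> (8 * C * L / \<epsilon>)\<^sup>2" using N2' by (intro power_mono) auto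
      thus ?thesis by (simp add: power_mult_distrib power_divide)
    qed
    \<comment> \<open>the second term keeps \<open>c\<close> positive without noise; it costs only \<open>N\<close> samples\<close>
    define c where "c = \<sigma>\<^sup>2 + 4 * L\<^sup>2 / (real N)^3"
    have c: "c > 0" unfolding c_def using L N0 by (intro add_nonneg_pos) auto
    \<comment> \<open>each outer iteration gets the same share of the error budget \<open>L\<close>\<close>
    define tk where "tk k = (if k = 0 then 1 else L / (real N * real k))" for k :: nat
    have tk: "tk k > 0" for k using L N0 by (simp add: tk_def)
    define a where "a = ipds_choice P N 1 c (\<lambda>k t. tk k)"
    have Del: "Delta_of L (mu P) = \<infinity>" by (simp add: Delta_of_def mu0)
    have beta: "beta_of L (mu P) k = real k" and p: "p_of L (mu P) k = 4 * L / real k" for k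
      by (simp_all add: beta_of_def p_of_def Del)
    define T where "T = T_of L (mu P) A 1"
    have T: "T k = nat \<lceil>real k * A / L\<rceil>" for k by (simp add: T_def T_of_def Del)
    define cc where "cc = c_of L (mu P) N c"
    have cc: "cc k = nat \<lceil>real N * (real k)\<^sup>2 * c / (4 * L\<^sup>2)\<rceil>" for k
      by (simp add: cc_def c_of_def Del beta p power2_eq_square mult_ac)
    have "L / A \<le> real N" using Ny y by linarith
    hence NA: "1 \<le> real N * A / L" using L A by (simp add: field_simps)
    have Tle: "real (T k) \<le> 2 * (real N * A / L)" if "k \<in> {1..N}" for k
    proof -
      have "real (T k) \<le> real k * A / L + 1" using L A by (simp add: T)
      also have "real k * A / L \<le> real N * A / L" using that L A by (intro divide_right_mono mult_right_mono) auto
      finally have "real (T k) \<le> real N * A / L + 1" by simp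
      thus ?thesis using NA unfolding mult_2 by (meson add_left_mono order_trans)
    qed
    have sampling: "real (sampling_complexity a) \<le> 4 * sqrt (2 * C) * sqrt (L / \<epsilon>) + 16 * C\<^sup>2 * (\<sigma>\<^sup>2 / \<epsilon>\<^sup>2)"
    proof -
      have "real (sampling_complexity a) = (\<Sum>k=1..N. real (cc k))"
        by (simp add: sampling_complexity_def a_def ipds_choice_def Let_def cc_def L_def)
      also have "\<dots> \<le> real N * (real N * (real N)\<^sup>2 * c / (4 * L\<^sup>2) + 1)"
      proof (rule sum_upto_le)
        fix k assume k: "k \<in> {1..N}"
        have "0 \<le> real N * (real k)\<^sup>2 * c / (4 * L\<^sup>2)" using c by simp
        hence "real (cc k) \<le> real N * (real k)\<^sup>2 * c / (4 * L\<^sup>2) + 1" unfolding cc by linarith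
        also have "real N * (real k)\<^sup>2 * c / (4 * L\<^sup>2) \<le> real N * (real N)\<^sup>2 * c / (4 * L\<^sup>2)"
          using k c by (intro divide_right_mono mult_right_mono mult_left_mono power_mono) auto
        finally show "real (cc k) \<le> real N * (real N)\<^sup>2 * c / (4 * L\<^sup>2) + 1" by simp
      qed
      also have "\<dots> = 2 * real N + (real N)^4 * \<sigma>\<^sup>2 / (4 * L\<^sup>2)"
        using N0 L by (simp add: c_def field_simps power2_eq_square power3_eq_cube power4_eq_xxxx)
      also have "\<dots> \<le> 2 * (2 * y) + 64 * C\<^sup>2 * L\<^sup>2 / \<epsilon>\<^sup>2 * \<sigma>\<^sup>2 / (4 * L\<^sup>2)"
        using Ny N4 by (intro add_mono divide_right_mono mult_right_mono mult_left_mono) auto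
      also have "64 * C\<^sup>2 * L\<^sup>2 / \<epsilon>\<^sup>2 * \<sigma>\<^sup>2 / (4 * L\<^sup>2) = 16 * C\<^sup>2 * (\<sigma>\<^sup>2 / \<epsilon>\<^sup>2)"
        using L by simp
      also have "2 * (2 * y) = 4 * sqrt (2 * C) * sqrt (L / \<epsilon>)"
        by (simp add: y_def real_sqrt_mult[symmetric])
      finally show ?thesis .
    qed
    have communication: "real (communication_complexity a) \<le> 32 * C * (A / \<epsilon>)"
    proof -
      have "real (communication_complexity a) = 2 * (\<Sum>k=1..N. real (T k))"
        by (simp add: communication_complexity_def a_def ipds_choice_def Let_def T_def L_def A_def)
      also have "\<dots> \<le> 2 * (real N * (2 * (real N * A / L)))"
        by (intro mult_left_mono sum_upto_le Tle) auto
      also have "\<dots> = 4 * (real N)\<^sup>2 * A / L" by (simp add: power2_eq_square)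
      also have "\<dots> \<le> 4 * (8 * C * L / \<epsilon>) * A / L"
        using N2' L A by (intro divide_right_mono mult_right_mono mult_left_mono) auto
      finally show ?thesis using L by simp
    qed
    have solves: "ipds_solves P W a \<epsilon> (64 * C\<^sup>2 * (256 * D\<^sup>2 + 16) * A\<^sup>2 * (1 / \<epsilon>\<^sup>2))"
      unfolding a_def
    proof (rule ipds_solves_of_budget[OF P tk N1], unfold L_def[symmetric] A_def[symmetric] D_def[symmetric] C_def[symmetric] \<sigma>_def[symmetric])
      have "(\<Sum>k=1..N. beta_of L (mu P) k * tk k) = (\<Sum>k=1..N. L / real N)"
        using N0 by (intro sum.cong) (auto simp: beta tk_def)
      also have "\<dots> = L" using N0 by simp
      finally show "(\<Sum>k=1..N. beta_of L (mu P) k * tk k) \<le> 2 * L" using L by simp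
    next
      have "(\<Sum>k=1..N. beta_of L (mu P) k / (p_of L (mu P) k * real (cc k))) \<le> real N * (L / (real N * c))"
      proof (rule sum_upto_le)
        fix k assume k: "k \<in> {1..N}"
        define z where "z = real N * (real k)\<^sup>2 * c / (4 * L\<^sup>2)"
        have z: "0 < z" using k c L N0 by (simp add: z_def)
        have cz: "z \<le> real (cc k)" unfolding cc z_def by (rule real_nat_ceiling_ge)
        have "beta_of L (mu P) k / (p_of L (mu P) k * real (cc k)) = (real k)\<^sup>2 / (4 * L) / real (cc k)"
          by (simp add: beta p power2_eq_square)
        also have "\<dots> \<le> (real k)\<^sup>2 / (4 * L) / z"
          using cz z L by (intro divide_left_mono mult_pos_pos) auto
        also have "\<dots> = L / (real N * c)" using k L c N0 by (simp add: z_def field_simps power2_eq_square)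
        finally show "beta_of L (mu P) k / (p_of L (mu P) k * real (cc k)) \<le> L / (real N * c)" .
      qed
      also have "\<dots> = L / c" using N0 by simp
      finally have "\<sigma>\<^sup>2 * (\<Sum>k=1..N. beta_of L (mu P) k / (p_of L (mu P) k * real (cc k))) \<le> \<sigma>\<^sup>2 * (L / c)"
        by (intro mult_left_mono) auto
      also have "\<dots> \<le> c * (L / c)" using L c by (intro mult_right_mono) (auto simp: c_def)
      also have "\<dots> \<le> 2 * L" using L c by simp
      finally show "\<sigma>\<^sup>2 * (\<Sum>k=1..N. beta_of L (mu P) k / (p_of L (mu P) k * real (c_of L (mu P) N c k))) \<le> 2 * L"
        by (simp add: cc_def)
    next
      have "(\<Sum>k=1..n. real k) = real n * (real n + 1) / 2" for n
        by (induction n) (auto simp: field_simps)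
      hence "(\<Sum>k=1..N. beta_of L (mu P) k) \<ge> (real N)\<^sup>2 / 2"
        by (simp add: beta power2_eq_square field_simps)
      moreover have "(real N)\<^sup>2 / 2 \<ge> C * L / \<epsilon>" using N2 by (simp add: mult_ac)
      ultimately have "(\<Sum>k=1..N. beta_of L (mu P) k) \<ge> C * L / \<epsilon>" by (rule order_trans[rotated])
      thus "L * C \<le> (\<Sum>k=1..N. beta_of L (mu P) k) * \<epsilon>" using e by (simp add: field_simps)
    next
      have "(\<Sum>k=1..N. (real (T k))\<^sup>2 * (8 * (2 * p_of L (mu P) k + mu P) * D\<^sup>2 / tk k + 4))
        \<le> real N * ((2 * (real N * A / L))\<^sup>2 * (real N * (64 * D\<^sup>2 + 4)))"
      proof (rule sum_upto_le)
        fix k assume k: "k \<in> {1..N}"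
        have "8 * (2 * p_of L (mu P) k + mu P) * D\<^sup>2 / tk k + 4 = real N * (64 * D\<^sup>2) + 4"
          using k L unfolding p unfolding mu0 by (simp add: tk_def)
        also have "\<dots> \<le> real N * (64 * D\<^sup>2) + real N * 4" using N1 by simp
        finally have 1: "8 * (2 * p_of L (mu P) k + mu P) * D\<^sup>2 / tk k + 4 \<le> real N * (64 * D\<^sup>2 + 4)"
          by (simp add: distrib_left)
        have "(real (T k))\<^sup>2 * (8 * (2 * p_of L (mu P) k + mu P) * D\<^sup>2 / tk k + 4)
          \<le> (real (T k))\<^sup>2 * (real N * (64 * D\<^sup>2 + 4))"
          using 1 by (intro mult_left_mono) auto
        also have "\<dots> \<le> (2 * (real N * A / L))\<^sup>2 * (real N * (64 * D\<^sup>2 + 4))"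
          using Tle[OF k] by (intro mult_right_mono power_mono) auto
        finally show "(real (T k))\<^sup>2 * (8 * (2 * p_of L (mu P) k + mu P) * D\<^sup>2 / tk k + 4) \<le> \<dots>" .
      qed
      also have "\<dots> = (real N)^4 * ((256 * D\<^sup>2 + 16) * A\<^sup>2 / L\<^sup>2)"
        using L by (simp add: field_simps power2_eq_square power4_eq_xxxx)
      also have "\<dots> \<le> 64 * C\<^sup>2 * L\<^sup>2 / \<epsilon>\<^sup>2 * ((256 * D\<^sup>2 + 16) * A\<^sup>2 / L\<^sup>2)"
        using N4 by (intro mult_right_mono) auto
      also have "\<dots> = 64 * C\<^sup>2 * (256 * D\<^sup>2 + 16) * A\<^sup>2 * (1 / \<epsilon>\<^sup>2)" using L by simp
      finally show "(\<Sum>k=1..N. (real (T_of L (mu P) A 1 k))\<^sup>2 * (8 * (2 * p_of L (mu P) k + mu P) * D\<^sup>2 / tk k + 4))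
        \<le> 64 * C\<^sup>2 * (256 * D\<^sup>2 + 16) * A\<^sup>2 * (1 / \<epsilon>\<^sup>2)" by (simp add: T_def)
    qed
    show ?case
      by (rule exI[of _ N], rule exI[of _ 1], rule exI[of _ c], rule exI[of _ "\<lambda>k t. tk k"])
         (use N1 c tk sampling communication solves in \<open>simp add: a_def Let_def\<close>)
  qed
qed

section \<open>Complexity in the strongly convex case\<close>

lemma sum_split_at:
  fixes f :: "nat \<Rightarrow> real"
  shows "(\<Sum>k=1..n + M. f k) = (\<Sum>k=1..n. f k) + (\<Sum>j=1..M. f (n + j))"
  by (induction M) auto

lemma sum_power_le:
  assumes "0 < s" "s < (1 :: real)"
  shows "(\<Sum>j=1..M. s ^ (M - j)) \<le> 1 / (1 - s)"
proof (induction M)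
  case 0 thus ?case using assms by simp
next
  case (Suc M)
  have "(\<Sum>j=1..M. s ^ (Suc M - j)) = s * (\<Sum>j=1..M. s ^ (M - j))"
    unfolding sum_distrib_left by (intro sum.cong) (auto simp: Suc_diff_le)
  also have "\<dots> \<le> s * (1 / (1 - s))" using Suc assms by (intro mult_left_mono) auto
  finally show ?case using assms by (simp add: field_simps)
qed

text \<open>A bound for the sum of the powers of \<open>sqrt lam\<close>.\<close>

definition geo_bound :: "real \<Rightarrow> real \<Rightarrow> real" where
  "geo_bound L m = 2 * (1 + tau_of L m)"

definition phase_length :: "real \<Rightarrow> real \<Rightarrow> nat" where
  "phase_length L m = the_enat (Delta_of L m)"

text \<open>In this constant and the next two, the first summand stems from the first phase and the second one
  from the second phase, where a factor \<open>geo_bound\<close> stands for a geometric sum or for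
  \<open>2 (1 + tau)\<close>.\<close>

definition sampling_const :: "real \<Rightarrow> real \<Rightarrow> real" where
  "sampling_const L m = real (phase_length L m) ^ 4 / (4 * L\<^sup>2)
     + (1 + tau_of L m)\<^sup>2 * real (phase_length L m) * geo_bound L m / L\<^sup>2"

definition communication_const :: "real \<Rightarrow> real \<Rightarrow> real" where
  "communication_const L m = (real (phase_length L m))\<^sup>2 / L + (geo_bound L m)\<^sup>2 / L"

definition lo_const :: "real \<Rightarrow> real \<Rightarrow> real \<Rightarrow> real \<Rightarrow> real" where
  "lo_const L m A D = (geo_bound L m * A / L + 1)\<^sup>2 *
     (real (phase_length L m) * (8 * (8 * L + m) * D\<^sup>2 * (real (phase_length L m))\<^sup>2 / L + 4)
      + geo_bound L m * (8 * (8 * L + m) * D\<^sup>2 * real (phase_length L m) * geo_bound L m / L + 4))"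

text \<open>The first phase shares a budget \<open>L\<close> evenly. In the second phase the shares decay geometrically
  backwards from the last iteration; equal shares would cost an additional factor \<open>log (1 / \<epsilon>)\<close>
  in the number of linear optimizations.\<close>

definition sc_tol :: "real \<Rightarrow> real \<Rightarrow> nat \<Rightarrow> nat \<Rightarrow> real" where
  "sc_tol L m M k = (if k = 0 then 1
     else if k \<le> phase_length L m then L / (real (phase_length L m) * beta_of L m k)
     else L * (1 - sqrt (lam_of L m)) * sqrt (lam_of L m) ^ (phase_length L m + M - k) / beta_of L m k)"

context
  fixes L m :: real
  assumes L: "L > 0" and m: "m > 0"
begin

private abbreviation "\<tau> \<equiv> tau_of L m"
private abbreviation "\<rho> \<equiv> lam_of L m"
private abbreviation "\<Delta> \<equiv> phase_length L m"
private abbreviation "G \<equiv> geo_bound L m"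
private definition "s = sqrt \<rho>"

lemma tau_pos: "\<tau> > 0" by (rule tau_of_pos[OF L less_imp_le[OF m] m])

lemma lam_bounds: "0 < \<rho>" "\<rho> < 1"
  using tau_pos by (simp_all add: lam_of_def)

lemma phase_bounds: "Delta_of L m = enat \<Delta>" "2 * \<tau> + 1 \<le> real \<Delta>" "real \<Delta> \<le> 2 * \<tau> + 2"
  unfolding phase_length_def by (rule Delta_of_bounds[OF L less_imp_le[OF m] m])+

lemma phase_ge_1: "\<Delta> \<ge> 1" using phase_bounds(2) tau_pos by simp

lemma root_bounds: "0 < s" "s < 1" "s\<^sup>2 = \<rho>" using lam_bounds by (simp_all add: s_def)

lemma geo_bounds: "1 / (1 - s) \<le> G" "G > 0" "real \<Delta> \<le> G"
proof -
  have "1 - \<rho> = 1 / (1 + \<tau>)" using tau_pos by (simp add: lam_of_def field_simps)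
  moreover have "1 - \<rho> = (1 - s) * (1 + s)" by (simp add: root_bounds(3)[symmetric] power2_eq_square algebra_simps)
  moreover have "(1 - s) * (1 + s) \<le> (1 - s) * 2" using root_bounds by (intro mult_left_mono) auto
  ultimately have "1 / (1 + \<tau>) \<le> (1 - s) * 2" by simp
  thus "1 / (1 - s) \<le> G" using root_bounds tau_pos by (simp add: geo_bound_def field_simps)
  show "G > 0" "real \<Delta> \<le> G" using tau_pos phase_bounds(3) by (simp_all add: geo_bound_def)
qed

lemma sc_tol_pos: "sc_tol L m M k > 0"
proof (cases "k = 0")
  case False
  have "beta_of L m k > 0" using False by (intro beta_of_pos[OF L less_imp_le[OF m]]) simp
  thus ?thesis using L root_bounds phase_ge_1 by (simp add: sc_tol_def s_def[symmetric])
qed (simp add: sc_tol_def)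

context
  fixes A c :: real and M :: nat
  assumes A: "A > 0" and c: "c > 0"
begin

text \<open>In the second phase, of length \<open>M\<close>, all parameters depend on the iteration through powers of
  \<open>s\<close>, and \<open>M\<close> will be chosen such that \<open>b\<close> is of order \<open>sqrt \<epsilon>\<close>. Counted from the last
  iteration backwards the summands decay geometrically, so that every sum is bounded by its last
  term up to the factor \<open>1 / (1 - s) \<le> G\<close>.\<close>

private definition "b = s ^ M"
private abbreviation "inner_len \<equiv> T_of L m A 1"
private abbreviation "cc \<equiv> c_of L m (\<Delta> + M) c"
private abbreviation "weight \<equiv> beta_of L m"
private abbreviation "prox_w \<equiv> p_of L m"
private abbreviation "tol \<equiv> sc_tol L m M"

lemma b_bounds: "0 < b" "b \<le> 1" using root_bounds by (simp_all add: b_def power_le_one)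

lemma sum_geo: "(\<Sum>j=1..M. s ^ (M - j)) \<le> G"
  using sum_power_le[OF root_bounds(1,2), of M] geo_bounds(1) by linarith

lemma first_phase:
  assumes "k \<in> {1..\<Delta>}"
  shows "weight k = real k" "prox_w k = 4 * L / real k" "real (inner_len k) \<le> real k * A / L + 1"
    "cc k = nat \<lceil>real \<Delta> * (real k)\<^sup>2 * c / (4 * L\<^sup>2)\<rceil>"
  using assms L A phase_bounds(1) by (simp_all add: beta_of_def p_of_def T_of_def c_of_def power2_eq_square mult_ac)

text \<open>The square of \<open>x\<close> is the weight of iteration \<open>\<Delta> + j\<close> relative to the last one.\<close>

lemma second_phase:
  assumes j: "j \<in> {1..M}"
  defines "x \<equiv> s ^ (M - j)"
  shows "0 < x" "x \<le> 1" "b \<le> x" "weight (\<Delta> + j) = real \<Delta> * x\<^sup>2 / b\<^sup>2" "prox_w (\<Delta> + j) = 4 * L / G"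
    "real (inner_len (\<Delta> + j)) \<le> G * A * x / (L * b) + 1"
    "cc (\<Delta> + j) = nat \<lceil>(1 + \<tau>)\<^sup>2 * real \<Delta> * c * x / (L\<^sup>2 * b\<^sup>2)\<rceil>"
    "tol (\<Delta> + j) = L * (1 - s) * x / weight (\<Delta> + j)"
proof -
  show x: "0 < x" "x \<le> 1" using root_bounds by (simp_all add: x_def power_le_one)
  have sj: "s ^ j = b / x" using j root_bounds by (simp add: b_def x_def power_add[symmetric] field_simps)
  have "s ^ j \<le> 1" using root_bounds by (simp add: power_le_one)
  thus "b \<le> x" using x unfolding sj by simp
  have nl: "\<not> enat (\<Delta> + j) \<le> Delta_of L m" using j phase_bounds(1) by simp
  have half: "\<rho> powr (real i / 2) = s ^ i" for i :: nat
  proof -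
    have "\<rho> powr (real i / 2) = (\<rho> powr (1 / 2)) powr real i" by (simp add: powr_powr)
    also have "\<dots> = s powr real i" using lam_bounds by (simp add: s_def powr_half_sqrt)
    finally show ?thesis using root_bounds by (simp add: powr_realpow)
  qed
  have "\<rho> powr (- (real (\<Delta> + j) - real \<Delta>)) = inverse (s ^ (2 * j))"
    using half[of "2 * j"] by (simp add: powr_minus)
  also have "\<dots> = x\<^sup>2 / b\<^sup>2" using x b_bounds by (simp add: power_even_eq sj power_divide)
  finally have e1: "\<rho> powr (- (real (\<Delta> + j) - real \<Delta>)) = x\<^sup>2 / b\<^sup>2" .
  show "weight (\<Delta> + j) = real \<Delta> * x\<^sup>2 / b\<^sup>2"
    using nl unfolding beta_of_def Let_def phase_length_def[symmetric] e1 by simp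
  show "prox_w (\<Delta> + j) = 4 * L / G" using nl tau_pos by (simp add: p_of_def geo_bound_def divide_simps)
  have e2: "\<rho> powr ((real (\<Delta> + j) - real \<Delta>) / 2) = b / x"
    using half[of j] sj by simp
  have "inner_len (\<Delta> + j) = nat \<lceil>G * A / (L * (b / x))\<rceil>"
    using nl unfolding T_of_def Let_def phase_length_def[symmetric] e2 by (simp add: geo_bound_def)
  moreover have "G * A / (L * (b / x)) = G * A * x / (L * b)" by simp
  ultimately have "inner_len (\<Delta> + j) = nat \<lceil>G * A * x / (L * b)\<rceil>" by simp
  moreover have "0 \<le> G * A * x / (L * b)" using geo_bounds A x L b_bounds by simp
  ultimately show "real (inner_len (\<Delta> + j)) \<le> G * A * x / (L * b) + 1" by simp
  have "(real (\<Delta> + j) + real (\<Delta> + M) - 2 * real \<Delta>) / 2 = real (j + M) / 2" by simp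
  hence e3: "\<rho> powr ((real (\<Delta> + j) + real (\<Delta> + M) - 2 * real \<Delta>) / 2) = b\<^sup>2 / x"
    using half[of "j + M"] by (simp only:) (simp add: power_add sj b_def[symmetric] power2_eq_square)
  have "cc (\<Delta> + j) = nat \<lceil>(1 + \<tau>)\<^sup>2 * real \<Delta> * c / (L\<^sup>2 * (b\<^sup>2 / x))\<rceil>"
    using nl unfolding c_of_def Let_def phase_length_def[symmetric] e3 by simp
  thus "cc (\<Delta> + j) = nat \<lceil>(1 + \<tau>)\<^sup>2 * real \<Delta> * c * x / (L\<^sup>2 * b\<^sup>2)\<rceil>" by simp
  show "tol (\<Delta> + j) = L * (1 - s) * x / weight (\<Delta> + j)"
    using j by (simp add: sc_tol_def s_def x_def)
qed

lemma sc_tolerances: "(\<Sum>k=1..\<Delta> + M. weight k * tol k) \<le> 2 * L"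
proof -
  have pos: "weight k > 0" if "k \<ge> 1" for k by (rule beta_of_pos[OF L less_imp_le[OF m] that])
  have "(\<Sum>k=1..\<Delta>. weight k * tol k) = (\<Sum>k=1..\<Delta>. L / real \<Delta>)"
    using phase_ge_1 by (intro sum.cong) (auto simp: sc_tol_def first_phase)
  also have "\<dots> = L" using phase_ge_1 by simp
  finally have 1: "(\<Sum>k=1..\<Delta>. weight k * tol k) = L" .
  have "(\<Sum>j=1..M. weight (\<Delta> + j) * tol (\<Delta> + j)) = (\<Sum>j=1..M. L * (1 - s) * s ^ (M - j))"
  proof (intro sum.cong refl)
    fix j assume j: "j \<in> {1..M}"
    have "weight (\<Delta> + j) > 0" using j by (intro pos) simp
    thus "weight (\<Delta> + j) * tol (\<Delta> + j) = L * (1 - s) * s ^ (M - j)" by (simp add: second_phase(8)[OF j])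
  qed
  also have "\<dots> = L * (1 - s) * (\<Sum>j=1..M. s ^ (M - j))" by (simp add: sum_distrib_left)
  also have "\<dots> \<le> L * (1 - s) * (1 / (1 - s))"
    using L root_bounds by (intro mult_left_mono sum_power_le) auto
  also have "\<dots> = L" using root_bounds by simp
  finally show ?thesis unfolding sum_split_at using 1 by linarith
qed

lemma sc_noise: "(\<Sum>k=1..\<Delta> + M. weight k / (prox_w k * real (cc k))) \<le> 2 * L / c"
proof -
  have "(\<Sum>k=1..\<Delta>. weight k / (prox_w k * real (cc k))) \<le> real \<Delta> * (L / (real \<Delta> * c))"
  proof (rule sum_upto_le)
    fix k assume k: "k \<in> {1..\<Delta>}"
    define z where "z = real \<Delta> * (real k)\<^sup>2 * c / (4 * L\<^sup>2)"
    have z: "0 < z" using k c L phase_ge_1 by (simp add: z_def)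
    have cz: "z \<le> real (cc k)" unfolding first_phase(4)[OF k] z_def by (rule real_nat_ceiling_ge)
    have "weight k / (prox_w k * real (cc k)) = (real k)\<^sup>2 / (4 * L) / real (cc k)"
      by (simp add: first_phase(1,2)[OF k] power2_eq_square)
    also have "\<dots> \<le> (real k)\<^sup>2 / (4 * L) / z"
      using cz z L by (intro divide_left_mono mult_pos_pos) auto
    also have "\<dots> = L / (real \<Delta> * c)"
      using k L c phase_ge_1 by (simp add: z_def field_simps power2_eq_square)
    finally show "weight k / (prox_w k * real (cc k)) \<le> L / (real \<Delta> * c)" .
  qed
  hence 1: "(\<Sum>k=1..\<Delta>. weight k / (prox_w k * real (cc k))) \<le> L / c" using phase_ge_1 by simp
  have "(\<Sum>j=1..M. weight (\<Delta> + j) / (prox_w (\<Delta> + j) * real (cc (\<Delta> + j)))) \<le> (\<Sum>j=1..M. L / (G * c) * s ^ (M - j))"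
  proof (rule sum_mono)
    fix j assume j: "j \<in> {1..M}"
    define x where "x = s ^ (M - j)"
    note l = second_phase[OF j, folded x_def]
    define z where "z = (1 + \<tau>)\<^sup>2 * real \<Delta> * c * x / (L\<^sup>2 * b\<^sup>2)"
    have z: "0 < z" using l(1) c L b_bounds tau_pos phase_ge_1 by (simp add: z_def)
    have cz: "z \<le> real (cc (\<Delta> + j))" unfolding l(7) z_def by (rule real_nat_ceiling_ge)
    have "weight (\<Delta> + j) / (prox_w (\<Delta> + j) * real (cc (\<Delta> + j))) = real \<Delta> * x\<^sup>2 / b\<^sup>2 * G / (4 * L) / real (cc (\<Delta> + j))"
      by (simp add: l)
    also have "\<dots> \<le> real \<Delta> * x\<^sup>2 / b\<^sup>2 * G / (4 * L) / z"
      using cz z L b_bounds geo_bounds by (intro divide_left_mono mult_pos_pos) auto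
    also have "\<dots> = L / (G * c) * x"
    proof -
      have tG: "1 + \<tau> = G / 2" by (simp add: geo_bound_def)
      show ?thesis unfolding z_def tG using l(1) b_bounds L c geo_bounds(2) phase_ge_1 by (simp add: field_simps power2_eq_square)
    qed
    finally show "weight (\<Delta> + j) / (prox_w (\<Delta> + j) * real (cc (\<Delta> + j))) \<le> L / (G * c) * s ^ (M - j)" by (simp add: x_def)
  qed
  also have "\<dots> = L / (G * c) * (\<Sum>j=1..M. s ^ (M - j))" by (simp add: sum_distrib_left)
  also have "\<dots> \<le> L / (G * c) * G" using sum_geo L c geo_bounds by (intro mult_left_mono) auto
  also have "\<dots> = L / c" using geo_bounds by simp
  finally show ?thesis unfolding sum_split_at using 1 by simp
qed

lemma sc_weights: "(\<Sum>k=1..\<Delta> + M. weight k) \<ge> 1 / b\<^sup>2"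
proof -
  have "weight (\<Delta> + M) \<ge> 1 / b\<^sup>2"
  proof (cases "M = 0")
    case True
    hence "b = 1" unfolding b_def by simp
    thus ?thesis using phase_ge_1 True by (simp add: first_phase)
  next
    case False
    hence "weight (\<Delta> + M) = real \<Delta> / b\<^sup>2" using second_phase(4)[of M] by simp
    thus ?thesis using phase_ge_1 b_bounds by (simp add: divide_right_mono)
  qed
  also have "weight (\<Delta> + M) \<le> (\<Sum>k=1..\<Delta> + M. weight k)"
  proof (rule member_le_sum)
    show "\<Delta> + M \<in> {1..\<Delta> + M}" using phase_ge_1 by simp
    show "0 \<le> weight x" if "x \<in> {1..\<Delta> + M} - {\<Delta> + M}" for x
      using beta_of_pos[OF L less_imp_le[OF m], of x] that by simp
  qed simp
  finally show ?thesis .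
qed

lemma sc_sampling: "(\<Sum>k=1..\<Delta> + M. real (cc k)) \<le> real (\<Delta> + M) + c * sampling_const L m / b\<^sup>2"
proof -
  have b2: "1 \<le> 1 / b\<^sup>2" using b_bounds by (simp add: power_le_one)
  have "(\<Sum>k=1..\<Delta>. real (cc k)) \<le> real \<Delta> * (real \<Delta> * (real \<Delta>)\<^sup>2 * c / (4 * L\<^sup>2) + 1)"
  proof (rule sum_upto_le)
    fix k assume k: "k \<in> {1..\<Delta>}"
    have "0 \<le> real \<Delta> * (real k)\<^sup>2 * c / (4 * L\<^sup>2)" using c by simp
    hence "real (cc k) \<le> real \<Delta> * (real k)\<^sup>2 * c / (4 * L\<^sup>2) + 1" unfolding first_phase(4)[OF k] by linarith
    also have "real \<Delta> * (real k)\<^sup>2 * c / (4 * L\<^sup>2) \<le> real \<Delta> * (real \<Delta>)\<^sup>2 * c / (4 * L\<^sup>2)"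
      using k c by (intro divide_right_mono mult_right_mono mult_left_mono power_mono) auto
    finally show "real (cc k) \<le> real \<Delta> * (real \<Delta>)\<^sup>2 * c / (4 * L\<^sup>2) + 1" by simp
  qed
  also have "\<dots> = real \<Delta> + c * (real \<Delta> ^ 4 / (4 * L\<^sup>2)) * 1"
    by (simp add: algebra_simps power2_eq_square power4_eq_xxxx)
  also have "\<dots> \<le> real \<Delta> + c * (real \<Delta> ^ 4 / (4 * L\<^sup>2)) * (1 / b\<^sup>2)"
    using b2 c by (intro add_left_mono mult_left_mono) auto
  finally have 1: "(\<Sum>k=1..\<Delta>. real (cc k)) \<le> \<dots>" .
  define w where "w = c * ((1 + \<tau>)\<^sup>2 * real \<Delta> / L\<^sup>2) * (1 / b\<^sup>2)"
  have w: "w \<ge> 0" using c by (simp add: w_def)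
  have "(\<Sum>j=1..M. real (cc (\<Delta> + j))) \<le> (\<Sum>j=1..M. w * s ^ (M - j) + 1)"
  proof (rule sum_mono)
    fix j assume j: "j \<in> {1..M}"
    define x where "x = s ^ (M - j)"
    note l = second_phase[OF j, folded x_def]
    have "0 \<le> (1 + \<tau>)\<^sup>2 * real \<Delta> * c * x / (L\<^sup>2 * b\<^sup>2)" using c l(1) by simp
    hence "real (cc (\<Delta> + j)) \<le> (1 + \<tau>)\<^sup>2 * real \<Delta> * c * x / (L\<^sup>2 * b\<^sup>2) + 1" unfolding l(7) by linarith
    thus "real (cc (\<Delta> + j)) \<le> w * s ^ (M - j) + 1" by (simp add: w_def x_def mult_ac)
  qed
  also have "\<dots> = w * (\<Sum>j=1..M. s ^ (M - j)) + real M" by (simp add: sum.distrib sum_distrib_left)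
  also have "\<dots> \<le> w * G + real M" using sum_geo w by (intro add_right_mono mult_left_mono) auto
  finally have 2: "(\<Sum>j=1..M. real (cc (\<Delta> + j))) \<le> w * G + real M" .
  have "real \<Delta> + c * (real \<Delta> ^ 4 / (4 * L\<^sup>2)) * (1 / b\<^sup>2) + (w * G + real M)
     = real (\<Delta> + M) + c * sampling_const L m / b\<^sup>2"
    by (simp add: w_def sampling_const_def add_divide_distrib algebra_simps)
  thus ?thesis unfolding sum_split_at using 1 2 by linarith
qed

lemma sc_communication: "(\<Sum>k=1..\<Delta> + M. real (inner_len k)) \<le> real (\<Delta> + M) + A * communication_const L m / b"
proof -
  have b1: "1 \<le> 1 / b" using b_bounds by simp
  have "(\<Sum>k=1..\<Delta>. real (inner_len k)) \<le> real \<Delta> * (real \<Delta> * A / L + 1)"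
  proof (rule sum_upto_le)
    fix k assume k: "k \<in> {1..\<Delta>}"
    have "real k * A / L \<le> real \<Delta> * A / L" using k A L by (intro divide_right_mono mult_right_mono) auto
    thus "real (inner_len k) \<le> real \<Delta> * A / L + 1" using first_phase(3)[OF k] by linarith
  qed
  also have "\<dots> = real \<Delta> + A * ((real \<Delta>)\<^sup>2 / L) * 1" by (simp add: algebra_simps power2_eq_square)
  also have "\<dots> \<le> real \<Delta> + A * ((real \<Delta>)\<^sup>2 / L) * (1 / b)"
    using b1 A L by (intro add_left_mono mult_left_mono) auto
  finally have 1: "(\<Sum>k=1..\<Delta>. real (inner_len k)) \<le> \<dots>" .
  define w where "w = A * (G / L) * (1 / b)"
  have w: "w \<ge> 0" using A L geo_bounds b_bounds by (simp add: w_def)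
  have "(\<Sum>j=1..M. real (inner_len (\<Delta> + j))) \<le> (\<Sum>j=1..M. w * s ^ (M - j) + 1)"
    using second_phase(6) by (intro sum_mono) (simp add: w_def mult_ac)
  also have "\<dots> = w * (\<Sum>j=1..M. s ^ (M - j)) + real M" by (simp add: sum.distrib sum_distrib_left)
  also have "\<dots> \<le> w * G + real M" using sum_geo w by (intro add_right_mono mult_left_mono) auto
  finally have 2: "(\<Sum>j=1..M. real (inner_len (\<Delta> + j))) \<le> w * G + real M" .
  have "real \<Delta> + A * ((real \<Delta>)\<^sup>2 / L) * (1 / b) + (w * G + real M)
     = real (\<Delta> + M) + A * communication_const L m / b"
    by (simp add: w_def communication_const_def add_divide_distrib algebra_simps power2_eq_square)
  thus ?thesis unfolding sum_split_at using 1 2 by linarith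
qed

lemma sc_lo_calls:
  "(\<Sum>k=1..\<Delta> + M. (real (inner_len k))\<^sup>2 * (8 * (2 * prox_w k + m) * D\<^sup>2 / tol k + 4)) \<le> lo_const L m A D / b ^ 4"
proof -
  define H where "H = G * A / L + 1"
  have H: "H > 0" using geo_bounds A L by (simp add: H_def add_pos_pos)
  define Q where "Q = 8 * (8 * L + m) * D\<^sup>2 / L"
  have Q: "Q \<ge> 0" using L m by (simp add: Q_def)
  have b4: "1 \<le> 1 / b ^ 4" using b_bounds by (simp add: power_le_one)
  have "(\<Sum>k=1..\<Delta>. (real (inner_len k))\<^sup>2 * (8 * (2 * prox_w k + m) * D\<^sup>2 / tol k + 4))
    \<le> real \<Delta> * (H\<^sup>2 * (Q * (real \<Delta>)\<^sup>2 + 4))"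
  proof (rule sum_upto_le)
    fix k assume k: "k \<in> {1..\<Delta>}"
    note e = first_phase[OF k]
    have "real k * A / L \<le> G * A / L" using k geo_bounds(3) A L by (intro divide_right_mono mult_right_mono) auto
    hence TH: "real (inner_len k) \<le> H" using e(3) unfolding H_def by linarith
    have pk: "2 * prox_w k + m \<le> 8 * L + m" using k L unfolding e(2) by (simp add: field_simps)
    have tol: "1 / tol k \<le> (real \<Delta>)\<^sup>2 / L"
      using k L by (simp add: sc_tol_def e(1) power2_eq_square divide_right_mono mult_left_mono)
    have "8 * (2 * prox_w k + m) * D\<^sup>2 * (1 / tol k) \<le> 8 * (8 * L + m) * D\<^sup>2 * ((real \<Delta>)\<^sup>2 / L)"
    proof (rule mult_mono[OF _ tol])
      show "8 * (2 * prox_w k + m) * D\<^sup>2 \<le> 8 * (8 * L + m) * D\<^sup>2"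
        using pk by (intro mult_right_mono mult_left_mono) auto
      show "0 \<le> 8 * (8 * L + m) * D\<^sup>2" using L m by simp
      show "0 \<le> 1 / tol (k)" using sc_tol_pos[of M k] by simp
    qed
    hence "8 * (2 * prox_w k + m) * D\<^sup>2 / tol k + 4 \<le> Q * (real \<Delta>)\<^sup>2 + 4" by (simp add: Q_def)
    moreover have "(real (inner_len k))\<^sup>2 \<le> H\<^sup>2" using TH by (intro power_mono) auto
    ultimately have "(real (inner_len k))\<^sup>2 * (8 * (2 * prox_w k + m) * D\<^sup>2 / tol k + 4) \<le> (real (inner_len k))\<^sup>2 * (Q * (real \<Delta>)\<^sup>2 + 4)"
      by (intro mult_left_mono) auto
    also have "\<dots> \<le> H\<^sup>2 * (Q * (real \<Delta>)\<^sup>2 + 4)"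
      using \<open>(real (inner_len k))\<^sup>2 \<le> H\<^sup>2\<close> Q by (intro mult_right_mono) auto
    finally show "(real (inner_len k))\<^sup>2 * (8 * (2 * prox_w k + m) * D\<^sup>2 / tol k + 4) \<le> H\<^sup>2 * (Q * (real \<Delta>)\<^sup>2 + 4)" .
  qed
  also have "\<dots> = real \<Delta> * (H\<^sup>2 * (Q * (real \<Delta>)\<^sup>2 + 4)) * 1" by simp
  also have "\<dots> \<le> real \<Delta> * (H\<^sup>2 * (Q * (real \<Delta>)\<^sup>2 + 4)) * (1 / b ^ 4)"
    using b4 Q by (intro mult_left_mono) auto
  finally have 1: "(\<Sum>k=1..\<Delta>. (real (inner_len k))\<^sup>2 * (8 * (2 * prox_w k + m) * D\<^sup>2 / tol k + 4)) \<le> \<dots>" .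
  define w where "w = H\<^sup>2 * (Q * real \<Delta> * G + 4) * (1 / b ^ 4)"
  have w: "w \<ge> 0" using Q geo_bounds by (simp add: w_def)
  have "(\<Sum>j=1..M. (real (inner_len (\<Delta> + j)))\<^sup>2 * (8 * (2 * prox_w (\<Delta> + j) + m) * D\<^sup>2 / tol (\<Delta> + j) + 4))
    \<le> (\<Sum>j=1..M. w * s ^ (M - j))"
  proof (rule sum_mono)
    fix j assume j: "j \<in> {1..M}"
    define x where "x = s ^ (M - j)"
    note l = second_phase[OF j, folded x_def]
    have xb: "1 \<le> x / b" using l(3) b_bounds by simp
    have "real (inner_len (\<Delta> + j)) \<le> G * A / L * (x / b) + x / b" using l(6) xb by simp
    hence TH: "real (inner_len (\<Delta> + j)) \<le> H * x / b" by (simp add: H_def algebra_simps add_divide_distrib)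
    have T2: "(real (inner_len (\<Delta> + j)))\<^sup>2 \<le> H\<^sup>2 * x\<^sup>2 / b\<^sup>2"
    proof -
      have "(real (inner_len (\<Delta> + j)))\<^sup>2 \<le> (H * x / b)\<^sup>2" using TH by (intro power_mono) auto
      thus ?thesis by (simp add: power_mult_distrib power_divide)
    qed
    have pk: "2 * prox_w (\<Delta> + j) + m \<le> 8 * L + m"
      using L tau_pos unfolding l(5) by (simp add: geo_bound_def field_simps)
    have "1 / tol (\<Delta> + j) = real \<Delta> * x / b\<^sup>2 / L * (1 / (1 - s))"
      using l(1) b_bounds by (simp add: l(8,4) power2_eq_square)
    also have "\<dots> \<le> real \<Delta> * x / b\<^sup>2 / L * G"
      using geo_bounds(1) l(1) L by (intro mult_left_mono) auto
    finally have tol: "1 / tol (\<Delta> + j) \<le> real \<Delta> * x / b\<^sup>2 / L * G" .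
    have "8 * (2 * prox_w (\<Delta> + j) + m) * D\<^sup>2 * (1 / tol (\<Delta> + j)) \<le> 8 * (8 * L + m) * D\<^sup>2 * (real \<Delta> * x / b\<^sup>2 / L * G)"
    proof (rule mult_mono[OF _ tol])
      show "8 * (2 * prox_w (\<Delta> + j) + m) * D\<^sup>2 \<le> 8 * (8 * L + m) * D\<^sup>2"
        using pk by (intro mult_right_mono mult_left_mono) auto
      show "0 \<le> 8 * (8 * L + m) * D\<^sup>2" using L m by simp
      show "0 \<le> 1 / tol (\<Delta> + j)" using sc_tol_pos[of M "\<Delta> + j"] by simp
    qed
    also have "\<dots> = Q * real \<Delta> * G * x / b\<^sup>2" by (simp add: Q_def mult_ac)
    also have "\<dots> \<le> Q * real \<Delta> * G * 1 / b\<^sup>2"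
      using l(2) Q geo_bounds by (intro divide_right_mono mult_left_mono) auto
    finally have "8 * (2 * prox_w (\<Delta> + j) + m) * D\<^sup>2 / tol (\<Delta> + j) + 4 \<le> Q * real \<Delta> * G / b\<^sup>2 + 4 * 1" by simp
    also have "\<dots> \<le> Q * real \<Delta> * G / b\<^sup>2 + 4 * (1 / b\<^sup>2)"
      using b_bounds by (intro add_left_mono mult_left_mono) (auto simp: power_le_one)
    also have "\<dots> = (Q * real \<Delta> * G + 4) / b\<^sup>2" by (simp add: add_divide_distrib)
    finally have q: "8 * (2 * prox_w (\<Delta> + j) + m) * D\<^sup>2 / tol (\<Delta> + j) + 4 \<le> (Q * real \<Delta> * G + 4) / b\<^sup>2" .
    have p0: "prox_w (\<Delta> + j) \<ge> 0" using L geo_bounds(2) by (simp add: l(5))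
    have q0: "0 \<le> Q * real \<Delta> * G" using Q geo_bounds by simp
    have "(real (inner_len (\<Delta> + j)))\<^sup>2 * (8 * (2 * prox_w (\<Delta> + j) + m) * D\<^sup>2 / tol (\<Delta> + j) + 4)
      \<le> H\<^sup>2 * x\<^sup>2 / b\<^sup>2 * ((Q * real \<Delta> * G + 4) / b\<^sup>2)"
      using T2 q p0 m sc_tol_pos[of M "\<Delta> + j"] by (intro mult_mono) (auto intro!: add_nonneg_nonneg less_imp_le)
    also have "\<dots> = w * x\<^sup>2" by (simp add: w_def power4_eq_xxxx power2_eq_square mult_ac)
    also have "\<dots> \<le> w * x" using l(1,2) w by (intro mult_left_mono) (simp_all add: power2_eq_square mult_left_le)
    finally show "(real (inner_len (\<Delta> + j)))\<^sup>2 * (8 * (2 * prox_w (\<Delta> + j) + m) * D\<^sup>2 / tol (\<Delta> + j) + 4) \<le> w * s ^ (M - j)"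
      by (simp add: x_def)
  qed
  also have "\<dots> = w * (\<Sum>j=1..M. s ^ (M - j))" by (simp add: sum_distrib_left)
  also have "\<dots> \<le> w * G" using sum_geo w by (intro mult_left_mono)
  finally have 2: "(\<Sum>j=1..M. (real (inner_len (\<Delta> + j)))\<^sup>2 * (8 * (2 * prox_w (\<Delta> + j) + m) * D\<^sup>2 / tol (\<Delta> + j) + 4)) \<le> w * G" .
  have "real \<Delta> * (H\<^sup>2 * (Q * (real \<Delta>)\<^sup>2 + 4)) * (1 / b ^ 4) + w * G = lo_const L m A D / b ^ 4"
    unfolding w_def lo_const_def H_def[symmetric] Q_def
    by (simp add: add_divide_distrib[symmetric]) (simp add: algebra_simps)
  thus ?thesis unfolding sum_split_at using 1 2 by linarith
qed

lemma sqrt_lam_power: "b = sqrt \<rho> ^ M" by (simp add: b_def s_def)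

lemmas sc_bounds = sc_tolerances sc_noise sc_weights[unfolded sqrt_lam_power]
  sc_sampling[unfolded sqrt_lam_power] sc_communication[unfolded sqrt_lam_power]
  sc_lo_calls[unfolded sqrt_lam_power]

end

end

text \<open>The second phase has the smallest length for which \<open>1 / lam ^ M\<close> reaches \<open>y\<close>; its length is
  logarithmic in \<open>y\<close> because \<open>ln (1 / lam) \<ge> 1 - lam\<close>.\<close>

lemma geometric_length:
  fixes lam y :: real
  assumes lam: "0 < lam" "lam < 1" and y: "1 \<le> y"
  obtains M :: nat where "y \<le> 1 / lam ^ M" "1 / lam ^ M \<le> y / lam" "real M \<le> ln y / (1 - lam) + 1"
proof -
  define l where "l = ln (1 / lam)"
  have l: "l > 0" using lam by (simp add: l_def ln_div)
  have l1: "1 - lam \<le> l" using ln_le_minus_one[of lam] lam by (simp add: l_def ln_div)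
  define M where "M = nat \<lceil>ln y / l\<rceil>"
  have ly: "0 \<le> ln y" using y by simp
  have M: "ln y / l \<le> real M" "real M \<le> ln y / l + 1"
    using ly l by (simp_all add: M_def real_nat_ceiling_ge)
  have pw: "ln (1 / lam ^ M) = real M * l" using lam by (simp add: l_def ln_div ln_realpow)
  have "ln y \<le> ln (1 / lam ^ M)" unfolding pw using M(1) l by (simp add: field_simps)
  hence 1: "y \<le> 1 / lam ^ M" using y lam by simp
  have "real M * l \<le> ln y + l" using M(2) l by (simp add: field_simps)
  also have "\<dots> = ln (y / lam)" using y lam by (simp add: l_def ln_div)
  finally have "ln (1 / lam ^ M) \<le> ln (y / lam)" by (simp only: pw)
  hence 2: "1 / lam ^ M \<le> y / lam" using y lam by (subst (asm) ln_le_cancel_iff) auto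
  have "ln y / l \<le> ln y / (1 - lam)" using l1 ly lam by (intro divide_left_mono mult_pos_pos) auto
  with M(2) have "real M \<le> ln y / (1 - lam) + 1" by linarith
  with 1 2 show ?thesis by (rule that)
qed

text \<open>The total weight is at least \<open>1 / lam ^ M\<close>, so that a second phase of logarithmic length suffices,
  and the lengths of the inner loops grow up to the order \<open>1 / sqrt \<epsilon>\<close>. Rounding up adds the
  number of iterations, which is logarithmic, to the samples and to the communication. It is the
  noise-free part of the samples, where the lower bound \<open>\<kappa>\<close> serves to replace \<open>1 + tau\<close> by a multiple
  of \<open>sqrt (L / m)\<close>, and it is of lower order than the communication.\<close>

lemma strongly_convex_case:
  fixes P :: "('m::finite, 'd::finite) problem"
  assumes P: "pds_problem P" and mu: "mu P > 0" and \<kappa>: "\<kappa> > 0" "Lt P / mu P \<ge> \<kappa>"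
  defines "D \<equiv> diameter (feas P)" and "C \<equiv> budget CARD('m) (norm (x0 P - xstar P)) (norm (zstar P))"
    and "A \<equiv> onorm (Aop P)" and "L \<equiv> Lt P" and "m \<equiv> mu P" and "\<sigma> \<equiv> noise P"
  shows "\<forall>\<^sub>F \<epsilon> in at_right 0. \<exists>N R c tol. N \<ge> 1 \<and> R > 0 \<and> c > 0 \<and> (\<forall>k t. tol k t > 0) \<and>
     (let a = ipds_choice P N R c tol in
      real (sampling_complexity a) \<le> 3 * (2 + 1 / sqrt \<kappa>) * (sqrt (L / m) * ln (L / \<epsilon>))
        + sampling_const L m * (C * L / lam_of L m) * (\<sigma>\<^sup>2 / \<epsilon>) \<and>
      real (communication_complexity a)
        \<le> 2 * (1 + communication_const L m) * sqrt (C * L / lam_of L m) * (A / sqrt \<epsilon>) \<and>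
      ipds_solves P W a \<epsilon> (lo_const L m A D * (C * L / lam_of L m)\<^sup>2 * (1 / \<epsilon>\<^sup>2)))"
proof -
  have L: "L > 0" and A: "A > 0" unfolding L_def A_def by (intro Lt_pos onorm_Aop_pos P)+
  have m: "m > 0" using mu by (simp add: m_def)
  have C: "C \<ge> 2" unfolding C_def by (rule budget_ge_2)
  define tau where "tau = tau_of L m"
  define lam where "lam = lam_of L m"
  define \<Delta> where "\<Delta> = phase_length L m"
  have tau: "tau > 0" unfolding tau_def by (rule tau_pos[OF L m])
  have lam: "0 < lam" "lam < 1" unfolding lam_def by (rule lam_bounds[OF L m])+
  have gap: "1 / (1 - lam) = 1 + tau"
    using tau by (simp add: lam_def lam_of_def tau_def[symmetric] field_simps)
  have \<Delta>: "\<Delta> \<ge> 1" unfolding \<Delta>_def by (rule phase_ge_1[OF L m])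
  define H where "H = sampling_const L m"
  have H: "H > 0"
    using L \<Delta> tau unfolding H_def sampling_const_def geo_bound_def \<Delta>_def[symmetric] tau_def[symmetric]
    by (intro add_pos_nonneg divide_pos_pos) auto
  have CL: "C * L > 0" using C L by simp
  have lim: "filterlim (\<lambda>\<epsilon>. K / \<epsilon>) at_top (at_right 0)" if "K > 0" for K :: real
    using that by real_asymp
  have lnL: "filterlim (\<lambda>\<epsilon>. ln (L / \<epsilon>)) at_top (at_right 0)"
    using L by real_asymp
  have "\<forall>\<^sub>F y in at_top. real \<Delta> + 1 + (1 + tau) * ln y \<le> A * sqrt y"
    using A tau by real_asymp
  hence ev3: "\<forall>\<^sub>F \<epsilon> in at_right 0. real \<Delta> + 1 + (1 + tau) * ln (C * L / \<epsilon>) \<le> A * sqrt (C * L / \<epsilon>)"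
    by (rule eventually_compose_filterlim[OF _ lim[OF CL]])
  have ev1: "\<forall>\<^sub>F \<epsilon> in at_right 0. 1 \<le> C * L / \<epsilon>"
    using lim[OF CL] by (simp add: filterlim_at_top)
  have ev2: "\<forall>\<^sub>F \<epsilon> in at_right 0. real \<Delta> + 2 + ln C \<le> ln (L / \<epsilon>)"
    using lnL by (simp add: filterlim_at_top)
  have ev0: "\<forall>\<^sub>F \<epsilon> in at_right 0. 0 < (\<epsilon> :: real)" by (simp add: eventually_at_right_less)
  from ev0 ev1 ev2 ev3 show ?thesis
  proof eventually_elim
    case (elim \<epsilon>)
    note e = elim(1) and y1 = elim(2) and logs = elim(3) and small = elim(4)
    define y where "y = C * L / \<epsilon>"
    obtain M where M: "y \<le> 1 / lam ^ M" "1 / lam ^ M \<le> y / lam" "real M \<le> ln y / (1 - lam) + 1"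
      using geometric_length[OF lam, of y] y1 by (auto simp: y_def)
    define b where "b = sqrt lam ^ M"
    have b: "b > 0" using lam by (simp add: b_def)
    have b2: "b\<^sup>2 = lam ^ M"
      using lam by (simp add: b_def power_mult[symmetric] mult.commute[of M]) (simp add: power_mult)
    define N where "N = \<Delta> + M"
    have N1: "N \<ge> 1" using \<Delta> by (simp add: N_def)
    \<comment> \<open>the second term keeps \<open>c\<close> positive without noise; it costs a single sample\<close>
    define c where "c = \<sigma>\<^sup>2 + b\<^sup>2 / H"
    have c: "c > 0" unfolding c_def using b H by (intro add_nonneg_pos) auto
    define tk where "tk = sc_tol L m M"
    have tk: "tk k > 0" for k unfolding tk_def by (rule sc_tol_pos[OF L m])
    define a where "a = ipds_choice P N 1 c (\<lambda>k t. tk k)"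
    note bounds = sc_bounds[OF L m A c, where M = M, folded lam_def \<Delta>_def H_def tk_def, folded b_def N_def]
    have lnC: "0 \<le> ln C" using C by simp
    have lny: "ln y = ln C + ln (L / \<epsilon>)"
      using C L e unfolding y_def times_divide_eq_right[symmetric] by (intro ln_mult_pos) auto
    have NM: "real N \<le> real \<Delta> + 1 + (1 + tau) * ln y"
      using M(3) unfolding N_def gap[symmetric] by simp
    have bi: "1 / b\<^sup>2 \<le> C * L / lam / \<epsilon>" unfolding b2 using M(2) by (simp add: y_def mult_ac)
    have bsq: "1 / b \<le> sqrt (C * L / lam / \<epsilon>)"
      using bi b by (intro real_le_rsqrt) (simp add: power_divide)
    have sampling: "real (sampling_complexity a) \<le> 3 * (2 + 1 / sqrt \<kappa>) * (sqrt (L / m) * ln (L / \<epsilon>))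
        + H * (C * L / lam) * (\<sigma>\<^sup>2 / \<epsilon>)"
    proof -
      have "real (sampling_complexity a) = (\<Sum>k=1..N. real (c_of L m N c k))"
        by (simp add: sampling_complexity_def a_def ipds_choice_def Let_def L_def m_def)
      also have "\<dots> \<le> real N + c * H / b\<^sup>2" by (rule bounds(4))
      also have "c * H / b\<^sup>2 = \<sigma>\<^sup>2 * H * (1 / b\<^sup>2) + 1"
        using b H by (simp add: c_def field_simps)
      also have "\<sigma>\<^sup>2 * H * (1 / b\<^sup>2) \<le> \<sigma>\<^sup>2 * H * (C * L / lam / \<epsilon>)"
        using bi H by (intro mult_left_mono) auto
      finally have 1: "real (sampling_complexity a) \<le> real N + 1 + H * (C * L / lam) * (\<sigma>\<^sup>2 / \<epsilon>)"
        by (simp add: mult_ac)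
      have l0: "0 \<le> ln (L / \<epsilon>)" and lD: "real \<Delta> + 2 \<le> ln (L / \<epsilon>)" and lC: "ln C \<le> ln (L / \<epsilon>)"
        using logs lnC by linarith+
      have "real N + 1 \<le> ln (L / \<epsilon>) + (1 + tau) * (2 * ln (L / \<epsilon>))"
      proof -
        have "(1 + tau) * ln y \<le> (1 + tau) * (2 * ln (L / \<epsilon>))"
          unfolding lny using lC tau by (intro mult_left_mono) auto
        thus ?thesis using NM lD by linarith
      qed
      also have "\<dots> \<le> 3 * (1 + tau) * ln (L / \<epsilon>)" using tau l0 by (simp add: algebra_simps)
      also have "\<dots> \<le> 3 * ((2 + 1 / sqrt \<kappa>) * sqrt (L / m)) * ln (L / \<epsilon>)"
      proof (intro mult_right_mono mult_left_mono l0)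
        have "sqrt \<kappa> \<le> sqrt (L / m)" using \<kappa>(2) by (simp add: L_def m_def)
        hence "1 \<le> 1 / sqrt \<kappa> * sqrt (L / m)" using \<kappa>(1) by (simp add: field_simps)
        thus "1 + tau \<le> (2 + 1 / sqrt \<kappa>) * sqrt (L / m)" 
          unfolding tau_def tau_of_def distrib_right by linarith
      qed simp
      finally have "real N + 1 \<le> 3 * (2 + 1 / sqrt \<kappa>) * (sqrt (L / m) * ln (L / \<epsilon>))" by (simp only: mult_ac)
      with 1 show ?thesis by linarith
    qed
    have communication: "real (communication_complexity a)
        \<le> 2 * (1 + communication_const L m) * sqrt (C * L / lam) * (A / sqrt \<epsilon>)"
    proof -
      have K0: "0 \<le> communication_const L m" using L by (simp add: communication_const_def)
      have "real N \<le> A * sqrt y" using NM small by (simp add: y_def)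
      also have "sqrt y \<le> 1 / b"
      proof (rule real_le_lsqrt)
        show "y \<le> (1 / b)\<^sup>2" using M(1) by (simp add: power_divide b2)
      qed (use b in simp)
      finally have NA: "real N \<le> A / b" using A by simp
      have "real (communication_complexity a) = 2 * (\<Sum>k=1..N. real (T_of L m A 1 k))"
        by (simp add: communication_complexity_def a_def ipds_choice_def Let_def L_def m_def A_def)
      also have "\<dots> \<le> 2 * (real N + A * communication_const L m / b)"
        using bounds(5) by (intro mult_left_mono) auto
      also have "\<dots> \<le> 2 * (A / b + A * communication_const L m / b)" using NA by simp
      also have "\<dots> = 2 * (1 + communication_const L m) * A * (1 / b)"
        by (simp add: add_divide_distrib algebra_simps)
      also have "\<dots> \<le> 2 * (1 + communication_const L m) * A * sqrt (C * L / lam / \<epsilon>)"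
        using bsq A K0 by (intro mult_left_mono) auto
      finally show ?thesis by (simp add: real_sqrt_divide real_sqrt_mult mult_ac)
    qed
    have solves: "ipds_solves P W a \<epsilon> (lo_const L m A D * (C * L / lam)\<^sup>2 * (1 / \<epsilon>\<^sup>2))"
      unfolding a_def
    proof (rule ipds_solves_of_budget[OF P tk N1], unfold L_def[symmetric] m_def[symmetric] A_def[symmetric]
        D_def[symmetric] C_def[symmetric] \<sigma>_def[symmetric])
      show "(\<Sum>k=1..N. beta_of L m k * tk k) \<le> 2 * L" by (rule bounds(1))
      have "\<sigma>\<^sup>2 * (\<Sum>k=1..N. beta_of L m k / (p_of L m k * real (c_of L m N c k))) \<le> \<sigma>\<^sup>2 * (2 * L / c)"
        using bounds(2) by (intro mult_left_mono) auto
      also have "\<dots> \<le> c * (2 * L / c)" using L c H by (intro mult_right_mono) (auto simp: c_def)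
      finally show "\<sigma>\<^sup>2 * (\<Sum>k=1..N. beta_of L m k / (p_of L m k * real (c_of L m N c k))) \<le> 2 * L"
        using c by simp
      have "y \<le> (\<Sum>k=1..N. beta_of L m k)" using M(1) bounds(3) unfolding b2 by linarith
      hence "y * \<epsilon> \<le> (\<Sum>k=1..N. beta_of L m k) * \<epsilon>" using e by (intro mult_right_mono) auto
      thus "L * C \<le> (\<Sum>k=1..N. beta_of L m k) * \<epsilon>" using e by (simp add: y_def mult.commute)
      have l0: "0 \<le> lo_const L m A D"
        using L m A tau unfolding lo_const_def geo_bound_def tau_def[symmetric]
        by (intro mult_nonneg_nonneg add_nonneg_nonneg divide_nonneg_pos) auto
      have "(\<Sum>k=1..N. (real (T_of L m A 1 k))\<^sup>2 * (8 * (2 * p_of L m k + m) * D\<^sup>2 / tk k + 4))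
        \<le> lo_const L m A D / b ^ 4" by (rule bounds(6))
      also have "\<dots> = lo_const L m A D * (1 / b\<^sup>2)\<^sup>2" by (simp add: power_divide)
      also have "\<dots> \<le> lo_const L m A D * (C * L / lam / \<epsilon>)\<^sup>2"
        using bi l0 by (intro mult_left_mono power_mono) auto
      also have "\<dots> = lo_const L m A D * (C * L / lam)\<^sup>2 * (1 / \<epsilon>\<^sup>2)"
        by (simp add: power_divide power_mult_distrib)
      finally show "(\<Sum>k=1..N. (real (T_of L m A 1 k))\<^sup>2 * (8 * (2 * p_of L m k + m) * D\<^sup>2 / tk k + 4))
        \<le> lo_const L m A D * (C * L / lam)\<^sup>2 * (1 / \<epsilon>\<^sup>2)" .
    qed
    show ?case
      by (rule exI[of _ N], rule exI[of _ 1], rule exI[of _ c], rule exI[of _ "\<lambda>k t. tk k"])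
         (use N1 c tk sampling communication solves in \<open>simp add: a_def Let_def H_def lam_def\<close>)
  qed
qed

(* Each hidden constant is a function of the data that are not displayed in the respective bound
   (the numbers of workers and of coordinates enter through the types). "As \<epsilon> \<rightarrow> 0" is the
   filter at_right 0. In part (ii), \<kappa> is any positive lower bound for the condition number. *)
theorem theorem1:
  shows
   "(\<exists>K1 K1' K2 K3. \<forall>P :: ('m::finite, 'd::finite) problem.
      pds_problem P \<and> mu P = 0 \<longrightarrow>
      (let D = diameter (feas P); r = norm (x0 P - xstar P); Z = norm (zstar P);
           A = onorm (Aop P); L = Lt P; \<sigma> = noise P in
       \<forall>\<^sub>F \<epsilon> in at_right 0.
         \<exists>N R c tol. N \<ge> 1 \<and> R > 0 \<and> c > 0 \<and> (\<forall>k t. tol k t > 0) \<and>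
           (let a = ipds_choice P N R c tol in
            real (sampling_complexity a)
              \<le> K1 D r Z A * sqrt (L / \<epsilon>) + K1' D r Z A * (\<sigma>\<^sup>2 / \<epsilon>\<^sup>2) \<and>
            real (communication_complexity a) \<le> K2 D r Z L \<sigma> * (A / \<epsilon>) \<and>
            ipds_solves P TYPE('w) a \<epsilon> (K3 D r Z A L \<sigma> * (1 / \<epsilon>\<^sup>2)))))
    \<and>
    (\<forall>\<kappa>>0. \<exists>K1 K1' K2 K3. \<forall>P :: ('m::finite, 'd::finite) problem.
      pds_problem P \<and> mu P > 0 \<and> Lt P / mu P \<ge> \<kappa> \<longrightarrow>
      (let D = diameter (feas P); r = norm (x0 P - xstar P); Z = norm (zstar P);
           A = onorm (Aop P); L = Lt P; \<sigma> = noise P; m = mu P in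
       \<forall>\<^sub>F \<epsilon> in at_right 0.
         \<exists>N R c tol. N \<ge> 1 \<and> R > 0 \<and> c > 0 \<and> (\<forall>k t. tol k t > 0) \<and>
           (let a = ipds_choice P N R c tol in
            real (sampling_complexity a)
              \<le> K1 D r Z A * (sqrt (L / m) * ln (L / \<epsilon>)) + K1' D r Z A L m * (\<sigma>\<^sup>2 / \<epsilon>) \<and>
            real (communication_complexity a) \<le> K2 D r Z L m \<sigma> * (A / sqrt \<epsilon>) \<and>
            ipds_solves P TYPE('w) a \<epsilon> (K3 D r Z A L m \<sigma> * (1 / \<epsilon>\<^sup>2)))))"
proof (intro conjI allI impI, goal_cases)
  case 1
  let ?C = "\<lambda>r Z. budget CARD('m) r Z"
  show ?case
    using convex_case[where ?'m = 'm and ?'d = 'd and W = "TYPE('w)"]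
    by (intro exI[of _ "\<lambda>D r Z A. 4 * sqrt (2 * ?C r Z)"] exI[of _ "\<lambda>D r Z A. 16 * (?C r Z)\<^sup>2"]
          exI[of _ "\<lambda>D r Z L \<sigma>. 32 * ?C r Z"]
          exI[of _ "\<lambda>D r Z A L \<sigma>. 64 * (?C r Z)\<^sup>2 * (256 * D\<^sup>2 + 16) * A\<^sup>2"] allI impI)
       (simp only: Let_def)
next
  case (2 \<kappa>)
  let ?C = "\<lambda>r Z. budget CARD('m) r Z"
  show ?case
    using strongly_convex_case[where ?'m = 'm and ?'d = 'd and W = "TYPE('w)", OF _ _ 2]
    by (intro exI[of _ "\<lambda>D r Z A. 3 * (2 + 1 / sqrt \<kappa>)"]
          exI[of _ "\<lambda>D r Z A L m. sampling_const L m * (?C r Z * L / lam_of L m)"]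
          exI[of _ "\<lambda>D r Z L m \<sigma>. 2 * (1 + communication_const L m) * sqrt (?C r Z * L / lam_of L m)"]
          exI[of _ "\<lambda>D r Z A L m \<sigma>. lo_const L m A D * (?C r Z * L / lam_of L m)\<^sup>2"] allI impI)
       (simp only: Let_def)
qed

end
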